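(* Let $R$ be a numerical semigroup ring which has minimal multiplicity, and let $\mathfrak{m}$ be its maximal ideal. Given an $R$-module $M$, the following conditions are equivalent: \begin{enumerate} \item[(i)] $M$ is full-trace Ulrich. \item[(ii)] $M\cong \mathfrak{m}\oplus N$ for some $R$-module $N$ which is either zero or an Ulrich $R$-module. \end{enumerate}
   Context: Modules are finitely generated. A numerical semigroup ring is a ring of the form $k[\![t^{a_1},\ldots,t^{a_n}]\!]\subseteq k[\![t]\!]$, where $k$ is a field and $a_1,\dots,a_n$ are positive integers with greatest common divisor $1$; it is a one-dimensional Cohen-Macaulay local domain. For a module $M$ over a Cohen-Macaulay local ring $(R,\mathfrak{m})$, $\mu_R(M)$ is the minimal number of generators and $\mathrm{e}_R(M)$ is the Hilbert-Samuel multiplicity with respect to $\mathfrak{m}$; $\mathrm{e}(R)=\mathrm{e}_R(R)$. $R$ has minimal multiplicity if $\mathrm{e}(R)=\mu_R(\mathfrak{m})-\dim(R)+1$. $M$ is maximal Cohen-Macaulay if $M\neq 0$ and $\operatorname{depth}_R(M)=\dim_R(M)=\dim(R)$. An Ulrich $R$-module is a maximal Cohen-Macaulay $R$-module $M$ with $\mu_R(M)=\mathrm{e}_R(M)$. The trace is $\operatorname{tr}_R(M)=\sum_{f\in\operatorname{Hom}_R(M,R)}\operatorname{im}(f)$. $M$ is full-trace Ulrich if $M$ is an Ulrich $R$-module with $\operatorname{tr}_R(M)=\mathfrak{m}$.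
   Formalization: The case R = k[[t]] is excluded: it has minimal multiplicity, but M = m (with N = 0) satisfies (ii) while its trace is R, not m, so (i) fails. N is taken on the same underlying type as M, which is no restriction up to isomorphism. *)

theory Defs
  imports
    Complex_Main
    "HOL-Library.Extended_Nat"
    "HOL-Library.FuncSet"
    "HOL-Computational_Algebra.Formal_Power_Series"
    "HOL-Algebra.Algebra"
    "HOL-Algebra.Algebraic_Closure_Type"
begin

section \<open>Modules over a commutative ring\<close>

text \<open>
  Modules are records as in \<^locale>\<open>module\<close>. Such a record extends a ring record, but its
  fields \<open>mult\<close> and \<open>one\<close> carry no information and are never used;
  the constructions below fill them arbitrarily.
\<close>

definition gen_submodule :: "('a, 'r) ring_scheme \<Rightarrow> ('a, 'b, 'm) module_scheme \<Rightarrow> 'b set \<Rightarrow> 'b set"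
  where "gen_submodule R M S = (\<lambda>H. submodule H R M) hull S"

definition fg_module :: "('a, 'r) ring_scheme \<Rightarrow> ('a, 'b, 'm) module_scheme \<Rightarrow> bool"
  where "fg_module R M \<longleftrightarrow>
    module R M \<and> (\<exists>S. finite S \<and> S \<subseteq> carrier M \<and> gen_submodule R M S = carrier M)"

definition min_num_generators :: "('a, 'r) ring_scheme \<Rightarrow> ('a, 'b, 'm) module_scheme \<Rightarrow> nat"
  where "min_num_generators R M =
    (LEAST n. \<exists>S. finite S \<and> card S = n \<and> S \<subseteq> carrier M \<and> gen_submodule R M S = carrier M)"

definition ideal_module :: "('a, 'r) ring_scheme \<Rightarrow> 'a set \<Rightarrow> ('a, 'a) module"
  where "ideal_module R I =
    \<lparr>carrier = I, monoid.mult = monoid.mult R, one = \<one>\<^bsub>R\<^esub>,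
     ring.zero = \<zero>\<^bsub>R\<^esub>, add = ring.add R, module.smult = monoid.mult R\<rparr>"

abbreviation regular_module :: "('a, 'r) ring_scheme \<Rightarrow> ('a, 'a) module"
  where "regular_module R \<equiv> ideal_module R (carrier R)"

definition direct_sum ::
    "('a, 'b, 'm) module_scheme \<Rightarrow> ('a, 'c, 'n) module_scheme \<Rightarrow> ('a, 'b \<times> 'c) module"
  where "direct_sum M N =
    \<lparr>carrier = carrier M \<times> carrier N,
     monoid.mult = (\<lambda>(x, y) (x', y'). (x \<otimes>\<^bsub>M\<^esub> x', y \<otimes>\<^bsub>N\<^esub> y')),
     one = (\<one>\<^bsub>M\<^esub>, \<one>\<^bsub>N\<^esub>),
     ring.zero = (\<zero>\<^bsub>M\<^esub>, \<zero>\<^bsub>N\<^esub>),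
     add = (\<lambda>(x, y) (x', y'). (x \<oplus>\<^bsub>M\<^esub> x', y \<oplus>\<^bsub>N\<^esub> y')),
     module.smult = (\<lambda>r (x, y). (r \<odot>\<^bsub>M\<^esub> x, r \<odot>\<^bsub>N\<^esub> y))\<rparr>"

text \<open>The quotient module is built on cosets in the same way as \<^const>\<open>FactRing\<close>.\<close>

definition quotient_module :: "('a, 'b, 'm) module_scheme \<Rightarrow> 'b set \<Rightarrow> ('a, 'b set) module"
  where "quotient_module M H =
    \<lparr>carrier = a_rcosets\<^bsub>M\<^esub> H, monoid.mult = rcoset_mult M H, one = H +>\<^bsub>M\<^esub> \<one>\<^bsub>M\<^esub>,
     ring.zero = H, add = set_add M, module.smult = (\<lambda>r C. \<Union>x\<in>C. H +>\<^bsub>M\<^esub> (r \<odot>\<^bsub>M\<^esub> x))\<rparr>"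

definition mod_hom ::
    "('a, 'r) ring_scheme \<Rightarrow> ('a, 'b, 'm) module_scheme \<Rightarrow> ('a, 'c, 'n) module_scheme \<Rightarrow> ('b \<Rightarrow> 'c) set"
  where "mod_hom R M N = {f \<in> carrier M \<rightarrow> carrier N.
    (\<forall>x\<in>carrier M. \<forall>y\<in>carrier M. f (x \<oplus>\<^bsub>M\<^esub> y) = f x \<oplus>\<^bsub>N\<^esub> f y) \<and>
    (\<forall>r\<in>carrier R. \<forall>x\<in>carrier M. f (r \<odot>\<^bsub>M\<^esub> x) = r \<odot>\<^bsub>N\<^esub> f x)}"

definition mod_isomorphic ::
    "('a, 'r) ring_scheme \<Rightarrow> ('a, 'b, 'm) module_scheme \<Rightarrow> ('a, 'c, 'n) module_scheme \<Rightarrow> bool"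
  where "mod_isomorphic R M N \<longleftrightarrow> (\<exists>f \<in> mod_hom R M N. bij_betw f (carrier M) (carrier N))"

definition annihilator :: "('a, 'r) ring_scheme \<Rightarrow> ('a, 'b, 'm) module_scheme \<Rightarrow> 'a set"
  where "annihilator R M = {r \<in> carrier R. \<forall>x\<in>carrier M. r \<odot>\<^bsub>M\<^esub> x = \<zero>\<^bsub>M\<^esub>}"

definition ideal_mult ::
    "('a, 'r) ring_scheme \<Rightarrow> 'a set \<Rightarrow> ('a, 'b, 'm) module_scheme \<Rightarrow> 'b set"
  where "ideal_mult R I M = gen_submodule R M {r \<odot>\<^bsub>M\<^esub> x | r x. r \<in> I \<and> x \<in> carrier M}"

text \<open>The trace is the sum of the ideals \<open>f ` carrier M\<close>, i.e. the ideal they generate.\<close>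

definition mod_trace :: "('a, 'r) ring_scheme \<Rightarrow> ('a, 'b, 'm) module_scheme \<Rightarrow> 'a set"
  where "mod_trace R M = genideal R (\<Union>f \<in> mod_hom R M (regular_module R). f ` carrier M)"


section \<open>Length, dimension, depth and multiplicity\<close>

text \<open>
  The supremum of all \<open>n\<close> admitting a strict chain \<open>C 0 \<subset> \<dots> \<subset> C n\<close> of sets satisfying \<open>P\<close>.
  It is \<open>0\<close> if no set satisfies \<open>P\<close>; hence the zero ring gets dimension \<open>0\<close>
  instead of the customary \<open>-\<infinity>\<close>. Dimensions of zero modules play no role below.
\<close>

definition sup_chain_length :: "('a set \<Rightarrow> bool) \<Rightarrow> enat"
  where "sup_chain_length P =
    Sup {enat n | n. \<exists>C :: nat \<Rightarrow> 'a set. (\<forall>i\<le>n. P (C i)) \<and> (\<forall>i<n. C i \<subset> C (Suc i))}"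

definition krull_dim :: "('a, 'r) ring_scheme \<Rightarrow> enat"
  where "krull_dim R = sup_chain_length (\<lambda>P. primeideal P R)"

definition module_dim :: "('a, 'r) ring_scheme \<Rightarrow> ('a, 'b, 'm) module_scheme \<Rightarrow> enat"
  where "module_dim R M = krull_dim (R Quot annihilator R M)"

definition module_length :: "('a, 'r) ring_scheme \<Rightarrow> ('a, 'b, 'm) module_scheme \<Rightarrow> enat"
  where "module_length R M = sup_chain_length (\<lambda>H. submodule H R M)"

text \<open>A regular sequence on \<open>M\<close>: each \<open>xs ! i\<close> is a nonzerodivisor on
  \<open>M / (xs ! 0, \<dots>, xs ! (i - 1)) M\<close>, and \<open>M \<noteq> (xs) M\<close>.\<close>

definition regular_sequence ::
    "('a, 'r) ring_scheme \<Rightarrow> ('a, 'b, 'm) module_scheme \<Rightarrow> 'a list \<Rightarrow> bool"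
  where "regular_sequence R M xs \<longleftrightarrow>
    set xs \<subseteq> carrier R \<and>
    (\<forall>i<length xs.
       let Q = quotient_module M (ideal_mult R (genideal R (set (take i xs))) M)
       in \<forall>y\<in>carrier Q. (xs ! i) \<odot>\<^bsub>Q\<^esub> y = \<zero>\<^bsub>Q\<^esub> \<longrightarrow> y = \<zero>\<^bsub>Q\<^esub>) \<and>
    ideal_mult R (genideal R (set xs)) M \<noteq> carrier M"

definition depth :: "('a, 'r) ring_scheme \<Rightarrow> 'a set \<Rightarrow> ('a, 'b, 'm) module_scheme \<Rightarrow> enat"
  where "depth R \<mm> M = Sup {enat (length xs) | xs. set xs \<subseteq> \<mm> \<and> regular_sequence R M xs}"

text \<open>
  The Hilbert--Samuel multiplicity
  \<open>lim d! / n\<^sup>d * length (M / \<mm>\<^sup>n M)\<close> with \<open>d = dim R\<close>. Normalising by \<open>dim M\<close> instead of \<open>dim R\<close>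
  makes no difference for maximal Cohen--Macaulay modules, where it is used.
  The power \<open>\<mm>\<^sup>n\<close> is taken in the monoid of ideals.
\<close>

definition multiplicity_mod ::
    "('a, 'r) ring_scheme \<Rightarrow> 'a set \<Rightarrow> ('a, 'b, 'm) module_scheme \<Rightarrow> real"
  where "multiplicity_mod R \<mm> M =
    (let d = the_enat (krull_dim R) in
     lim (\<lambda>n. fact d *
       real (the_enat (module_length R
         (quotient_module M (ideal_mult R (\<mm> [^]\<^bsub>ideals_set R\<^esub> n) M)))) / real n ^ d))"


section \<open>Ulrich modules\<close>

text \<open>In the following definitions \<open>\<mm>\<close> is the maximal ideal of the local ring \<open>R\<close>.\<close>

definition minimal_multiplicity :: "('a, 'r) ring_scheme \<Rightarrow> 'a set \<Rightarrow> bool"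
  where "minimal_multiplicity R \<mm> \<longleftrightarrow>
    multiplicity_mod R \<mm> (regular_module R) =
      real (min_num_generators R (ideal_module R \<mm>)) - real (the_enat (krull_dim R)) + 1"

definition maximal_cohen_macaulay ::
    "('a, 'r) ring_scheme \<Rightarrow> 'a set \<Rightarrow> ('a, 'b, 'm) module_scheme \<Rightarrow> bool"
  where "maximal_cohen_macaulay R \<mm> M \<longleftrightarrow>
    fg_module R M \<and> carrier M \<noteq> {\<zero>\<^bsub>M\<^esub>} \<and>
    depth R \<mm> M = module_dim R M \<and> module_dim R M = krull_dim R"

definition ulrich :: "('a, 'r) ring_scheme \<Rightarrow> 'a set \<Rightarrow> ('a, 'b, 'm) module_scheme \<Rightarrow> bool"
  where "ulrich R \<mm> M \<longleftrightarrow>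
    maximal_cohen_macaulay R \<mm> M \<and> real (min_num_generators R M) = multiplicity_mod R \<mm> M"

definition full_trace_ulrich ::
    "('a, 'r) ring_scheme \<Rightarrow> 'a set \<Rightarrow> ('a, 'b, 'm) module_scheme \<Rightarrow> bool"
  where "full_trace_ulrich R \<mm> M \<longleftrightarrow> ulrich R \<mm> M \<and> mod_trace R M = \<mm>"


section \<open>Numerical semigroup rings\<close>

text \<open>
  For a finite set \<open>A\<close> of positive integers, \<open>k[[t\<^sup>a | a \<in> A]]\<close> consists of all formal sums
  \<open>\<Sum>\<^sub>\<nu> c \<nu> * (\<Prod>a\<in>A. (t\<^sup>a) ^ \<nu> a)\<close> over the exponent vectors \<open>\<nu>\<close>; below, the terms of
  degree \<open>m\<close> are collected, of which there are finitely many because \<open>0 \<notin> A\<close>.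
\<close>

definition semigroup_series :: "nat set \<Rightarrow> 'k::field fps set"
  where "semigroup_series A =
    {Abs_fps (\<lambda>m. \<Sum>\<nu> | \<nu> \<in> A \<rightarrow>\<^sub>E UNIV \<and> (\<Sum>a\<in>A. \<nu> a * a) = m. c \<nu>) | c :: (nat \<Rightarrow> nat) \<Rightarrow> 'k. True}"

definition numerical_semigroup_ring :: "nat set \<Rightarrow> 'k::field fps ring"
  where "numerical_semigroup_ring A = ring_of_type_algebra\<lparr>carrier := semigroup_series A\<rparr>"

text \<open>
  The ring \<open>k[[t]]\<close> itself is of this form (e.g. \<open>A = {1}\<close>) and has minimal multiplicity, but there
  \<open>\<mm> = t k[[t]]\<close> is free of rank one and so has trace \<open>k[[t]] \<noteq> \<mm>\<close>. Thus \<open>\<mm>\<close>, which is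
  of the form \<open>\<mm> \<oplus> N\<close> with \<open>N = 0\<close>, is not full-trace Ulrich over \<open>k[[t]]\<close>. Characterisations of
  full-trace Ulrich modules as modules \<open>\<mm> \<oplus> N\<close> therefore need \<open>R \<noteq> k[[t]]\<close>, i.e.
  \<^term>\<open>carrier R \<noteq> UNIV\<close>.
\<close>

text \<open>The semigroup generated by \<open>A\<close> controls the support of the series.\<close>

lemma semigroup_series_eq_support:
  assumes "finite A" "0 \<notin> A"
  shows "semigroup_series A =
    {f :: 'k::field fps. \<forall>m. fps_nth f m \<noteq> 0 \<longrightarrow> (\<exists>\<nu>. (\<Sum>a\<in>A. \<nu> a * a) = m)}"
    (is "_ = ?S")
proof -
  define E where "E m = {\<nu> :: nat \<Rightarrow> nat. \<nu> \<in> A \<rightarrow>\<^sub>E UNIV \<and> (\<Sum>a\<in>A. \<nu> a * a) = m}" for m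
  have fin: "finite (E m)" for m
  proof (rule finite_subset)
    show "E m \<subseteq> A \<rightarrow>\<^sub>E {..m}"
    proof
      fix \<nu> assume \<nu>: "\<nu> \<in> E m"
      have "\<nu> a \<le> m" if "a \<in> A" for a
      proof -
        have "\<nu> a \<le> \<nu> a * a" using that assms by (cases a) auto
        also have "\<dots> \<le> (\<Sum>a\<in>A. \<nu> a * a)"
          using that assms by (intro member_le_sum) auto
        finally show ?thesis using \<nu> by (simp add: E_def)
      qed
      then show "\<nu> \<in> A \<rightarrow>\<^sub>E {..m}" using \<nu> by (auto simp: E_def PiE_def)
    qed
    show "finite (A \<rightarrow>\<^sub>E {..m})" using assms by (intro finite_PiE) auto
  qed
  have restr: "restrict \<nu> A \<in> E (\<Sum>a\<in>A. \<nu> a * a)" for \<nu>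
    by (auto simp: E_def)
  show ?thesis
  proof
    show "semigroup_series A \<subseteq> ?S"
    proof
      fix f :: "'k fps" assume "f \<in> semigroup_series A"
      then obtain c where c: "f = Abs_fps (\<lambda>m. \<Sum>\<nu>\<in>E m. c \<nu>)"
        by (auto simp: semigroup_series_def E_def)
      have "E m \<noteq> {}" if "fps_nth f m \<noteq> 0" for m
        using that by (auto simp: c)
      then show "f \<in> ?S" by (auto simp: E_def)
    qed
    show "?S \<subseteq> semigroup_series A"
    proof
      fix f :: "'k fps" assume f: "f \<in> ?S"
      define e where "e m = (SOME \<nu>. \<nu> \<in> E m)" for m
      define c where "c \<nu> = (let m = (\<Sum>a\<in>A. \<nu> a * a) in if \<nu> = e m then fps_nth f m else 0)" for \<nu>
      have "fps_nth f m = (\<Sum>\<nu>\<in>E m. c \<nu>)" for m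
      proof -
        have "(\<Sum>\<nu>\<in>E m. c \<nu>) = (\<Sum>\<nu>\<in>E m. if \<nu> = e m then fps_nth f m else 0)"
          by (intro sum.cong) (auto simp: c_def E_def Let_def)
        also have "\<dots> = (if e m \<in> E m then fps_nth f m else 0)"
          using fin by simp
        also have "\<dots> = fps_nth f m"
        proof (cases "fps_nth f m = 0")
          case False
          then obtain \<nu> where "(\<Sum>a\<in>A. \<nu> a * a) = m" using f by blast
          then have "restrict \<nu> A \<in> E m" using restr[of \<nu>] by simp
          then have "e m \<in> E m" unfolding e_def by (rule someI[of "\<lambda>\<nu>. \<nu> \<in> E m"])
          then show ?thesis by simp
        qed simp
        finally show ?thesis by simp
      qed
      then have "f = Abs_fps (\<lambda>m. \<Sum>\<nu>\<in>E m. c \<nu>)"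
        by (auto simp: fps_eq_iff)
      then show "f \<in> semigroup_series A"
        unfolding semigroup_series_def E_def by blast
    qed
  qed
qed

lemma domain_numerical_semigroup_ring:
  assumes "finite A" "0 \<notin> A"
  shows "domain (numerical_semigroup_ring A :: 'k::field fps ring)"
proof -
  define H where "H = {m. \<exists>\<nu> :: nat \<Rightarrow> nat. (\<Sum>a\<in>A. \<nu> a * a) = m}"
  define S where "S = (semigroup_series A :: 'k fps set)"
  have S: "S = {f. \<forall>m. fps_nth f m \<noteq> 0 \<longrightarrow> m \<in> H}"
    using semigroup_series_eq_support[OF assms] by (simp add: S_def H_def)
  have H0: "0 \<in> H" by (auto simp: H_def intro!: exI[of _ "\<lambda>_. 0"])
  have Hadd: "m + n \<in> H" if mn: "m \<in> H" "n \<in> H" for m n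
  proof -
    obtain \<mu> \<nu> :: "nat \<Rightarrow> nat" where "(\<Sum>a\<in>A. \<mu> a * a) = m" "(\<Sum>a\<in>A. \<nu> a * a) = n"
      using mn by (auto simp: H_def)
    then have "(\<Sum>a\<in>A. (\<mu> a + \<nu> a) * a) = m + n"
      by (simp add: sum.distrib algebra_simps)
    then show ?thesis unfolding H_def by (intro CollectI exI[of _ "\<lambda>a. \<mu> a + \<nu> a"])
  qed
  have one: "1 \<in> S" and zero: "0 \<in> S" using H0 by (auto simp: S)
  have add: "f + g \<in> S" and uminus: "- f \<in> S" if "f \<in> S" "g \<in> S" for f g
    using that by (force simp: S)+
  have mult: "f * g \<in> S" if fg: "f \<in> S" "g \<in> S" for f g
  proof -
    have "m \<in> H" if nz: "fps_nth (f * g) m \<noteq> 0" for m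
    proof -
      obtain i where "i \<le> m" "fps_nth f i * fps_nth g (m - i) \<noteq> 0"
        using nz unfolding fps_mult_nth
        by (metis (no_types, lifting) atLeastAtMost_iff sum.not_neutral_contains_not_neutral)
      then have "i \<in> H" "m - i \<in> H" using fg by (auto simp: S)
      from Hadd[OF this] show ?thesis using \<open>i \<le> m\<close> by simp
    qed
    then show ?thesis by (simp add: S)
  qed
  define R where "R = (numerical_semigroup_ring A :: 'k fps ring)"
  have R [simp]: "carrier R = S" "monoid.mult R = (*)" "\<one>\<^bsub>R\<^esub> = 1" "\<zero>\<^bsub>R\<^esub> = 0" "ring.add R = (+)"
    by (simp_all add: R_def numerical_semigroup_ring_def ring_of_type_algebra_def S_def)
  have "cring R"
  proof (intro cringI abelian_groupI comm_monoidI)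
    show "\<exists>y\<in>carrier R. y \<oplus>\<^bsub>R\<^esub> x = \<zero>\<^bsub>R\<^esub>" if "x \<in> carrier R" for x
      using that uminus by (intro bexI[of _ "- x"]) auto
  qed (simp_all add: one zero add mult algebra_simps)
  then show ?thesis
    unfolding R_def[symmetric] by (rule domain.intro) (simp add: domain_axioms_def)
qed

lemma module_ideal_module:
  assumes "cring R" "ideal I R"
  shows "module R (ideal_module R I)"
proof -
  interpret cring R by fact
  interpret I: ideal I R by fact
  show ?thesis
  proof (intro moduleI abelian_groupI)
    show "\<exists>y\<in>carrier (ideal_module R I). y \<oplus>\<^bsub>ideal_module R I\<^esub> x = \<zero>\<^bsub>ideal_module R I\<^esub>"
      if "x \<in> carrier (ideal_module R I)" for x
      using that by (intro bexI[of _ "\<ominus>\<^bsub>R\<^esub> x"]) (auto simp: ideal_module_def l_neg)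
  qed (auto simp: ideal_module_def a_ac m_ac l_distr r_distr I.I_l_closed is_cring)
qed

lemma module_direct_sum:
  assumes "module R M" "module R N"
  shows "module R (direct_sum M N)"
proof -
  interpret M: module R M by fact
  interpret N: module R N by fact
  show ?thesis
  proof (intro moduleI abelian_groupI)
    show "\<exists>y\<in>carrier (direct_sum M N). y \<oplus>\<^bsub>direct_sum M N\<^esub> x = \<zero>\<^bsub>direct_sum M N\<^esub>"
      if "x \<in> carrier (direct_sum M N)" for x
      using that
      by (intro bexI[of _ "(\<ominus>\<^bsub>M\<^esub> fst x, \<ominus>\<^bsub>N\<^esub> snd x)"])
         (auto simp: direct_sum_def M.M.l_neg N.M.l_neg)
  qed (auto simp: direct_sum_def M.M.a_ac N.M.a_ac M.smult_l_distr N.smult_l_distr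
        M.smult_r_distr N.smult_r_distr M.smult_assoc1 N.smult_assoc1 M.is_cring)
qed

end

theory Submission
  imports Defs
begin

text \<open>
  Let \<open>w \<in> \<mm>\<close> have least possible order. Since \<open>\<mm>\<^sup>n\<^sup>+\<^sup>c \<subseteq> w\<^sup>n R \<subseteq> \<mm>\<^sup>n\<close> for a constant \<open>c\<close>, a finitely
  generated torsion-free module \<open>M\<close> has multiplicity \<open>length (M / w M)\<close>, while \<open>\<mu>(M) = length (M / \<mm> M)\<close>
  by Nakayama; hence a nonzero \<open>M\<close> is Ulrich iff it is torsion-free with \<open>\<mm> M = w M\<close>. By additivity of length,
  \<open>e(\<mm>) = e(R)\<close>, so minimal multiplicity says that \<open>\<mm>\<close> is Ulrich.

  If \<open>M\<close> is Ulrich with trace \<open>\<mm>\<close>, then some \<open>f : M \<rightarrow> R\<close> with image in \<open>\<mm>\<close> takes a value \<open>w = f m\<^sub>0\<close> of least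
  order, and \<open>\<mm> M = w M\<close> provides a section of \<open>f : M \<rightarrow> \<mm>\<close>. Conversely \<open>\<mm> \<oplus> N\<close> is Ulrich, its trace contains
  \<open>\<mm>\<close>, and a homomorphism to \<open>R\<close> hitting a unit would give \<open>\<mm> = w R\<close>, i.e. \<open>R = k[[t]]\<close>.
\<close>

section \<open>Chains of sets\<close>

text \<open>Length is a supremum over strict chains with values in the extended naturals, so
  additivity comes from cutting and joining chains, and finiteness has to be established wherever
  lengths are cancelled. The reduction is found through orders of power series and not by a generic
  choice, so k may be finite. If e is the least order in \<open>\<mm>\<close>, every element of the
  n-th power of \<open>\<mm>\<close> has order at least n e. If all exponents from c on lie in the
  semigroup, a series of order at least ord(y) + c is a multiple of y inside R; this c is the shift
  constant. The trace is only the ideal generated by the values of the homomorphisms, so an element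
  of least order in it might a priori be a mere combination of values. But values that all have
  order greater than e generate an ideal without t^e, so some single homomorphism already attains e.
  This makes it possible to split M with one map.\<close>

lemma enat_eqI:
  assumes "\<And>n. enat n \<le> a \<longleftrightarrow> enat n \<le> b"
  shows "a = b"
proof (rule antisym)
  have "x \<le> y" if "\<And>n. enat n \<le> x \<Longrightarrow> enat n \<le> y" for x y
    using that by (cases x; cases y) (auto, metis Suc_n_not_le_n)
  then show "a \<le> b" "b \<le> a" using assms by blast+
qed

text \<open>Additivity of length is checked in this form: a chain is distributed over two intervals,
  and either interval may have infinite length.\<close>

lemma enat_le_add_iff:
  "enat n \<le> a + b \<longleftrightarrow> (\<exists>i j. i + j = n \<and> enat i \<le> a \<and> enat j \<le> b)"
proof
  assume le: "enat n \<le> a + b"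
  show "\<exists>i j. i + j = n \<and> enat i \<le> a \<and> enat j \<le> b"
  proof (cases "enat n \<le> a")
    case True
    then show ?thesis by (intro exI[of _ n] exI[of _ 0]) (simp add: zero_enat_def[symmetric])
  next
    case False
    then obtain i where "a = enat i" "i < n" by (cases a) auto
    with le show ?thesis
      by (intro exI[of _ i] exI[of _ "n - i"]) (cases b; auto)
  qed
qed (metis add_mono plus_enat_simps(1))

text \<open>A finite bound below a supremum of naturals is reached by some member of the set, and
  downward closure brings that member down to \<open>n\<close> itself. Hence infinite lengths need
  no separate treatment.\<close>

lemma enat_le_Sup_iff:
  assumes "Q 0" and "\<And>n. Q (Suc n) \<Longrightarrow> Q n"
  shows "enat n \<le> Sup {enat n | n. Q n} \<longleftrightarrow> Q n"
proof
  assume le: "enat n \<le> Sup {enat n | n. Q n}"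
  have down: "Q m" if "Q n" "m \<le> n" for m n
    using that(2,1) by (induction rule: inc_induct) (auto intro: assms(2))
  show "Q n"
  proof (cases n)
    case (Suc m)
    then have "enat m < Sup {enat n | n. Q n}" using le by (simp add: Suc_ile_eq)
    then obtain k where "Q k" "m < k" by (auto simp: less_Sup_iff)
    then show ?thesis using down[of k n] Suc by simp
  qed (use assms in simp)
qed (auto intro: Sup_upper)

text \<open>The recursive form keeps the first member of a chain visible, so chains can be cut,
  joined and restarted by induction on their length.\<close>

primrec strict_chain :: "('a set \<Rightarrow> bool) \<Rightarrow> nat \<Rightarrow> 'a set \<Rightarrow> bool" where
  "strict_chain P 0 V \<longleftrightarrow> P V"
| "strict_chain P (Suc n) V \<longleftrightarrow> P V \<and> (\<exists>Y. V \<subset> Y \<and> strict_chain P n Y)"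

lemma strict_chain_SucI: "P V \<Longrightarrow> V \<subset> Y \<Longrightarrow> strict_chain P n Y \<Longrightarrow> strict_chain P (Suc n) V"
  by (simp del: psubset_eq) (rule exI[of _ Y], simp del: psubset_eq)

lemma strict_chain_start: "strict_chain P n V \<Longrightarrow> P V"
  by (cases n) auto

lemma strict_chain_lower_start:
  "strict_chain P n V \<Longrightarrow> P Y \<Longrightarrow> Y \<subseteq> V \<Longrightarrow> strict_chain P n Y"
  by (cases n) (simp, metis strict_chain.simps(2) subset_psubset_trans)

lemma strict_chain_map:
  assumes "\<And>V. P V \<Longrightarrow> Q (f V)" and "\<And>V Y. P V \<Longrightarrow> P Y \<Longrightarrow> V \<subset> Y \<Longrightarrow> f V \<subset> f Y"
  shows "strict_chain P n V \<Longrightarrow> strict_chain Q n (f V)"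
proof (induction n arbitrary: V)
  case 0
  then show ?case by (simp add: assms)
next
  case (Suc n)
  then obtain Y where "P V" "V \<subset> Y" "strict_chain P n Y" by auto
  then show ?case
    using Suc.IH[of Y] assms strict_chain_start[of P n Y] by (intro strict_chain_SucI[of _ _ "f Y"]) simp_all
qed

lemma ex_chain_iff_strict_chain:
  "(\<exists>C. C 0 = V \<and> (\<forall>i\<le>n. P (C i)) \<and> (\<forall>i<n. C i \<subset> C (Suc i))) \<longleftrightarrow> strict_chain P n V"
proof (induction n arbitrary: V)
  case 0
  show ?case by auto
next
  case (Suc n)
  show ?case
  proof
    assume "\<exists>C. C 0 = V \<and> (\<forall>i\<le>Suc n. P (C i)) \<and> (\<forall>i<Suc n. C i \<subset> C (Suc i))"
    then obtain C where C: "C 0 = V" "\<And>i. i \<le> Suc n \<Longrightarrow> P (C i)" "\<And>i. i < Suc n \<Longrightarrow> C i \<subset> C (Suc i)"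
      by blast
    have "strict_chain P n (C 1)"
      unfolding Suc.IH[symmetric] by (rule exI[of _ "\<lambda>i. C (Suc i)"]) (use C in auto)
    then show "strict_chain P (Suc n) V" using C(1) C(2)[of 0] C(3)[of 0] by auto
  next
    assume "strict_chain P (Suc n) V"
    then obtain Y where Y: "P V" "V \<subset> Y" "strict_chain P n Y" by auto
    then obtain C where C: "C 0 = Y" "\<forall>i\<le>n. P (C i)" "\<forall>i<n. C i \<subset> C (Suc i)"
      unfolding Suc.IH[symmetric] by blast
    show "\<exists>C. C 0 = V \<and> (\<forall>i\<le>Suc n. P (C i)) \<and> (\<forall>i<Suc n. C i \<subset> C (Suc i))"
      by (rule exI[of _ "case_nat V C"]) (use Y C in \<open>auto split: nat.splits\<close>)
  qed
qed

lemma sup_chain_length_eq_strict_chain: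
  "sup_chain_length P = Sup {enat n | n. \<exists>V. strict_chain P n V}"
  unfolding sup_chain_length_def ex_chain_iff_strict_chain[symmetric] by auto

lemma enat_le_sup_chain_length_iff:
  assumes "P V"
  shows "enat n \<le> sup_chain_length P \<longleftrightarrow> (\<exists>U. strict_chain P n U)"
  unfolding sup_chain_length_eq_strict_chain
  by (rule enat_le_Sup_iff) (use assms in auto)

text \<open>Two such maps in opposite directions give equal lengths, and they need not be shown
  inverse to each other.\<close>

lemma sup_chain_length_map_le:
  assumes "\<And>V. P V \<Longrightarrow> Q (f V)" and "\<And>V Y. P V \<Longrightarrow> P Y \<Longrightarrow> V \<subset> Y \<Longrightarrow> f V \<subset> f Y"
  shows "sup_chain_length P \<le> sup_chain_length Q"
  unfolding sup_chain_length_eq_strict_chain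
  by (rule Sup_subset_mono) (use strict_chain_map[of P Q f] assms in blast)

section \<open>Submodules and relative length\<close>

text \<open>This is the length of K / H, measured among the submodules between H and K so that no
  quotient module has to be formed.\<close>

definition rel_length ::
    "('a, 'r) ring_scheme \<Rightarrow> ('a, 'b, 'm) module_scheme \<Rightarrow> 'b set \<Rightarrow> 'b set \<Rightarrow> enat"
  where "rel_length R M H K = sup_chain_length (\<lambda>V. submodule V R M \<and> H \<subseteq> V \<and> V \<subseteq> K)"

text \<open>Only the upper bound K is recorded: the chain starts at H, so all its members contain H
  automatically.\<close>

definition submodule_chain ::
    "('a, 'r) ring_scheme \<Rightarrow> ('a, 'b, 'm) module_scheme \<Rightarrow> nat \<Rightarrow> 'b set \<Rightarrow> 'b set \<Rightarrow> bool"
  where "submodule_chain R M n H K = strict_chain (\<lambda>V. submodule V R M \<and> V \<subseteq> K) n H"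

context module
begin

lemma minus_eq_zero_imp_eq:
  assumes "a \<in> carrier M" "b \<in> carrier M" "a \<ominus>\<^bsub>M\<^esub> b = \<zero>\<^bsub>M\<^esub>"
  shows "a = b"
proof -
  have "\<ominus>\<^bsub>M\<^esub> (\<ominus>\<^bsub>M\<^esub> b) = a" using assms by (intro M.minus_equality) (auto simp: a_minus_def)
  then show ?thesis using assms by simp
qed

lemma add_minus_cancel:
  assumes "a \<in> carrier M" "b \<in> carrier M"
  shows "(a \<oplus>\<^bsub>M\<^esub> b) \<ominus>\<^bsub>M\<^esub> a = b"
  using assms by (simp add: a_minus_def M.a_comm[of a b] M.a_assoc M.r_neg)

lemma set_addI: "h \<in> H \<Longrightarrow> k \<in> K \<Longrightarrow> h \<oplus>\<^bsub>M\<^esub> k \<in> H <+>\<^bsub>M\<^esub> K"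
  by (auto simp: set_add_def')

lemma submodule_zero_closed: "submodule H R M \<Longrightarrow> \<zero>\<^bsub>M\<^esub> \<in> H"
  using subgroup.one_closed[OF submodule.axioms(1)] by fastforce

lemma submodule_minus_closed:
  assumes "submodule H R M" "a \<in> H" "b \<in> H"
  shows "a \<ominus>\<^bsub>M\<^esub> b \<in> H"
  using submoduleE[OF assms(1)] assms unfolding a_minus_def by blast

lemma submodule_Inter:
  assumes "\<And>H. H \<in> F \<Longrightarrow> submodule H R M" "F \<noteq> {}"
  shows "submodule (\<Inter>F) R M"
proof (rule submoduleI)
  show "\<Inter>F \<subseteq> carrier M" using assms submoduleE(1) by blast
qed (use assms in \<open>auto dest: submoduleE submodule_zero_closed\<close>)

lemma submodule_Int: "submodule H R M \<Longrightarrow> submodule K R M \<Longrightarrow> submodule (H \<inter> K) R M"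
  using submodule_Inter[of "{H, K}"] by auto

lemma submodule_zero: "submodule {\<zero>\<^bsub>M\<^esub>} R M"
  by (rule submoduleI) auto

lemma submodule_gen:
  assumes "S \<subseteq> carrier M"
  shows "submodule (gen_submodule R M S) R M"
  unfolding gen_submodule_def hull_def
  by (rule submodule_Inter) (use assms carrier_is_submodule in auto)

lemma gen_incl: "S \<subseteq> gen_submodule R M S"
  unfolding gen_submodule_def by (rule hull_subset)

lemma gen_minimal: "S \<subseteq> H \<Longrightarrow> submodule H R M \<Longrightarrow> gen_submodule R M S \<subseteq> H"
  unfolding gen_submodule_def by (rule hull_minimal)

lemma gen_mono: "S \<subseteq> T \<Longrightarrow> gen_submodule R M S \<subseteq> gen_submodule R M T"
  unfolding gen_submodule_def by (rule hull_mono)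

lemma gen_in_carrier: "S \<subseteq> carrier M \<Longrightarrow> gen_submodule R M S \<subseteq> carrier M"
  using gen_minimal carrier_is_submodule by blast

lemma gen_submodule_id: "submodule H R M \<Longrightarrow> gen_submodule R M H = H"
  unfolding gen_submodule_def by (rule hull_same)

lemma submodule_set_add:
  assumes H: "submodule H R M" and K: "submodule K R M"
  shows "submodule (H <+>\<^bsub>M\<^esub> K) R M"
proof -
  note h = submoduleE[OF H] and k = submoduleE[OF K]
  have hc: "\<And>x. x \<in> H \<Longrightarrow> x \<in> carrier M" and kc: "\<And>x. x \<in> K \<Longrightarrow> x \<in> carrier M" using h k by auto
  show ?thesis
  proof (rule submoduleI)
    show "H <+>\<^bsub>M\<^esub> K \<subseteq> carrier M" using hc kc by (auto simp: set_add_def')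
    show "\<zero>\<^bsub>M\<^esub> \<in> H <+>\<^bsub>M\<^esub> K"
      using H K[THEN submodule_zero_closed] submodule_zero_closed by (force simp: set_add_def')
  next
    fix a assume "a \<in> H <+>\<^bsub>M\<^esub> K"
    then obtain x y where a: "a = x \<oplus>\<^bsub>M\<^esub> y" "x \<in> H" "y \<in> K" by (auto simp: set_add_def')
    then have "\<ominus>\<^bsub>M\<^esub> a = \<ominus>\<^bsub>M\<^esub> x \<oplus>\<^bsub>M\<^esub> \<ominus>\<^bsub>M\<^esub> y" using hc kc by (simp add: M.minus_add)
    then show "\<ominus>\<^bsub>M\<^esub> a \<in> H <+>\<^bsub>M\<^esub> K" using a h(3) k(3) by (auto simp: set_add_def')
    fix b assume "b \<in> H <+>\<^bsub>M\<^esub> K"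
    then obtain x' y' where b: "b = x' \<oplus>\<^bsub>M\<^esub> y'" "x' \<in> H" "y' \<in> K" by (auto simp: set_add_def')
    have "a \<oplus>\<^bsub>M\<^esub> b = (x \<oplus>\<^bsub>M\<^esub> x') \<oplus>\<^bsub>M\<^esub> (y \<oplus>\<^bsub>M\<^esub> y')"
      using a b hc kc by (simp add: M.a_ac)
    then show "a \<oplus>\<^bsub>M\<^esub> b \<in> H <+>\<^bsub>M\<^esub> K" using a b h(5) k(5) by (simp add: set_addI)
  next
    fix r a assume "r \<in> carrier R" "a \<in> H <+>\<^bsub>M\<^esub> K"
    then show "r \<odot>\<^bsub>M\<^esub> a \<in> H <+>\<^bsub>M\<^esub> K"
      using h(4) k(4) hc kc by (auto simp: set_add_def' smult_r_distr) blast
  qed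
qed

lemma set_add_incl:
  assumes "submodule H R M" "submodule K R M"
  shows "H \<subseteq> H <+>\<^bsub>M\<^esub> K" "K \<subseteq> H <+>\<^bsub>M\<^esub> K"
proof -
  have "x \<in> H <+>\<^bsub>M\<^esub> K" if "x \<in> H" for x
    using that set_addI[of x H "\<zero>\<^bsub>M\<^esub>" K] submodule_zero_closed[OF assms(2)] submoduleE(1)[OF assms(1)]
    by auto
  moreover have "x \<in> H <+>\<^bsub>M\<^esub> K" if "x \<in> K" for x
    using that set_addI[of "\<zero>\<^bsub>M\<^esub>" H x K] submodule_zero_closed[OF assms(1)] submoduleE(1)[OF assms(2)]
    by auto
  ultimately show "H \<subseteq> H <+>\<^bsub>M\<^esub> K" "K \<subseteq> H <+>\<^bsub>M\<^esub> K" by auto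
qed

lemma set_add_minimal:
  assumes "H \<subseteq> L" "K \<subseteq> L" "submodule L R M"
  shows "H <+>\<^bsub>M\<^esub> K \<subseteq> L"
  using assms submoduleE(5)[OF assms(3)] by (auto simp: set_add_def')

lemma gen_Un_eq_set_add:
  assumes H: "submodule H R M" and S: "S \<subseteq> carrier M"
  shows "gen_submodule R M (H \<union> S) = H <+>\<^bsub>M\<^esub> gen_submodule R M S"
proof
  note G = submodule_gen[OF S]
  show "gen_submodule R M (H \<union> S) \<subseteq> H <+>\<^bsub>M\<^esub> gen_submodule R M S"
    using set_add_incl[OF H G] gen_incl[of S] by (intro gen_minimal submodule_set_add H G) auto
  have "H \<union> S \<subseteq> carrier M" using S submoduleE(1)[OF H] by auto
  then show "H <+>\<^bsub>M\<^esub> gen_submodule R M S \<subseteq> gen_submodule R M (H \<union> S)"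
    using gen_incl[of "H \<union> S"] by (intro set_add_minimal submodule_gen gen_mono) auto
qed

lemma gen_singleton:
  assumes s: "s \<in> carrier M"
  shows "gen_submodule R M {s} = {r \<odot>\<^bsub>M\<^esub> s | r. r \<in> carrier R}"
proof
  have "submodule {r \<odot>\<^bsub>M\<^esub> s | r. r \<in> carrier R} R M"
  proof (rule submoduleI)
    show "\<zero>\<^bsub>M\<^esub> \<in> {r \<odot>\<^bsub>M\<^esub> s | r. r \<in> carrier R}"
      using s by (auto intro!: exI[of _ \<zero>])
  next
    fix a assume "a \<in> {r \<odot>\<^bsub>M\<^esub> s | r. r \<in> carrier R}"
    then show "\<ominus>\<^bsub>M\<^esub> a \<in> {r \<odot>\<^bsub>M\<^esub> s | r. r \<in> carrier R}"
      using s by (auto simp: smult_l_minus[symmetric])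
    fix b assume "b \<in> {r \<odot>\<^bsub>M\<^esub> s | r. r \<in> carrier R}"
    with \<open>a \<in> _\<close> show "a \<oplus>\<^bsub>M\<^esub> b \<in> {r \<odot>\<^bsub>M\<^esub> s | r. r \<in> carrier R}"
      using s by (auto simp: smult_l_distr[symmetric])
  next
    fix r a assume "r \<in> carrier R" "a \<in> {r \<odot>\<^bsub>M\<^esub> s | r. r \<in> carrier R}"
    then show "r \<odot>\<^bsub>M\<^esub> a \<in> {r \<odot>\<^bsub>M\<^esub> s | r. r \<in> carrier R}"
      using s by (auto simp: smult_assoc1[symmetric])
  qed (use s in auto)
  moreover have "s \<in> {r \<odot>\<^bsub>M\<^esub> s | r. r \<in> carrier R}"
    using s by (auto intro!: exI[of _ \<one>])
  ultimately show "gen_submodule R M {s} \<subseteq> {r \<odot>\<^bsub>M\<^esub> s | r. r \<in> carrier R}"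
    by (intro gen_minimal) auto
  show "{r \<odot>\<^bsub>M\<^esub> s | r. r \<in> carrier R} \<subseteq> gen_submodule R M {s}"
    using submoduleE(4)[OF submodule_gen[of "{s}"]] gen_incl[of "{s}"] s by auto
qed

lemma submodule_vimage_smult:
  assumes H: "submodule H R M" and r: "r \<in> carrier R"
  shows "submodule {m \<in> carrier M. r \<odot>\<^bsub>M\<^esub> m \<in> H} R M"
proof (rule submoduleI)
  fix s a assume s: "s \<in> carrier R" and a: "a \<in> {m \<in> carrier M. r \<odot>\<^bsub>M\<^esub> m \<in> H}"
  then have "r \<odot>\<^bsub>M\<^esub> (s \<odot>\<^bsub>M\<^esub> a) = s \<odot>\<^bsub>M\<^esub> (r \<odot>\<^bsub>M\<^esub> a)"
    using r by (metis (lifting) mem_Collect_eq smult_assoc1 R.m_comm)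
  then show "s \<odot>\<^bsub>M\<^esub> a \<in> {m \<in> carrier M. r \<odot>\<^bsub>M\<^esub> m \<in> H}"
    using s a submoduleE(4)[OF H] by auto
qed (use r submoduleE[OF H] submodule_zero_closed[OF H] in
      \<open>auto simp: smult_r_minus smult_r_distr\<close>)

lemma submodule_image_smult:
  assumes H: "submodule H R M" and r: "r \<in> carrier R"
  shows "submodule ((\<odot>\<^bsub>M\<^esub>) r ` H) R M"
proof -
  note h = submoduleE[OF H]
  have hc: "\<And>x. x \<in> H \<Longrightarrow> x \<in> carrier M" using h(1) by auto
  show ?thesis
  proof (rule submoduleI)
    show "(\<odot>\<^bsub>M\<^esub>) r ` H \<subseteq> carrier M" using hc r by auto
    show "\<zero>\<^bsub>M\<^esub> \<in> (\<odot>\<^bsub>M\<^esub>) r ` H"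
      by (rule image_eqI[of _ _ "\<zero>\<^bsub>M\<^esub>"]) (use r submodule_zero_closed[OF H] in auto)
  next
    fix a assume "a \<in> (\<odot>\<^bsub>M\<^esub>) r ` H"
    then show "\<ominus>\<^bsub>M\<^esub> a \<in> (\<odot>\<^bsub>M\<^esub>) r ` H" using h(3) hc r by (auto simp: smult_r_minus[symmetric])
    fix b assume "b \<in> (\<odot>\<^bsub>M\<^esub>) r ` H"
    with \<open>a \<in> _\<close> show "a \<oplus>\<^bsub>M\<^esub> b \<in> (\<odot>\<^bsub>M\<^esub>) r ` H"
      using h(5) hc r by (auto simp: smult_r_distr[symmetric])
  next
    fix s a assume s: "s \<in> carrier R" and "a \<in> (\<odot>\<^bsub>M\<^esub>) r ` H"
    then obtain x where x: "a = r \<odot>\<^bsub>M\<^esub> x" "x \<in> H" by auto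
    have "s \<odot>\<^bsub>M\<^esub> a = r \<odot>\<^bsub>M\<^esub> (s \<odot>\<^bsub>M\<^esub> x)"
      using s r x hc by (metis smult_assoc1 R.m_comm)
    then show "s \<odot>\<^bsub>M\<^esub> a \<in> (\<odot>\<^bsub>M\<^esub>) r ` H" using h(4) s x by auto
  qed
qed

section \<open>Additivity of length\<close>

text \<open>The first chain need not reach K. Its last member lies inside K and replaces K as the
  start of the second chain, so no length is lost.\<close>

lemma submodule_chain_concat:
  assumes "submodule_chain R M n H K" "submodule_chain R M m K L"
  shows "submodule_chain R M (n + m) H L"
  using assms
proof (induction n arbitrary: H)
  case 0
  then show ?case
    by (auto simp: submodule_chain_def dest: strict_chain_start intro: strict_chain_lower_start)
next
  case (Suc n)
  then obtain Y where Y: "submodule H R M" "H \<subseteq> K" "H \<subset> Y" "submodule_chain R M n Y K"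
    by (auto simp: submodule_chain_def)
  have "K \<subseteq> L" using Suc.prems(2) by (auto simp: submodule_chain_def dest: strict_chain_start)
  then show ?case
    using Suc.IH[OF Y(4) Suc.prems(2)] Y by (auto simp: submodule_chain_def simp del: psubset_eq)
qed

text \<open>By the modular law, each strict step \<open>H \<subset> V\<close> stays strict after intersecting with \<open>K\<close> or
  after adding \<open>K\<close>.\<close>

lemma submodule_chain_split:
  assumes "submodule_chain R M n H L" "submodule L R M" "submodule K R M" "K \<subseteq> L"
  shows "\<exists>a b. a + b = n \<and> submodule_chain R M a (H \<inter> K) K \<and> submodule_chain R M b (H <+>\<^bsub>M\<^esub> K) L"
  using assms(1)
proof (induction n arbitrary: H)
  case 0
  then show ?case
    using assms set_add_minimal[of H L K]
    by (auto simp: submodule_chain_def submodule_Int submodule_set_add)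
next
  case (Suc n)
  then obtain V where V: "H \<subset> V" "submodule_chain R M n V L" and H: "submodule H R M" "H \<subseteq> L"
    by (auto simp: submodule_chain_def)
  then have Vs: "submodule V R M" "V \<subseteq> L"
    by (auto simp: submodule_chain_def dest: strict_chain_start)
  obtain a b where ab: "a + b = n" "submodule_chain R M a (V \<inter> K) K"
      "submodule_chain R M b (V <+>\<^bsub>M\<^esub> K) L"
    using Suc.IH[OF V(2)] by auto
  have le1: "H \<inter> K \<subseteq> V \<inter> K" and le2: "H <+>\<^bsub>M\<^esub> K \<subseteq> V <+>\<^bsub>M\<^esub> K"
    using V(1) by (auto simp: set_add_def')
  have s1: "submodule (H \<inter> K) R M" and s2: "submodule (H <+>\<^bsub>M\<^esub> K) R M" "H <+>\<^bsub>M\<^esub> K \<subseteq> L"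
    using H assms set_add_minimal[of H L K] by (auto intro: submodule_Int submodule_set_add)
  show ?case
  proof (cases "H \<inter> K = V \<inter> K")
    case False
    then have "submodule_chain R M (Suc a) (H \<inter> K) K"
      using ab(2) le1 s1 unfolding submodule_chain_def by (intro strict_chain_SucI) auto
    moreover have "submodule_chain R M b (H <+>\<^bsub>M\<^esub> K) L"
      using ab(3) le2 s2 unfolding submodule_chain_def by (auto intro: strict_chain_lower_start)
    ultimately show ?thesis using ab(1) by (intro exI[of _ "Suc a"] exI[of _ b]) auto
  next
    case True
    have "H <+>\<^bsub>M\<^esub> K \<noteq> V <+>\<^bsub>M\<^esub> K"
    proof
      assume eq: "H <+>\<^bsub>M\<^esub> K = V <+>\<^bsub>M\<^esub> K"
      have "v \<in> H" if v: "v \<in> V" for v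
      proof -
        have "v \<in> H <+>\<^bsub>M\<^esub> K" using v eq set_add_incl(1)[OF Vs(1) assms(3)] by auto
        then obtain h k where hk: "h \<in> H" "k \<in> K" "v = h \<oplus>\<^bsub>M\<^esub> k" by (auto simp: set_add_def')
        have c: "h \<in> carrier M" "k \<in> carrier M" using hk submoduleE(1)[OF H(1)] submoduleE(1)[OF assms(3)] by auto
        have "k = v \<ominus>\<^bsub>M\<^esub> h" using c hk(3) by (simp add: add_minus_cancel)
        then have "k \<in> V" using submodule_minus_closed[OF Vs(1) v, of h] hk(1) V(1) by (auto simp del: psubset_eq)
        then have "k \<in> H" using True hk by auto
        then show "v \<in> H" using hk submoduleE(5)[OF H(1)] by auto
      qed
      then show False using V(1) by auto
    qed
    then have "submodule_chain R M (Suc b) (H <+>\<^bsub>M\<^esub> K) L"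
      using ab(3) le2 s2 unfolding submodule_chain_def by (intro strict_chain_SucI) auto
    then show ?thesis using ab True by (intro exI[of _ a] exI[of _ "Suc b"]) auto
  qed
qed

text \<open>A chain between H and K can be made to start exactly at H by lowering its first member,
  which keeps the next inclusion strict.\<close>

lemma enat_le_rel_length_iff:
  assumes "submodule H R M" "submodule K R M" "H \<subseteq> K"
  shows "enat n \<le> rel_length R M H K \<longleftrightarrow> submodule_chain R M n H K"
proof -
  define P where "P V \<longleftrightarrow> submodule V R M \<and> H \<subseteq> V \<and> V \<subseteq> K" for V
  define Q where "Q V \<longleftrightarrow> submodule V R M \<and> V \<subseteq> K" for V
  have PQ: "P V \<longleftrightarrow> Q V \<and> H \<subseteq> V" for V by (auto simp: P_def Q_def)
  have chain_Q: "submodule_chain R M n H K \<longleftrightarrow> strict_chain Q n H" for n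
    by (simp add: submodule_chain_def Q_def[abs_def])
  have 1: "strict_chain Q n V" if "strict_chain P n V" for n V
    using strict_chain_map[of P Q id n V] that by (simp add: PQ)
  have 2: "strict_chain P n V" if "strict_chain Q n V" "H \<subseteq> V" for n V
    using that
  proof (induction n arbitrary: V)
    case (Suc n)
    then obtain Y where Y: "Q V" "V \<subset> Y" "strict_chain Q n Y" by auto
    show ?case by (rule strict_chain_SucI[OF _ Y(2)]) (use Suc Y in \<open>auto simp: PQ\<close>)
  qed (simp add: PQ)
  have eq: "(\<exists>V. strict_chain P n V) \<longleftrightarrow> submodule_chain R M n H K" for n
  proof
    assume "\<exists>V. strict_chain P n V"
    then obtain V where V: "strict_chain P n V" by blast
    then have "H \<subseteq> V" using strict_chain_start[OF V] by (simp add: PQ)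
    then show "submodule_chain R M n H K"
      using strict_chain_lower_start[OF 1[OF V], of H] chain_Q assms by (simp add: Q_def)
  qed (use 2[of n H] in \<open>auto simp: chain_Q\<close>)
  have "rel_length R M H K = Sup {enat n | n. submodule_chain R M n H K}"
    unfolding rel_length_def P_def[symmetric] sup_chain_length_eq_strict_chain eq ..
  moreover have "submodule_chain R M 0 H K" using assms by (auto simp: submodule_chain_def)
  moreover have "submodule_chain R M n H K" if "submodule_chain R M (Suc n) H K" for n
    using that unfolding eq[symmetric] by auto
  ultimately show ?thesis by (simp add: enat_le_Sup_iff)
qed

text \<open>Splitting a chain at K gives one inequality and concatenation the other. For a chain
  from H the two pieces start at \<open>H \<inter> K\<close> = H and H + K = K.\<close>

lemma rel_length_add:
  assumes H: "submodule H R M" and K: "submodule K R M" and L: "submodule L R M" and le: "H \<subseteq> K" "K \<subseteq> L"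
  shows "rel_length R M H L = rel_length R M H K + rel_length R M K L"
proof (rule enat_eqI)
  have HK: "H \<inter> K = H" "H <+>\<^bsub>M\<^esub> K = K"
    using le set_add_minimal[OF le(1) subset_refl K] set_add_incl[OF H K] by auto
  have HL: "H \<subseteq> L" using le by auto
  fix n
  show "enat n \<le> rel_length R M H L \<longleftrightarrow> enat n \<le> rel_length R M H K + rel_length R M K L"
    unfolding enat_le_add_iff enat_le_rel_length_iff[OF H L HL] enat_le_rel_length_iff[OF H K le(1)]
      enat_le_rel_length_iff[OF K L le(2)]
    using submodule_chain_split[of n H L K] submodule_chain_concat[of _ H K _ L] HK L K le(2) by auto
qed

lemma rel_length_self:
  assumes "submodule H R M"
  shows "rel_length R M H H = 0"
proof -
  have "\<not> submodule_chain R M 1 H H"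
    by (auto simp: submodule_chain_def)
  then have "\<not> enat 1 \<le> rel_length R M H H" using enat_le_rel_length_iff[of H H 1] assms by simp
  then show ?thesis by (cases "rel_length R M H H") (auto simp: zero_enat_def)
qed

lemma rel_length_mono:
  assumes "submodule H R M" "submodule K R M" "submodule L R M" "H \<subseteq> K" "K \<subseteq> L"
  shows "rel_length R M K L \<le> rel_length R M H L" and "rel_length R M H K \<le> rel_length R M H L"
  using rel_length_add[OF assms] by (simp_all add: add_increasing)

lemma rel_length_eq_0_imp_eq:
  assumes "submodule H R M" "submodule K R M" "H \<subseteq> K" "rel_length R M H K = 0"
  shows "H = K"
proof (rule ccontr)
  assume "H \<noteq> K"
  then have "submodule_chain R M 1 H K" using assms by (auto simp: submodule_chain_def)
  then have "enat 1 \<le> rel_length R M H K" using enat_le_rel_length_iff assms by blast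
  then show False using assms(4) by (simp add: zero_enat_def)
qed

text \<open>This turns an equality of invariants into an equality of submodules; finiteness is what
  allows the length of L / K to be cancelled.\<close>

lemma rel_length_eq_imp_eq:
  assumes "submodule H R M" "submodule K R M" "submodule L R M" "H \<subseteq> K" "K \<subseteq> L"
    and "rel_length R M H L = rel_length R M K L" "rel_length R M H L \<noteq> \<infinity>"
  shows "H = K"
proof (rule rel_length_eq_0_imp_eq[OF assms(1,2,4)])
  show "rel_length R M H K = 0"
    using rel_length_add[OF assms(1-5)] assms(6,7)
    by (cases "rel_length R M K L"; cases "rel_length R M H K") (auto simp: zero_enat_def)
qed

text \<open>Multiplication by a nonzerodivisor is an isomorphism from M onto r M. Image and preimage
  carry strict chains between the two intervals.\<close>

lemma rel_length_image_smult:
  assumes H: "submodule H R M" and K: "submodule K R M" and "H \<subseteq> K" and r: "r \<in> carrier R"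
    and inj: "\<And>m. m \<in> carrier M \<Longrightarrow> r \<odot>\<^bsub>M\<^esub> m = \<zero>\<^bsub>M\<^esub> \<Longrightarrow> m = \<zero>\<^bsub>M\<^esub>"
  shows "rel_length R M ((\<odot>\<^bsub>M\<^esub>) r ` H) ((\<odot>\<^bsub>M\<^esub>) r ` K) = rel_length R M H K"
proof -
  have Kc: "K \<subseteq> carrier M" using submoduleE(1)[OF K] .
  have "a = b" if "a \<in> carrier M" "b \<in> carrier M" "r \<odot>\<^bsub>M\<^esub> a = r \<odot>\<^bsub>M\<^esub> b" for a b
  proof -
    have "r \<odot>\<^bsub>M\<^esub> (a \<ominus>\<^bsub>M\<^esub> b) = \<zero>\<^bsub>M\<^esub>"
      using that r by (simp add: a_minus_def smult_r_distr smult_r_minus M.r_neg)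
    then have "a \<ominus>\<^bsub>M\<^esub> b = \<zero>\<^bsub>M\<^esub>" using inj[of "a \<ominus>\<^bsub>M\<^esub> b"] that by simp
    then show ?thesis using that minus_eq_zero_imp_eq by blast
  qed
  then have i: "inj_on ((\<odot>\<^bsub>M\<^esub>) r) (carrier M)" by (auto simp: inj_on_def)
  show ?thesis unfolding rel_length_def
  proof (rule antisym)
    let ?f = "\<lambda>V. {m \<in> carrier M. r \<odot>\<^bsub>M\<^esub> m \<in> V}"
    show "sup_chain_length (\<lambda>U. submodule U R M \<and> (\<odot>\<^bsub>M\<^esub>) r ` H \<subseteq> U \<and> U \<subseteq> (\<odot>\<^bsub>M\<^esub>) r ` K)
      \<le> sup_chain_length (\<lambda>U. submodule U R M \<and> H \<subseteq> U \<and> U \<subseteq> K)"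
    proof (rule sup_chain_length_map_le[where f = ?f])
      fix V assume V: "submodule V R M \<and> (\<odot>\<^bsub>M\<^esub>) r ` H \<subseteq> V \<and> V \<subseteq> (\<odot>\<^bsub>M\<^esub>) r ` K"
      have "m \<in> K" if m: "m \<in> carrier M" "r \<odot>\<^bsub>M\<^esub> m \<in> V" for m
      proof -
        obtain k where "k \<in> K" "r \<odot>\<^bsub>M\<^esub> m = r \<odot>\<^bsub>M\<^esub> k" using m V by auto
        then show ?thesis using i m Kc by (auto dest!: inj_onD)
      qed
      then show "submodule (?f V) R M \<and> H \<subseteq> ?f V \<and> ?f V \<subseteq> K"
        using V r submoduleE(1)[OF H] submodule_vimage_smult[of V r] by auto
      fix W assume "submodule W R M \<and> (\<odot>\<^bsub>M\<^esub>) r ` H \<subseteq> W \<and> W \<subseteq> (\<odot>\<^bsub>M\<^esub>) r ` K" "V \<subset> W"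
      then show "?f V \<subset> ?f W" using Kc by blast
    qed
    show "sup_chain_length (\<lambda>U. submodule U R M \<and> H \<subseteq> U \<and> U \<subseteq> K)
      \<le> sup_chain_length (\<lambda>U. submodule U R M \<and> (\<odot>\<^bsub>M\<^esub>) r ` H \<subseteq> U \<and> U \<subseteq> (\<odot>\<^bsub>M\<^esub>) r ` K)"
    proof (rule sup_chain_length_map_le[where f = "\<lambda>V. (\<odot>\<^bsub>M\<^esub>) r ` V"])
      fix V W assume "submodule V R M \<and> H \<subseteq> V \<and> V \<subseteq> K" "submodule W R M \<and> H \<subseteq> W \<and> W \<subseteq> K" "V \<subset> W"
      then show "(\<odot>\<^bsub>M\<^esub>) r ` V \<subset> (\<odot>\<^bsub>M\<^esub>) r ` W"
        using Kc inj_on_image_eq_iff[OF i, of V W] by blast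
    qed (use r submodule_image_smult in auto)
  qed
qed

end

section \<open>Products of an ideal with a module\<close>

context module
begin

lemma smult_in_ideal_mult: "r \<in> I \<Longrightarrow> x \<in> carrier M \<Longrightarrow> r \<odot>\<^bsub>M\<^esub> x \<in> ideal_mult R I M"
  unfolding ideal_mult_def by (rule subsetD[OF gen_incl]) blast

lemma submodule_ideal_mult: "I \<subseteq> carrier R \<Longrightarrow> submodule (ideal_mult R I M) R M"
  unfolding ideal_mult_def by (rule submodule_gen) auto

lemma ideal_mult_minimal:
  assumes "submodule H R M" "\<And>r x. r \<in> I \<Longrightarrow> x \<in> carrier M \<Longrightarrow> r \<odot>\<^bsub>M\<^esub> x \<in> H"
  shows "ideal_mult R I M \<subseteq> H"
  unfolding ideal_mult_def by (rule gen_minimal) (use assms in auto)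

end

section \<open>Modules over local rings\<close>

locale local_cring = cring R for R (structure) +
  fixes \<mm> :: "'a set"
  assumes maximal: "maximalideal \<mm> R"
    and unitI: "r \<in> carrier R \<Longrightarrow> r \<notin> \<mm> \<Longrightarrow> r \<in> Units R"
begin

lemma m_ideal: "ideal \<mm> R"
  using maximal by (rule maximalideal.axioms)

lemma m_carrier [simp]: "r \<in> \<mm> \<Longrightarrow> r \<in> carrier R"
  using ideal.Icarr[OF m_ideal] .

lemma genideal_m: "genideal R \<mm> = \<mm>"
  using genideal_self[of \<mm>] genideal_minimal[OF m_ideal subset_refl]
    additive_subgroup.a_subset[OF ideal.axioms(1)[OF m_ideal]] by blast

lemma one_notin_m: "\<one> \<notin> \<mm>"
  using ideal.one_imp_carrier[OF m_ideal] maximalideal.I_notcarr[OF maximal] by blast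

lemma one_minus_unit:
  assumes "r \<in> \<mm>"
  shows "\<one> \<ominus> r \<in> Units R"
proof (rule unitI)
  show "\<one> \<ominus> r \<notin> \<mm>"
  proof
    assume "\<one> \<ominus> r \<in> \<mm>"
    then have "(\<one> \<ominus> r) \<oplus> r \<in> \<mm>"
      using assms additive_subgroup.a_closed[OF ideal.axioms(1)[OF m_ideal]] by blast
    moreover have "(\<one> \<ominus> r) \<oplus> r = \<one>" using assms by (simp add: a_minus_def a_assoc l_neg)
    ultimately show False using one_notin_m by simp
  qed
qed (use assms in auto)

end

locale local_module = module R M + local_cring R \<mm> for R (structure) and M (structure) and \<mm>
begin

lemma submodule_mM: "submodule (ideal_mult R \<mm> M) R M"
  by (rule submodule_ideal_mult) auto

text \<open>The quotient by H is cyclic and killed by \<open>\<mm>\<close>, hence an image of the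
  field R / \<open>\<mm>\<close>. Concretely, a strictly larger V contains some h + r s outside H;
  then r is a unit, so V contains s and is everything.\<close>

lemma rel_length_insert_le_1:
  assumes H: "submodule H R M" and s: "s \<in> carrier M" and "\<And>r. r \<in> \<mm> \<Longrightarrow> r \<odot>\<^bsub>M\<^esub> s \<in> H"
  shows "rel_length R M H (gen_submodule R M (H \<union> {s})) \<le> 1"
proof (rule ccontr)
  define K where "K = gen_submodule R M (H \<union> {s})"
  have Hs: "H \<union> {s} \<subseteq> carrier M" using submoduleE(1)[OF H] s by auto
  have K: "submodule K R M" "H \<subseteq> K" unfolding K_def using submodule_gen[OF Hs] gen_incl[of "H \<union> {s}"] by auto
  assume "\<not> rel_length R M H (gen_submodule R M (H \<union> {s})) \<le> 1"
  then have "enat (Suc 1) \<le> rel_length R M H K"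
    unfolding K_def[symmetric] by (simp add: one_enat_def not_le Suc_ile_eq)
  then have "submodule_chain R M (Suc 1) H K" using enat_le_rel_length_iff[OF H K] by blast
  then obtain V W where V: "H \<subset> V" "V \<subset> W" "submodule V R M" "submodule W R M" "W \<subseteq> K"
    by (auto simp: submodule_chain_def simp del: psubset_eq)
  then obtain v where v: "v \<in> V" "v \<notin> H" by blast
  then have "v \<in> K" using V by auto
  then obtain h r where hr: "h \<in> H" "r \<in> carrier R" "v = h \<oplus>\<^bsub>M\<^esub> r \<odot>\<^bsub>M\<^esub> s"
    unfolding K_def using gen_Un_eq_set_add[OF H, of "{s}"] gen_singleton[OF s] s
    by (auto simp: set_add_def')
  have hc: "h \<in> carrier M" using hr submoduleE(1)[OF H] by auto
  have "r \<notin> \<mm>"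
  proof
    assume "r \<in> \<mm>"
    then have "v \<in> H" using hr assms(3)[of r] submoduleE(5)[OF H] by blast
    then show False using v by simp
  qed
  then have r: "r \<in> Units R" using unitI hr by auto
  have "r \<odot>\<^bsub>M\<^esub> s = v \<ominus>\<^bsub>M\<^esub> h" using hr hc s by (simp add: add_minus_cancel)
  then have "r \<odot>\<^bsub>M\<^esub> s \<in> V" using submodule_minus_closed[OF V(3) v(1), of h] hr(1) V(1) by auto
  then have "inv r \<odot>\<^bsub>M\<^esub> (r \<odot>\<^bsub>M\<^esub> s) \<in> V" using submoduleE(4)[OF V(3)] r by auto
  then have "s \<in> V" using r s by (simp add: smult_assoc1[symmetric] hr(2))
  then have "K \<subseteq> V" unfolding K_def using V by (intro gen_minimal) auto
  then show False using V by auto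
qed

lemma rel_length_gen_le_card:
  assumes "finite S" and H: "submodule H R M" and S: "S \<subseteq> carrier M"
    and "\<And>r s. r \<in> \<mm> \<Longrightarrow> s \<in> S \<Longrightarrow> r \<odot>\<^bsub>M\<^esub> s \<in> H"
  shows "rel_length R M H (gen_submodule R M (H \<union> S)) \<le> enat (card S)"
  using assms(1,3,4)
proof (induction S)
  case empty
  then show ?case by (simp add: gen_submodule_id[OF H] rel_length_self[OF H] )
next
  case (insert s S)
  define K where "K = gen_submodule R M (H \<union> S)"
  have HS: "H \<union> S \<subseteq> carrier M" using submoduleE(1)[OF H] insert by auto
  have K: "submodule K R M" "H \<subseteq> K"
    unfolding K_def using submodule_gen[OF HS] gen_incl[of "H \<union> S"] by auto
  have eq: "gen_submodule R M (H \<union> insert s S) = gen_submodule R M (K \<union> {s})"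
    unfolding K_def gen_submodule_def by (subst hull_Un_left[symmetric]) (simp add: Un_commute)
  define L where "L = gen_submodule R M (K \<union> {s})"
  have Ks: "K \<union> {s} \<subseteq> carrier M" using submoduleE(1)[OF K(1)] insert by auto
  have L: "submodule L R M" "K \<subseteq> L"
    unfolding L_def using submodule_gen[OF Ks] gen_incl[of "K \<union> {s}"] by auto
  have "rel_length R M H K \<le> enat (card S)" unfolding K_def using insert by auto
  moreover have "rel_length R M K L \<le> enat 1"
    unfolding L_def one_enat_def[symmetric] using insert K
    by (intro rel_length_insert_le_1) auto
  ultimately have "rel_length R M H L \<le> enat (card S) + enat 1"
    unfolding rel_length_add[OF H K(1) L(1) K(2) L(2)] by (rule add_mono)
  then show ?case unfolding eq L_def using insert by simp
qed

text \<open>Generators are removed one at a time. An equation t = a + r t with r in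
  \<open>\<mm>\<close> gives t = a / (1 - r), so t already lies in the submodule generated without
  its own multiples, and the induction hypothesis handles the others.\<close>

lemma nakayama:
  assumes "finite S" and K: "submodule K R M" and "S \<subseteq> carrier M"
    and "S \<subseteq> gen_submodule R M (K \<union> {r \<odot>\<^bsub>M\<^esub> s | r s. r \<in> \<mm> \<and> s \<in> S})"
  shows "S \<subseteq> K"
  using assms(1,3,4)
proof (induction S)
  case (insert t S)
  define G where "G = gen_submodule R M (K \<union> {r \<odot>\<^bsub>M\<^esub> s | r s. r \<in> \<mm> \<and> s \<in> S})"
  have t: "t \<in> carrier M" and S: "S \<subseteq> carrier M" using insert by auto
  have Ts: "K \<union> {r \<odot>\<^bsub>M\<^esub> s | r s. r \<in> \<mm> \<and> s \<in> S} \<subseteq> carrier M"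
    using submoduleE(1)[OF K] S by auto
  have G: "submodule G R M" unfolding G_def by (rule submodule_gen[OF Ts])
  note g = submoduleE[OF G]
  \<comment> \<open>\<open>E\<close> is G + \<open>\<mm>\<close> t, which separates the multiples of
    the new generator t from those of the old ones.\<close>
  define E where "E = {a \<oplus>\<^bsub>M\<^esub> r \<odot>\<^bsub>M\<^esub> t | a r. a \<in> G \<and> r \<in> \<mm>}"
  have E: "submodule E R M"
  proof -
    have "submodule {r \<odot>\<^bsub>M\<^esub> t | r. r \<in> \<mm>} R M"
    proof (rule submoduleI)
      show "\<zero>\<^bsub>M\<^esub> \<in> {r \<odot>\<^bsub>M\<^esub> t | r. r \<in> \<mm>}"
        using additive_subgroup.zero_closed[OF ideal.axioms(1)[OF m_ideal]] t
        by (auto intro!: exI[of _ \<zero>])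
    next
      fix a assume a: "a \<in> {r \<odot>\<^bsub>M\<^esub> t | r. r \<in> \<mm>}"
      then show "\<ominus>\<^bsub>M\<^esub> a \<in> {r \<odot>\<^bsub>M\<^esub> t | r. r \<in> \<mm>}"
        using additive_subgroup.a_inv_closed[OF ideal.axioms(1)[OF m_ideal]] t
        by (auto simp: smult_l_minus[symmetric])
      fix b assume "b \<in> {r \<odot>\<^bsub>M\<^esub> t | r. r \<in> \<mm>}"
      with a show "a \<oplus>\<^bsub>M\<^esub> b \<in> {r \<odot>\<^bsub>M\<^esub> t | r. r \<in> \<mm>}"
        using additive_subgroup.a_closed[OF ideal.axioms(1)[OF m_ideal]] t
        by (auto simp: smult_l_distr[symmetric])
    next
      fix r a assume "r \<in> carrier R" "a \<in> {r \<odot>\<^bsub>M\<^esub> t | r. r \<in> \<mm>}"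
      then show "r \<odot>\<^bsub>M\<^esub> a \<in> {r \<odot>\<^bsub>M\<^esub> t | r. r \<in> \<mm>}"
        using ideal.I_l_closed[OF m_ideal] t by (auto simp: smult_assoc1[symmetric])
    qed (use t in auto)
    from submodule_set_add[OF G this] show ?thesis
      by (rule back_subst[of "\<lambda>E. submodule E R M"]) (auto simp: E_def set_add_def')
  qed
  have GE: "G \<subseteq> E"
  proof
    fix a assume "a \<in> G"
    moreover have "a = a \<oplus>\<^bsub>M\<^esub> \<zero> \<odot>\<^bsub>M\<^esub> t" using g(1) \<open>a \<in> G\<close> t by auto
    ultimately show "a \<in> E" unfolding E_def
      using additive_subgroup.zero_closed[OF ideal.axioms(1)[OF m_ideal]] by blast
  qed
  have "gen_submodule R M (K \<union> {r \<odot>\<^bsub>M\<^esub> s | r s. r \<in> \<mm> \<and> s \<in> insert t S}) \<subseteq> E"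
  proof (rule gen_minimal[OF _ E], rule)
    fix y assume "y \<in> K \<union> {r \<odot>\<^bsub>M\<^esub> s | r s. r \<in> \<mm> \<and> s \<in> insert t S}"
    then consider "y \<in> K \<union> {r \<odot>\<^bsub>M\<^esub> s | r s. r \<in> \<mm> \<and> s \<in> S}" | r where "r \<in> \<mm>" "y = r \<odot>\<^bsub>M\<^esub> t" by blast
    then show "y \<in> E"
    proof cases
      case 1
      then have "y \<in> G" unfolding G_def by (rule subsetD[OF gen_incl])
      then show ?thesis using GE by blast
    next
      case 2
      then have "y = \<zero>\<^bsub>M\<^esub> \<oplus>\<^bsub>M\<^esub> r \<odot>\<^bsub>M\<^esub> t" using t by auto
      then show ?thesis unfolding E_def using 2 submodule_zero_closed[OF G] by blast
    qed
  qed
  then have sub: "insert t S \<subseteq> E" using insert.prems(2) by blast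
  then obtain a r where ar: "a \<in> G" "r \<in> \<mm>" "t = a \<oplus>\<^bsub>M\<^esub> r \<odot>\<^bsub>M\<^esub> t" unfolding E_def by blast
  have ac: "a \<in> carrier M" using ar g(1) by auto
  have u: "\<one> \<ominus> r \<in> Units R" using one_minus_unit ar by blast
  have "a = (r \<odot>\<^bsub>M\<^esub> t \<oplus>\<^bsub>M\<^esub> a) \<ominus>\<^bsub>M\<^esub> r \<odot>\<^bsub>M\<^esub> t" using ac ar(2) t by (simp add: add_minus_cancel)
  also have "r \<odot>\<^bsub>M\<^esub> t \<oplus>\<^bsub>M\<^esub> a = t" using ar ac t by (metis M.a_comm smult_closed m_carrier)
  also have "t \<ominus>\<^bsub>M\<^esub> r \<odot>\<^bsub>M\<^esub> t = (\<one> \<ominus> r) \<odot>\<^bsub>M\<^esub> t"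
    using t ar(2) by (simp add: a_minus_def smult_l_distr smult_l_minus)
  finally have "inv (\<one> \<ominus> r) \<odot>\<^bsub>M\<^esub> a = t"
    using u t by (simp add: smult_assoc1[symmetric] R.Units_closed)
  then have tG: "t \<in> G" using g(4)[of "inv (\<one> \<ominus> r)" a] u ar by auto
  have "E \<subseteq> G"
    unfolding E_def using g(4,5) tG by auto
  then have "S \<subseteq> G" using sub by auto
  then have SK: "S \<subseteq> K" using insert.IH insert.prems(1) unfolding G_def by auto
  then have "G \<subseteq> K" unfolding G_def using submoduleE(4)[OF K] K by (intro gen_minimal) auto
  then show ?case using SK tG by auto
qed auto

text \<open>The finite set eliminated by \<open>nakayama\<close> is an auxiliary generating set T of
  M, with the submodule generated by S in the role of K.\<close>

lemma nakayama_carrier: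
  assumes fg: "fg_module R M" and S: "S \<subseteq> carrier M"
    and gen: "gen_submodule R M (ideal_mult R \<mm> M \<union> S) = carrier M"
  shows "gen_submodule R M S = carrier M"
proof -
  obtain T where T: "finite T" "T \<subseteq> carrier M" "gen_submodule R M T = carrier M"
    using fg unfolding fg_module_def by blast
  define K where "K = gen_submodule R M S"
  define B where "B = {r \<odot>\<^bsub>M\<^esub> s | r s. r \<in> \<mm> \<and> s \<in> T}"
  have K: "submodule K R M" unfolding K_def by (rule submodule_gen[OF S])
  have KB: "K \<union> B \<subseteq> carrier M" using submoduleE(1)[OF K] T(2) by (auto simp: B_def)
  note G = submodule_gen[OF KB]
  \<comment> \<open>The elements x with r x in the target form a submodule, so it suffices to test
    the generators T.\<close>
  have "r \<odot>\<^bsub>M\<^esub> x \<in> gen_submodule R M (K \<union> B)" if r: "r \<in> \<mm>" and x: "x \<in> carrier M" for r x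
  proof -
    have "gen_submodule R M T \<subseteq> {x \<in> carrier M. r \<odot>\<^bsub>M\<^esub> x \<in> gen_submodule R M (K \<union> B)}"
    proof (rule gen_minimal)
      show "T \<subseteq> {x \<in> carrier M. r \<odot>\<^bsub>M\<^esub> x \<in> gen_submodule R M (K \<union> B)}"
      proof
        fix x assume x: "x \<in> T"
        then have "r \<odot>\<^bsub>M\<^esub> x \<in> B" using r unfolding B_def by blast
        then show "x \<in> {x \<in> carrier M. r \<odot>\<^bsub>M\<^esub> x \<in> gen_submodule R M (K \<union> B)}"
          using gen_incl[of "K \<union> B"] x T(2) by blast
      qed
    qed (rule submodule_vimage_smult[OF G m_carrier[OF r]])
    then show ?thesis using x T(3) by auto
  qed
  then have "ideal_mult R \<mm> M \<subseteq> gen_submodule R M (K \<union> B)" by (intro ideal_mult_minimal G)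
  moreover have "S \<subseteq> gen_submodule R M (K \<union> B)"
    using gen_incl[of S] gen_incl[of "K \<union> B"] unfolding K_def by blast
  ultimately have "carrier M \<subseteq> gen_submodule R M (K \<union> B)"
    unfolding gen[symmetric] by (intro gen_minimal G) auto
  then have "T \<subseteq> gen_submodule R M (K \<union> B)" using T(2) by auto
  then have "T \<subseteq> K" using nakayama[OF T(1) K T(2)] unfolding B_def by blast
  then show ?thesis using T(3) gen_minimal[OF _ K, of T] gen_in_carrier[OF S] K_def by auto
qed

text \<open>Each element adjoined from outside the current submodule uses up at least one unit of
  the remaining length.\<close>

lemma ex_generators_over_mM:
  assumes "submodule H R M" and "ideal_mult R \<mm> M \<subseteq> H" and "rel_length R M H (carrier M) \<le> enat n"
  shows "\<exists>S. finite S \<and> card S \<le> n \<and> S \<subseteq> carrier M \<and> gen_submodule R M (H \<union> S) = carrier M"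
  using assms
proof (induction n arbitrary: H)
  case 0
  then have "H = carrier M"
    using rel_length_eq_0_imp_eq[OF 0(1) carrier_is_submodule submoduleE(1)[OF 0(1)]]
    by (simp add: zero_enat_def[symmetric])
  then show ?case using 0 by (intro exI[of _ "{}"]) (simp add: gen_submodule_id)
next
  case (Suc n)
  note Hc = submoduleE(1)[OF Suc.prems(1)]
  show ?case
  proof (cases "H = carrier M")
    case True
    then show ?thesis using Suc.prems by (intro exI[of _ "{}"]) (simp add: gen_submodule_id)
  next
    case False
    then obtain s where s: "s \<in> carrier M" "s \<notin> H" using Hc by auto
    define K where "K = gen_submodule R M (H \<union> {s})"
    have Hs: "H \<union> {s} \<subseteq> carrier M" using Hc s by auto
    have K: "submodule K R M" "H \<union> {s} \<subseteq> K"
      unfolding K_def using submodule_gen[OF Hs] gen_incl by auto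
    have "rel_length R M H K \<noteq> 0"
      using rel_length_eq_0_imp_eq[OF Suc.prems(1) K(1)] K(2) s by auto
    then have "1 \<le> rel_length R M H K" by (simp add: ileI1 one_eSuc)
    moreover have "rel_length R M H K + rel_length R M K (carrier M) \<le> enat (Suc n)"
      using rel_length_add[OF Suc.prems(1) K(1) carrier_is_submodule] K(2) submoduleE(1)[OF K(1)]
        Suc.prems(3) by auto
    ultimately have "rel_length R M K (carrier M) \<le> enat n"
      by (cases "rel_length R M H K"; cases "rel_length R M K (carrier M)") (auto simp: one_enat_def)
    moreover have "ideal_mult R \<mm> M \<subseteq> K" using Suc.prems(2) K(2) by auto
    ultimately obtain S where S: "finite S" "card S \<le> n" "S \<subseteq> carrier M"
        "gen_submodule R M (K \<union> S) = carrier M"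
      using Suc.IH[OF K(1)] by blast
    have "gen_submodule R M (H \<union> insert s S) = gen_submodule R M (K \<union> S)"
      unfolding K_def gen_submodule_def by (subst hull_Un_left[symmetric]) simp
    then show ?thesis using S s
      by (intro exI[of _ "insert s S"]) (auto simp: card_insert_if)
  qed
qed

text \<open>A minimal generating set bounds the length from above and thereby shows it to be finite.
  The greedy choice of elements modulo \<open>\<mm>\<close> M, lifted by Nakayama, then gives a
  generating set of at most that size.\<close>

lemma min_num_generators_eq_rel_length:
  assumes fg: "fg_module R M"
  shows "enat (min_num_generators R M) = rel_length R M (ideal_mult R \<mm> M) (carrier M)"
proof (rule antisym)
  define Q where "Q n \<longleftrightarrow> (\<exists>S. finite S \<and> card S = n \<and> S \<subseteq> carrier M \<and> gen_submodule R M S = carrier M)" for n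
  have min: "min_num_generators R M = (LEAST n. Q n)" by (simp add: min_num_generators_def Q_def)
  have "\<exists>n. Q n" using fg unfolding fg_module_def Q_def by auto
  then have "Q (min_num_generators R M)" unfolding min by (rule LeastI_ex)
  then obtain S where S: "finite S" "card S = min_num_generators R M" "S \<subseteq> carrier M" "gen_submodule R M S = carrier M"
    unfolding Q_def by blast
  have "gen_submodule R M (ideal_mult R \<mm> M \<union> S) = carrier M"
    using gen_mono[of S "ideal_mult R \<mm> M \<union> S"] S submoduleE(1)[OF submodule_mM]
      gen_in_carrier[of "ideal_mult R \<mm> M \<union> S"] by auto
  then show le: "rel_length R M (ideal_mult R \<mm> M) (carrier M) \<le> enat (min_num_generators R M)"
    using rel_length_gen_le_card[OF S(1) submodule_mM S(3)] smult_in_ideal_mult[of _ \<mm>] S(2,3)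
    by (metis subsetD)
  then obtain n where n: "rel_length R M (ideal_mult R \<mm> M) (carrier M) = enat n"
    by (metis enat_ile)
  then obtain S where S: "finite S" "card S \<le> n" "S \<subseteq> carrier M"
      "gen_submodule R M (ideal_mult R \<mm> M \<union> S) = carrier M"
    using ex_generators_over_mM[OF submodule_mM, of n] by auto
  then have "Q (card S)" using nakayama_carrier[OF fg S(3,4)] unfolding Q_def by blast
  then have "min_num_generators R M \<le> card S" unfolding min by (rule Least_le)
  then show "enat (min_num_generators R M) \<le> rel_length R M (ideal_mult R \<mm> M) (carrier M)"
    using S(2) n by simp
qed

end

section \<open>Quotient modules\<close>

context module
begin

context
  fixes H assumes H: "submodule H R M"
begin

lemma abelian_subgroup_submodule: "abelian_subgroup H M"
  using abelian_subgroupI3[OF additive_subgroupI[OF submodule.axioms(1)[OF H]]]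
    M.abelian_group_axioms .

lemma coset_eq_iff:
  assumes "a \<in> carrier M" "b \<in> carrier M"
  shows "H +>\<^bsub>M\<^esub> a = H +>\<^bsub>M\<^esub> b \<longleftrightarrow> a \<ominus>\<^bsub>M\<^esub> b \<in> H"
proof -
  interpret S: abelian_subgroup H M by (rule abelian_subgroup_submodule)
  have "H +>\<^bsub>M\<^esub> a = H +>\<^bsub>M\<^esub> b \<longleftrightarrow> a \<in> H +>\<^bsub>M\<^esub> b"
    using S.a_repr_independence'[of a b] S.a_rcos_self[of a] assms by auto
  then show ?thesis using S.a_rcos_module[of b a] assms by (simp add: a_minus_def)
qed

lemma coset_eq_H_iff: "a \<in> carrier M \<Longrightarrow> H +>\<^bsub>M\<^esub> a = H \<longleftrightarrow> a \<in> H"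
  using coset_eq_iff[of a "\<zero>\<^bsub>M\<^esub>"] submoduleE(1)[OF H] M.minus_equality[of "\<zero>\<^bsub>M\<^esub>" "\<zero>\<^bsub>M\<^esub>"]
  by (simp add: a_minus_def)

lemma carrier_quotient_module: "carrier (quotient_module M H) = {H +>\<^bsub>M\<^esub> a | a. a \<in> carrier M}"
  by (auto simp: quotient_module_def A_RCOSETS_def')

lemma coset_in_carrier: "a \<in> carrier M \<Longrightarrow> H +>\<^bsub>M\<^esub> a \<in> carrier (quotient_module M H)"
  unfolding carrier_quotient_module by blast

lemma zero_quotient_module [simp]: "\<zero>\<^bsub>quotient_module M H\<^esub> = H"
  by (simp add: quotient_module_def)

lemma add_quotient_module:
  assumes "a \<in> carrier M" "b \<in> carrier M"
  shows "(H +>\<^bsub>M\<^esub> a) \<oplus>\<^bsub>quotient_module M H\<^esub> (H +>\<^bsub>M\<^esub> b) = H +>\<^bsub>M\<^esub> (a \<oplus>\<^bsub>M\<^esub> b)"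
  using abelian_subgroup.a_rcos_sum[OF abelian_subgroup_submodule assms]
  by (simp add: quotient_module_def)

text \<open>The union in the definition of the action runs over all representatives x of one coset.
  They all give the same coset, because r (x - a) lies in H.\<close>

lemma smult_quotient_module:
  assumes "r \<in> carrier R" "a \<in> carrier M"
  shows "r \<odot>\<^bsub>quotient_module M H\<^esub> (H +>\<^bsub>M\<^esub> a) = H +>\<^bsub>M\<^esub> (r \<odot>\<^bsub>M\<^esub> a)"
proof -
  interpret S: abelian_subgroup H M by (rule abelian_subgroup_submodule)
  have "H +>\<^bsub>M\<^esub> (r \<odot>\<^bsub>M\<^esub> x) = H +>\<^bsub>M\<^esub> (r \<odot>\<^bsub>M\<^esub> a)" if "x \<in> H +>\<^bsub>M\<^esub> a" for x
  proof -
    have x: "x \<in> carrier M" using S.a_elemrcos_carrier assms that by blast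
    have "x \<ominus>\<^bsub>M\<^esub> a \<in> H" using S.a_rcos_module[of a x] x assms that by (simp add: a_minus_def)
    then have "r \<odot>\<^bsub>M\<^esub> (x \<ominus>\<^bsub>M\<^esub> a) \<in> H" using submoduleE(4)[OF H] assms by blast
    then show ?thesis
      using x assms by (simp add: coset_eq_iff a_minus_def smult_r_distr smult_r_minus)
  qed
  then have "(\<Union>x\<in>H +>\<^bsub>M\<^esub> a. H +>\<^bsub>M\<^esub> (r \<odot>\<^bsub>M\<^esub> x)) = (\<Union>x\<in>H +>\<^bsub>M\<^esub> a. H +>\<^bsub>M\<^esub> (r \<odot>\<^bsub>M\<^esub> a))"
    by (rule SUP_cong[OF refl])
  also have "\<dots> = H +>\<^bsub>M\<^esub> (r \<odot>\<^bsub>M\<^esub> a)" using S.a_rcos_self[OF assms(2)] by blast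
  finally show ?thesis by (simp add: quotient_module_def)
qed

lemma coset_zero: "H +>\<^bsub>M\<^esub> \<zero>\<^bsub>M\<^esub> = H"
  using coset_eq_H_iff submodule_zero_closed[OF H] by blast

lemma abelian_group_quotient_module: "abelian_group (quotient_module M H)"
proof (rule abelian_groupI)
  fix x assume "x \<in> carrier (quotient_module M H)"
  then obtain u where u: "u \<in> carrier M" "x = H +>\<^bsub>M\<^esub> u" by (auto simp: carrier_quotient_module)
  then show "\<zero>\<^bsub>quotient_module M H\<^esub> \<oplus>\<^bsub>quotient_module M H\<^esub> x = x"
    using add_quotient_module[of "\<zero>\<^bsub>M\<^esub>" u] by (simp add: coset_zero)
  have "(H +>\<^bsub>M\<^esub> (\<ominus>\<^bsub>M\<^esub> u)) \<oplus>\<^bsub>quotient_module M H\<^esub> x = \<zero>\<^bsub>quotient_module M H\<^esub>"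
    using u by (simp add: add_quotient_module M.l_neg coset_zero)
  then show "\<exists>y\<in>carrier (quotient_module M H). y \<oplus>\<^bsub>quotient_module M H\<^esub> x = \<zero>\<^bsub>quotient_module M H\<^esub>"
    using coset_in_carrier[OF M.a_inv_closed[OF u(1)]] by blast
  fix y assume "y \<in> carrier (quotient_module M H)"
  then obtain v where v: "v \<in> carrier M" "y = H +>\<^bsub>M\<^esub> v" by (auto simp: carrier_quotient_module)
  show "x \<oplus>\<^bsub>quotient_module M H\<^esub> y \<in> carrier (quotient_module M H)"
    using u v by (simp add: coset_in_carrier add_quotient_module)
  show "x \<oplus>\<^bsub>quotient_module M H\<^esub> y = y \<oplus>\<^bsub>quotient_module M H\<^esub> x"
    using u v by (simp add: add_quotient_module M.a_comm)
  fix z assume "z \<in> carrier (quotient_module M H)"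
  then obtain w where w: "w \<in> carrier M" "z = H +>\<^bsub>M\<^esub> w" by (auto simp: carrier_quotient_module)
  show "x \<oplus>\<^bsub>quotient_module M H\<^esub> y \<oplus>\<^bsub>quotient_module M H\<^esub> z =
      x \<oplus>\<^bsub>quotient_module M H\<^esub> (y \<oplus>\<^bsub>quotient_module M H\<^esub> z)"
    using u v w by (simp add: add_quotient_module M.a_assoc)
  next
  show "\<zero>\<^bsub>quotient_module M H\<^esub> \<in> carrier (quotient_module M H)"
    using coset_in_carrier[OF M.zero_closed] by (simp add: coset_zero)
qed

lemma module_quotient_module: "module R (quotient_module M H)"
proof (rule moduleI[OF R.cring_axioms abelian_group_quotient_module])
  fix a b x y assume a: "a \<in> carrier R" and b: "b \<in> carrier R"
    and x: "x \<in> carrier (quotient_module M H)" and y: "y \<in> carrier (quotient_module M H)"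
  obtain u v where u: "u \<in> carrier M" "x = H +>\<^bsub>M\<^esub> u" and v: "v \<in> carrier M" "y = H +>\<^bsub>M\<^esub> v"
    using x y
    by (auto simp: carrier_quotient_module)
  show "a \<odot>\<^bsub>quotient_module M H\<^esub> x \<in> carrier (quotient_module M H)"
    using a u by (simp add: smult_quotient_module coset_in_carrier)
  show "(a \<oplus> b) \<odot>\<^bsub>quotient_module M H\<^esub> x =
      a \<odot>\<^bsub>quotient_module M H\<^esub> x \<oplus>\<^bsub>quotient_module M H\<^esub> b \<odot>\<^bsub>quotient_module M H\<^esub> x"
    using a b u by (simp add: smult_quotient_module add_quotient_module smult_l_distr)
  show "a \<odot>\<^bsub>quotient_module M H\<^esub> (x \<oplus>\<^bsub>quotient_module M H\<^esub> y) =
      a \<odot>\<^bsub>quotient_module M H\<^esub> x \<oplus>\<^bsub>quotient_module M H\<^esub> a \<odot>\<^bsub>quotient_module M H\<^esub> y"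
    using a u v by (simp add: smult_quotient_module add_quotient_module smult_r_distr)
  show "(a \<otimes> b) \<odot>\<^bsub>quotient_module M H\<^esub> x = a \<odot>\<^bsub>quotient_module M H\<^esub> (b \<odot>\<^bsub>quotient_module M H\<^esub> x)"
    using a b u by (simp add: smult_quotient_module smult_assoc1)
next
  fix x assume "x \<in> carrier (quotient_module M H)"
  then obtain u where u: "u \<in> carrier M" "x = H +>\<^bsub>M\<^esub> u" by (auto simp: carrier_quotient_module)
  show "\<one> \<odot>\<^bsub>quotient_module M H\<^esub> x = x" using u by (simp add: smult_quotient_module)
qed

text \<open>This is the correspondence of submodules under M \<rightarrow> M / H. It replaces the
  quotients in the definition of multiplicity by intervals of submodules of M.\<close>

lemma module_length_quotient:
  "module_length R (quotient_module M H) = rel_length R M H (carrier M)"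
proof -
  define Q where "Q = quotient_module M H"
  interpret Q: module R Q unfolding Q_def by (rule module_quotient_module)
  have cQ: "carrier Q = {H +>\<^bsub>M\<^esub> a | a. a \<in> carrier M}" unfolding Q_def by (rule carrier_quotient_module)
  have zQ: "\<zero>\<^bsub>Q\<^esub> = H" unfolding Q_def by simp
  note addQ = add_quotient_module[folded Q_def] and smultQ = smult_quotient_module[folded Q_def]
  have H0: "H +>\<^bsub>M\<^esub> \<zero>\<^bsub>M\<^esub> = H" using coset_eq_H_iff submodule_zero_closed[OF H] by blast
  have minusQ: "\<ominus>\<^bsub>Q\<^esub> (H +>\<^bsub>M\<^esub> a) = H +>\<^bsub>M\<^esub> (\<ominus>\<^bsub>M\<^esub> a)" if "a \<in> carrier M" for a
    using that by (intro Q.M.minus_equality) (auto simp: cQ addQ zQ H0 M.l_neg)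
  show ?thesis unfolding Q_def[symmetric] module_length_def rel_length_def
  proof (rule antisym)
    let ?f = "\<lambda>V. {m \<in> carrier M. H +>\<^bsub>M\<^esub> m \<in> V}"
    show "sup_chain_length (\<lambda>U. submodule U R Q)
      \<le> sup_chain_length (\<lambda>U. submodule U R M \<and> H \<subseteq> U \<and> U \<subseteq> carrier M)"
    proof (rule sup_chain_length_map_le[where f = ?f])
      fix V assume V: "submodule V R Q"
      have "submodule (?f V) R M"
        using Q.submoduleE[OF V] Q.submodule_zero_closed[OF V] minusQ
        by (intro submoduleI) (auto simp: addQ[symmetric] smultQ[symmetric] minusQ[symmetric] H0 zQ)
      moreover have "H +>\<^bsub>M\<^esub> m \<in> V" if "m \<in> H" for m
        using that coset_eq_H_iff[of m] submoduleE(1)[OF H] Q.submodule_zero_closed[OF V] zQ by auto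
      ultimately show "submodule (?f V) R M \<and> H \<subseteq> ?f V \<and> ?f V \<subseteq> carrier M"
        using submoduleE(1)[OF H] by auto
      fix W assume W: "submodule W R Q" and VW: "V \<subset> W"
      then obtain C where C: "C \<in> W" "C \<notin> V" by blast
      then have "C \<in> carrier Q" using Q.submoduleE(1)[OF W] by auto
      then obtain m where "m \<in> carrier M" "C = H +>\<^bsub>M\<^esub> m" by (auto simp: cQ)
      then show "?f V \<subset> ?f W" using C VW by blast
    qed
    let ?g = "\<lambda>V. (+>\<^bsub>M\<^esub>) H ` V"
    show "sup_chain_length (\<lambda>U. submodule U R M \<and> H \<subseteq> U \<and> U \<subseteq> carrier M)
      \<le> sup_chain_length (\<lambda>U. submodule U R Q)"
    proof (rule sup_chain_length_map_le[where f = ?g])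
      fix V assume V: "submodule V R M \<and> H \<subseteq> V \<and> V \<subseteq> carrier M"
      then have Vc: "\<And>v. v \<in> V \<Longrightarrow> v \<in> carrier M" and Vs: "submodule V R M" by auto
      note v = submoduleE[OF Vs]
      show "submodule (?g V) R Q"
      proof (rule Q.submoduleI)
        show "\<zero>\<^bsub>Q\<^esub> \<in> ?g V"
          using submodule_zero_closed[OF Vs] H0 zQ by (metis imageI)
      qed (use v Vc in \<open>auto simp: cQ minusQ addQ smultQ\<close>)
      fix W assume W: "submodule W R M \<and> H \<subseteq> W \<and> W \<subseteq> carrier M" and VW: "V \<subset> W"
      then obtain w where w: "w \<in> W" "w \<notin> V" by blast
      have "H +>\<^bsub>M\<^esub> w \<notin> ?g V"
      proof
        assume "H +>\<^bsub>M\<^esub> w \<in> ?g V"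
        then obtain x where x: "x \<in> V" "H +>\<^bsub>M\<^esub> w = H +>\<^bsub>M\<^esub> x" by auto
        have wx: "w \<in> carrier M" "x \<in> carrier M" using w x V W by auto
        then have "w \<ominus>\<^bsub>M\<^esub> x \<in> V" using x(2) coset_eq_iff[of w x] V by blast
        then have "(w \<ominus>\<^bsub>M\<^esub> x) \<oplus>\<^bsub>M\<^esub> x \<in> V" using v(5) x(1) by blast
        also have "(w \<ominus>\<^bsub>M\<^esub> x) \<oplus>\<^bsub>M\<^esub> x = w" using wx by (simp add: a_minus_def M.a_assoc M.l_neg)
        finally show False using w by simp
      qed
      then show "?g V \<subset> ?g W" using w VW by blast
    qed
  qed
qed

end

text \<open>Being a nonzerodivisor on M / H is expressed by elements of M, which removes quotient
  modules from the computation of depth.\<close>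

lemma regular_sequence_iff:
  assumes "set xs \<subseteq> carrier R"
  shows "regular_sequence R M xs \<longleftrightarrow>
    (\<forall>i<length xs. \<forall>m\<in>carrier M. (xs ! i) \<odot>\<^bsub>M\<^esub> m \<in> ideal_mult R (genideal R (set (take i xs))) M \<longrightarrow>
        m \<in> ideal_mult R (genideal R (set (take i xs))) M) \<and>
    ideal_mult R (genideal R (set xs)) M \<noteq> carrier M"
proof -
  have "(\<forall>y\<in>carrier (quotient_module M H). x \<odot>\<^bsub>quotient_module M H\<^esub> y = \<zero>\<^bsub>quotient_module M H\<^esub> \<longrightarrow>
          y = \<zero>\<^bsub>quotient_module M H\<^esub>) \<longleftrightarrow> (\<forall>m\<in>carrier M. x \<odot>\<^bsub>M\<^esub> m \<in> H \<longrightarrow> m \<in> H)"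
    if H: "submodule H R M" and x: "x \<in> carrier R" for H x
  proof -
    have "(\<forall>y\<in>carrier (quotient_module M H). x \<odot>\<^bsub>quotient_module M H\<^esub> y = \<zero>\<^bsub>quotient_module M H\<^esub> \<longrightarrow>
          y = \<zero>\<^bsub>quotient_module M H\<^esub>) \<longleftrightarrow>
        (\<forall>m\<in>carrier M. x \<odot>\<^bsub>quotient_module M H\<^esub> (H +>\<^bsub>M\<^esub> m) = H \<longrightarrow> H +>\<^bsub>M\<^esub> m = H)"
      by (auto simp: carrier_quotient_module[OF H] zero_quotient_module[OF H])
    then show ?thesis
      using x by (auto simp: smult_quotient_module[OF H] coset_eq_H_iff[OF H])
  qed
  moreover have "submodule (ideal_mult R (genideal R (set (take i xs))) M) R M" for i
    by (rule submodule_ideal_mult[OF additive_subgroup.a_subset[OF ideal.axioms(1)[OF R.genideal_ideal]]])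
       (use assms set_take_subset[of i xs] in auto)
  moreover have "xs ! i \<in> carrier R" if "i < length xs" for i using that assms by auto
  ultimately show ?thesis unfolding regular_sequence_def Let_def using assms by simp
qed

text \<open>This serves the first entry of a regular sequence, where the submodule divided out comes
  from the empty list.\<close>

lemma ideal_mult_genideal_empty: "ideal_mult R (genideal R {}) M = {\<zero>\<^bsub>M\<^esub>}"
proof -
  have "genideal R {} = {\<zero>}"
    using R.genideal_minimal[OF R.zeroideal, of "{}"]
      additive_subgroup.zero_closed[OF ideal.axioms(1)[OF R.genideal_ideal[of "{}"]]] by auto
  then have "ideal_mult R (genideal R {}) M \<subseteq> {\<zero>\<^bsub>M\<^esub>}"
    by (intro ideal_mult_minimal submodule_zero) auto
  then show ?thesis
    using submodule_zero_closed[OF submodule_ideal_mult[of "genideal R {}"]] \<open>genideal R {} = {\<zero>}\<close> by auto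
qed

definition torsion_free :: bool where
  "torsion_free \<longleftrightarrow> (\<forall>r\<in>carrier R. \<forall>m\<in>carrier M. r \<odot>\<^bsub>M\<^esub> m = \<zero>\<^bsub>M\<^esub> \<longrightarrow> r = \<zero> \<or> m = \<zero>\<^bsub>M\<^esub>)"

lemma torsion_freeD:
  "torsion_free \<Longrightarrow> r \<in> carrier R \<Longrightarrow> m \<in> carrier M \<Longrightarrow> r \<odot>\<^bsub>M\<^esub> m = \<zero>\<^bsub>M\<^esub> \<Longrightarrow> r \<noteq> \<zero> \<Longrightarrow> m = \<zero>\<^bsub>M\<^esub>"
  unfolding torsion_free_def by blast

end

section \<open>Krull dimension under surjections and isomorphisms\<close>

lemma krull_dim_le_of_surj_hom:
  assumes "h \<in> ring_hom R S" "h ` carrier R = carrier S" "cring R" "cring S"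
  shows "krull_dim S \<le> krull_dim R"
  unfolding krull_dim_def
proof (rule sup_chain_length_map_le[where f = "\<lambda>P. {r \<in> carrier R. h r \<in> P}"])
  interpret R: cring R by fact
  interpret S: cring S by fact
  interpret h: ring_hom_ring R S h using assms by (intro ring_hom_ringI2) (auto intro: R.ring_axioms S.ring_axioms)
  fix P assume "primeideal P S"
  then show "primeideal {r \<in> carrier R. h r \<in> P} R" by (rule h.primeideal_vimage[OF assms(3)])
next
  fix P P' assume P: "primeideal P S" "primeideal P' S" "P \<subset> P'"
  then obtain s where s: "s \<in> P'" "s \<notin> P" by blast
  then have "s \<in> h ` carrier R"
    using assms(2) ideal.Icarr[OF primeideal.axioms(1)[OF P(2)]] by auto
  then show "{r \<in> carrier R. h r \<in> P} \<subset> {r \<in> carrier R. h r \<in> P'}" using s P(3) by blast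
qed

text \<open>The dimension of a faithful module is by definition that of R / 0, a ring of cosets that
  is isomorphic to R but not equal to it.\<close>

lemma krull_dim_iso:
  assumes "R \<simeq> S" "cring R" "cring S"
  shows "krull_dim R = krull_dim S"
proof (rule antisym)
  have iso: "krull_dim T \<le> krull_dim S" if ST: "S \<simeq> T" "cring S" "cring T"
    for S :: "('x, 'y) ring_scheme" and T :: "('z, 'w) ring_scheme"
  proof -
    obtain h where "h \<in> ring_iso S T" using ST unfolding is_ring_iso_def by auto
    then show ?thesis using ST
      by (intro krull_dim_le_of_surj_hom[of h]) (auto simp: ring_iso_def bij_betw_def)
  qed
  show "krull_dim S \<le> krull_dim R" using iso assms by blast
  show "krull_dim R \<le> krull_dim S"
    using iso[OF ring_iso_sym[OF cring.axioms(1)[OF assms(2)] assms(1)]] assms by blast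
qed

section \<open>One-dimensional local domains\<close>

text \<open>The axiom \<open>power_in_principal\<close> puts \<open>\<mm>\<close> into the radical
  of every nonzero principal ideal. For a local domain with nonzero \<open>\<mm>\<close> this
  expresses dimension one, in a form that can be applied directly to elements.\<close>

locale curve_ring = domain R + local_cring R \<mm> for R (structure) and \<mm> +
  assumes finite_generators_m: "\<exists>Y. finite Y \<and> Y \<subseteq> \<mm> \<and> genideal R Y = \<mm>"
    and m_nonzero: "\<mm> \<noteq> {\<zero>}"
    and power_in_principal: "\<lbrakk>y \<in> carrier R; y \<noteq> \<zero>; z \<in> \<mm>\<rbrakk> \<Longrightarrow> \<exists>(n::nat). \<exists>q\<in>carrier R. z [^] n = y \<otimes> q"
begin

text \<open>A nonzero prime contains some nonzero y, hence a power of each z in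
  \<open>\<mm>\<close>, hence z itself.\<close>

lemma primeideal_iff_zero_or_m: "primeideal P R \<longleftrightarrow> P = {\<zero>} \<or> P = \<mm>"
proof
  assume P: "primeideal P R"
  interpret P: primeideal P R by (rule P)
  show "P = {\<zero>} \<or> P = \<mm>"
  proof (cases "P = {\<zero>}")
    case False
    then obtain y where y: "y \<in> P" "y \<noteq> \<zero>" using P.zero_closed by auto
    have "z \<in> P" if z: "z \<in> \<mm>" for z
    proof -
      obtain n :: nat and q where "q \<in> carrier R" "z [^] n = y \<otimes> q"
        using power_in_principal[OF P.Icarr[OF y(1)] y(2) z] by blast
      then have "z [^] n \<in> P" using P.I_r_closed[OF y(1)] by simp
      then show "z \<in> P"
      proof (induction n)
        case 0
        then show ?case using P.one_imp_carrier P.I_notcarr by auto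
      next
        case (Suc n)
        then show ?case using P.I_prime[of "z [^] n" z] z by auto
      qed
    qed
    then show ?thesis
      using maximalideal.I_maximal[OF maximal P.ideal_axioms] P.a_subset P.I_notcarr by auto
  qed simp
next
  assume "P = {\<zero>} \<or> P = \<mm>"
  then show "primeideal P R"
    using zeroprimeideal maximalideal_prime[OF maximal] by blast
qed

lemma krull_dim_eq_1: "krull_dim R = 1"
proof -
  have *: "enat n \<le> krull_dim R \<longleftrightarrow> (\<exists>U. strict_chain (\<lambda>P. primeideal P R) n U)" for n
    unfolding krull_dim_def by (rule enat_le_sup_chain_length_iff[where V = "{\<zero>}"]) (rule zeroprimeideal)
  have zm: "{\<zero>} \<subset> \<mm>"
    using m_nonzero additive_subgroup.zero_closed[OF ideal.axioms(1)[OF m_ideal]] by auto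
  have "strict_chain (\<lambda>P. primeideal P R) 1 {\<zero>}"
    using zm by (auto simp: primeideal_iff_zero_or_m simp del: psubset_eq)
  then have "enat 1 \<le> krull_dim R" unfolding * by blast
  moreover have "\<not> strict_chain (\<lambda>P. primeideal P R) 2 U" for U
    using zm by (auto simp: numeral_2_eq_2 primeideal_iff_zero_or_m)
  then have "\<not> enat 2 \<le> krull_dim R" unfolding * by blast
  ultimately show ?thesis by (cases "krull_dim R") (auto simp: one_enat_def)
qed

end

locale curve_module = module R M + curve_ring R \<mm> for R (structure) and M (structure) and \<mm>

sublocale curve_module \<subseteq> local_module by intro_locales

context curve_module
begin

text \<open>If r m = 0 with r nonzero, some power of z is a multiple of r and so kills m. Cancelling
  z repeatedly leaves m = 0.\<close>

lemma nonzerodivisor_imp_torsion_free: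
  assumes z: "z \<in> \<mm>" and nz: "\<And>m. m \<in> carrier M \<Longrightarrow> z \<odot>\<^bsub>M\<^esub> m = \<zero>\<^bsub>M\<^esub> \<Longrightarrow> m = \<zero>\<^bsub>M\<^esub>"
  shows torsion_free
  unfolding torsion_free_def
proof (intro ballI impI)
  fix r m assume r: "r \<in> carrier R" and m: "m \<in> carrier M" and rm: "r \<odot>\<^bsub>M\<^esub> m = \<zero>\<^bsub>M\<^esub>"
  show "r = \<zero> \<or> m = \<zero>\<^bsub>M\<^esub>"
  proof (cases "r = \<zero>")
    case False
    obtain n :: nat and q where nq: "q \<in> carrier R" "z [^] n = r \<otimes> q"
      using power_in_principal[OF r False z] by blast
    then have "z [^] n \<odot>\<^bsub>M\<^esub> m = q \<odot>\<^bsub>M\<^esub> (r \<odot>\<^bsub>M\<^esub> m)"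
      using r m by (metis R.m_comm smult_assoc1)
    then have "z [^] n \<odot>\<^bsub>M\<^esub> m = \<zero>\<^bsub>M\<^esub>" using rm nq by simp
    then have "m = \<zero>\<^bsub>M\<^esub>"
    proof (induction n)
      case (Suc n)
      have "z \<odot>\<^bsub>M\<^esub> (z [^] n \<odot>\<^bsub>M\<^esub> m) = \<zero>\<^bsub>M\<^esub>"
        using Suc.prems z m by (simp add: smult_assoc1[symmetric] R.m_comm)
      then show ?case using nz[of "z [^] n \<odot>\<^bsub>M\<^esub> m"] z m Suc.IH by (meson R.nat_pow_closed m_carrier smult_closed)
    qed (use m in simp)
    then show ?thesis ..
  qed simp
qed

lemma module_dim_eq_1:
  assumes torsion_free "carrier M \<noteq> {\<zero>\<^bsub>M\<^esub>}"
  shows "module_dim R M = 1"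
proof -
  obtain m where "m \<in> carrier M" "m \<noteq> \<zero>\<^bsub>M\<^esub>" using assms(2) M.zero_closed by blast
  then have "annihilator R M = {\<zero>}"
    using assms(1) by (auto simp: annihilator_def torsion_free_def)
  moreover have "krull_dim R = krull_dim (R Quot {\<zero>})"
    by (rule krull_dim_iso[OF R.FactRing_zeroideal(2) R.cring_axioms
          ideal.quotient_is_cring[OF R.zeroideal R.cring_axioms]])
  ultimately show ?thesis unfolding module_dim_def using krull_dim_eq_1 by simp
qed

lemma ideal_mult_proper:
  assumes fg: "fg_module R M" and "carrier M \<noteq> {\<zero>\<^bsub>M\<^esub>}" and "I \<subseteq> \<mm>"
  shows "ideal_mult R I M \<noteq> carrier M"
proof
  assume eq: "ideal_mult R I M = carrier M"
  have "ideal_mult R I M \<subseteq> ideal_mult R \<mm> M"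
    using assms(3) by (intro ideal_mult_minimal submodule_mM smult_in_ideal_mult) auto
  then have "gen_submodule R M (ideal_mult R \<mm> M \<union> {}) = carrier M"
    using eq submoduleE(1)[OF submodule_mM] gen_submodule_id[OF carrier_is_submodule] by auto
  then have "gen_submodule R M {} = carrier M" using nakayama_carrier[OF fg] by blast
  then show False using assms(2) gen_minimal[OF _ submodule_zero, of "{}"] M.zero_closed by auto
qed

text \<open>Positive depth supplies a nonzerodivisor in \<open>\<mm>\<close>, which suffices for
  torsion-freeness. Conversely any nonzero element of \<open>\<mm>\<close> is regular on a
  torsion-free M, and no regular sequence is longer than that.\<close>

lemma maximal_cohen_macaulay_iff:
  assumes fg: "fg_module R M"
  shows "maximal_cohen_macaulay R \<mm> M \<longleftrightarrow> carrier M \<noteq> {\<zero>\<^bsub>M\<^esub>} \<and> torsion_free"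
proof
  assume mcm: "maximal_cohen_macaulay R \<mm> M"
  then have "depth R \<mm> M = 1" and ne: "carrier M \<noteq> {\<zero>\<^bsub>M\<^esub>}"
    by (auto simp: maximal_cohen_macaulay_def krull_dim_eq_1)
  then have "0 < Sup {enat (length xs) | xs. set xs \<subseteq> \<mm> \<and> regular_sequence R M xs}"
    by (simp add: depth_def)
  then obtain xs where xs: "set xs \<subseteq> \<mm>" "regular_sequence R M xs" "length xs > 0"
    by (auto simp: less_Sup_iff zero_enat_def)
  have xsR: "set xs \<subseteq> carrier R" using xs(1) by auto
  have nz: "m = \<zero>\<^bsub>M\<^esub>" if "m \<in> carrier M" "(xs ! 0) \<odot>\<^bsub>M\<^esub> m = \<zero>\<^bsub>M\<^esub>" for m
    using regular_sequence_iff[OF xsR, THEN iffD1, OF xs(2), THEN conjunct1, THEN spec, of 0]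
      that xs(3) ideal_mult_genideal_empty by simp
  have "torsion_free"
  proof (rule nonzerodivisor_imp_torsion_free[of "xs ! 0"])
    show "xs ! 0 \<in> \<mm>" using xs by (simp add: subset_iff)
    fix m assume "m \<in> carrier M" "(xs ! 0) \<odot>\<^bsub>M\<^esub> m = \<zero>\<^bsub>M\<^esub>"
    then show "m = \<zero>\<^bsub>M\<^esub>" by (rule nz)
  qed
  then show "carrier M \<noteq> {\<zero>\<^bsub>M\<^esub>} \<and> torsion_free" using ne by blast
next
  assume A: "carrier M \<noteq> {\<zero>\<^bsub>M\<^esub>} \<and> torsion_free"
  define D where "D = {enat (length xs) | xs. set xs \<subseteq> \<mm> \<and> regular_sequence R M xs}"
  obtain x where x: "x \<in> \<mm>" "x \<noteq> \<zero>"
    using m_nonzero additive_subgroup.zero_closed[OF ideal.axioms(1)[OF m_ideal]] by auto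
  have "regular_sequence R M [x]"
  proof -
    have "ideal_mult R (genideal R {x}) M \<noteq> carrier M"
      using x A by (intro ideal_mult_proper fg R.genideal_minimal m_ideal) auto
    moreover have "m = \<zero>\<^bsub>M\<^esub>" if "m \<in> carrier M" "x \<odot>\<^bsub>M\<^esub> m = \<zero>\<^bsub>M\<^esub>" for m
      using torsion_freeD[of x m] that x A by auto
    ultimately show ?thesis using x
      by (subst regular_sequence_iff) (auto simp: ideal_mult_genideal_empty)
  qed
  then have "enat (length [x]) \<in> D" unfolding D_def using x(1) by fastforce
  then have 1: "1 \<le> Sup D" by (auto simp: one_enat_def intro: Sup_upper)
  \<comment> \<open>A direct argument against two entries y, z: some power of z is a multiple of y,
    so it maps M into y M. As z is injective modulo y M, this forces M = y M, against the properness
    required of a regular sequence.\<close>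
  have "length xs \<le> 1" if xs: "set xs \<subseteq> \<mm>" and reg: "regular_sequence R M xs" for xs
  proof (rule ccontr)
    assume "\<not> length xs \<le> 1"
    then obtain y z zs where xs_eq: "xs = y # z # zs" by (cases xs; cases "tl xs") auto
    have y: "y \<in> \<mm>" and z: "z \<in> \<mm>" using xs by (auto simp: xs_eq)
    define H where "H = ideal_mult R (genideal R {y}) M"
    have xsR: "set xs \<subseteq> carrier R" using xs by auto
    have I: "ideal (genideal R (set xs)) R" using xsR by (rule R.genideal_ideal)
    have IM: "submodule (ideal_mult R (genideal R (set xs)) M) R M"
      by (rule submodule_ideal_mult[OF additive_subgroup.a_subset[OF ideal.axioms(1)[OF I]]])
    note reg' = reg[unfolded regular_sequence_iff[OF xsR]]
    have y_nz: "m = \<zero>\<^bsub>M\<^esub>" if "m \<in> carrier M" "y \<odot>\<^bsub>M\<^esub> m = \<zero>\<^bsub>M\<^esub>" for m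
      using conjunct1[OF reg', THEN spec, of 0] that by (simp add: xs_eq ideal_mult_genideal_empty)
    have z_nz: "m \<in> H" if "m \<in> carrier M" "z \<odot>\<^bsub>M\<^esub> m \<in> H" for m
      using conjunct1[OF reg', THEN spec, of 1] that by (simp add: xs_eq H_def)
    have "y \<noteq> \<zero>" using y_nz A M.zero_closed by fastforce
    then obtain n :: nat and q where nq: "q \<in> carrier R" "z [^] n = y \<otimes> q"
      using power_in_principal[OF _ _ z, of y] y by auto
    have "m \<in> H" if m: "m \<in> carrier M" for m
    proof -
      have "y \<odot>\<^bsub>M\<^esub> (q \<odot>\<^bsub>M\<^esub> m) \<in> H"
        unfolding H_def using nq m y R.genideal_self'[of y] by (intro smult_in_ideal_mult) auto
      then have "z [^] n \<odot>\<^bsub>M\<^esub> m \<in> H" using nq m y by (simp add: smult_assoc1)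
      then show "m \<in> H"
      proof (induction n)
        case (Suc n)
        have "z \<odot>\<^bsub>M\<^esub> (z [^] n \<odot>\<^bsub>M\<^esub> m) \<in> H"
          using Suc.prems z m by (simp add: smult_assoc1[symmetric] R.m_comm)
        then have "z [^] n \<odot>\<^bsub>M\<^esub> m \<in> H" using z m by (intro z_nz[of "z [^] n \<odot>\<^bsub>M\<^esub> m"]) auto
        then show ?case by (rule Suc.IH)
      qed (use m in simp)
    qed
    then have "carrier M \<subseteq> H" by blast
    moreover have "H \<subseteq> ideal_mult R (genideal R (set xs)) M"
      unfolding H_def
    proof (rule ideal_mult_minimal)
      show "submodule (ideal_mult R (genideal R (set xs)) M) R M" by (rule IM)
      have "genideal R {y} \<subseteq> genideal R (set xs)"
        using R.genideal_self[OF xsR] by (intro R.genideal_minimal I) (auto simp: xs_eq)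
      then show "r \<odot>\<^bsub>M\<^esub> x \<in> ideal_mult R (genideal R (set xs)) M"
        if "r \<in> genideal R {y}" "x \<in> carrier M" for r x
        using that by (intro smult_in_ideal_mult) auto
    qed
    moreover have "ideal_mult R (genideal R (set xs)) M \<subseteq> carrier M"
      by (rule submoduleE(1)[OF IM])
    ultimately show False using conjunct2[OF reg'] by blast
  qed
  then have "Sup D \<le> 1" by (intro Sup_least) (auto simp: D_def one_enat_def)
  then have "depth R \<mm> M = 1" using 1 by (simp add: depth_def D_def)
  then show "maximal_cohen_macaulay R \<mm> M"
    unfolding maximal_cohen_macaulay_def using module_dim_eq_1 A fg krull_dim_eq_1 by simp
qed

end

section \<open>Reductions and multiplicity\<close>

context curve_ring
begin

text \<open>This is what is used of a reduction \<open>x R\<close> of \<open>\<mm>\<close>: the filtrations by \<open>\<mm>\<^sup>n\<close> and by \<open>x\<^sup>n R\<close>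
  differ only by a bounded shift, so that both compute the multiplicity.\<close>

definition principal_reduction :: "'a \<Rightarrow> bool" where
  "principal_reduction x \<longleftrightarrow> x \<in> \<mm> \<and> x \<noteq> \<zero> \<and>
    (\<exists>c. \<forall>n. \<forall>y\<in>\<mm> [^]\<^bsub>ideals_set R\<^esub> (n + c). \<exists>q\<in>carrier R. y = x [^] (n::nat) \<otimes> q)"

lemma m_pow_Suc: "\<mm> [^]\<^bsub>ideals_set R\<^esub> Suc n = ideal_prod R (\<mm> [^]\<^bsub>ideals_set R\<^esub> n) \<mm>"
  by (simp add: ideals_set_def)

lemma m_pow_ideal: "ideal (\<mm> [^]\<^bsub>ideals_set R\<^esub> (n::nat)) R"
proof (induction n)
  case 0
  then show ?case using oneideal by (simp add: ideals_set_def)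
next
  case (Suc n)
  then show ?case unfolding m_pow_Suc by (intro ideal_prod_is_ideal m_ideal)
qed

lemma m_pow_carrier: "\<mm> [^]\<^bsub>ideals_set R\<^esub> (n::nat) \<subseteq> carrier R"
  by (rule additive_subgroup.a_subset[OF ideal.axioms(1)[OF m_pow_ideal]])

lemma pow_in_m_pow: "x \<in> \<mm> \<Longrightarrow> x [^] n \<in> \<mm> [^]\<^bsub>ideals_set R\<^esub> (n::nat)"
proof (induction n)
  case 0
  then show ?case by (simp add: ideals_set_def)
next
  case (Suc n)
  then show ?case unfolding m_pow_Suc by (simp add: ideal_prod.prod)
qed

end

context curve_module
begin

lemma pow_smult_image_Suc:
  assumes "x \<in> carrier R"
  shows "(\<odot>\<^bsub>M\<^esub>) (x [^] Suc n) ` carrier M = (\<odot>\<^bsub>M\<^esub>) x ` (\<odot>\<^bsub>M\<^esub>) (x [^] n) ` carrier M"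
  unfolding image_image
  by (rule image_cong) (use assms in \<open>auto simp: smult_assoc1[symmetric] R.m_comm\<close>)

text \<open>Multiplication by x identifies M / x^n M with x M / x^(n+1) M, so each further power
  adds the same length \<open>l\<close>.\<close>

lemma rel_length_pow:
  assumes "torsion_free" "x \<in> carrier R" "x \<noteq> \<zero>"
    and l: "rel_length R M ((\<odot>\<^bsub>M\<^esub>) x ` carrier M) (carrier M) = enat l"
  shows "rel_length R M ((\<odot>\<^bsub>M\<^esub>) (x [^] n) ` carrier M) (carrier M) = enat (n * l)"
proof (induction n)
  case 0
  have "(\<odot>\<^bsub>M\<^esub>) \<one> ` carrier M = carrier M" by (auto simp: image_def)
  then show ?case by (simp add: rel_length_self[OF carrier_is_submodule] zero_enat_def)
next
  case (Suc n)
  define H where "H = (\<odot>\<^bsub>M\<^esub>) (x [^] n) ` carrier M"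
  have H: "submodule H R M" unfolding H_def using assms by (intro submodule_image_smult carrier_is_submodule) auto
  have Hc: "H \<subseteq> carrier M" by (rule submoduleE(1)[OF H])
  have xM: "submodule ((\<odot>\<^bsub>M\<^esub>) x ` carrier M) R M" and xH: "submodule ((\<odot>\<^bsub>M\<^esub>) x ` H) R M"
    using assms H by (auto intro: submodule_image_smult carrier_is_submodule)
  have le: "(\<odot>\<^bsub>M\<^esub>) x ` H \<subseteq> (\<odot>\<^bsub>M\<^esub>) x ` carrier M" using Hc by (rule image_mono)
  have "rel_length R M ((\<odot>\<^bsub>M\<^esub>) x ` H) ((\<odot>\<^bsub>M\<^esub>) x ` carrier M) = rel_length R M H (carrier M)"
    using torsion_freeD[OF assms(1,2)] assms(3)
    by (intro rel_length_image_smult[OF H carrier_is_submodule Hc assms(2)]) blast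
  then show ?case
    unfolding pow_smult_image_Suc[OF assms(2)] H_def[symmetric]
      rel_length_add[OF xH xM carrier_is_submodule le submoduleE(1)[OF xM]] l
    using Suc.IH by (simp add: H_def[symmetric] add.commute)
qed

text \<open>Some power of \<open>\<mm>\<close> sends M into x M. The filtration of M by these powers
  has finite steps, since both \<open>\<mm>\<close> and M are finitely generated.\<close>

lemma principal_reduction_finite_length:
  assumes fg: "fg_module R M" and red: "principal_reduction x"
  shows "rel_length R M ((\<odot>\<^bsub>M\<^esub>) x ` carrier M) (carrier M) \<noteq> \<infinity>"
proof -
  obtain S where S: "finite S" "S \<subseteq> carrier M" "gen_submodule R M S = carrier M"
    using fg unfolding fg_module_def by blast
  obtain Y where Y: "finite Y" "Y \<subseteq> \<mm>" "genideal R Y = \<mm>" using finite_generators_m by blast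
  \<comment> \<open>\<open>T j\<close> consists of the products of j generators of
    \<open>\<mm>\<close> with a generator of M: a finite generating set for the product of the j-th
    power of \<open>\<mm>\<close> with M.\<close>
  define T where "T (j :: nat) = ((\<lambda>T. (\<lambda>(y, s). y \<odot>\<^bsub>M\<^esub> s) ` (Y \<times> T)) ^^ j) S" for j
  have T0: "T 0 = S" and TSuc: "\<And>j. T (Suc j) = (\<lambda>(y, s). y \<odot>\<^bsub>M\<^esub> s) ` (Y \<times> T j)"
    by (simp_all add: T_def)
  have fin: "finite (T j)" for j by (induction j) (use S Y in \<open>simp_all add: T0 TSuc\<close>)
  have Tc: "T j \<subseteq> carrier M" for j
    by (induction j) (use S Y in \<open>auto simp: T0 TSuc subset_iff\<close>)
  note G = submodule_gen[OF Tc]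
  have step: "r \<odot>\<^bsub>M\<^esub> t \<in> gen_submodule R M (T (Suc j))" if r: "r \<in> \<mm>" and t: "t \<in> T j" for r t j
  proof -
    have tc: "t \<in> carrier M" using t Tc by auto
    define I where "I = {r \<in> carrier R. r \<odot>\<^bsub>M\<^esub> t \<in> gen_submodule R M (T (Suc j))}"
    note g = submoduleE[OF G[of "Suc j"]]
    \<comment> \<open>The scalars carrying t into the next term of the filtration form an ideal, so
      only the generators Y of \<open>\<mm>\<close> need to be tested.\<close>
    have "ideal I R"
    proof (rule idealI[OF R.ring_axioms])
      show "subgroup I (add_monoid R)"
        by (rule R.add.subgroupI)
           (use g tc submodule_zero_closed[OF G] in
            \<open>auto simp: I_def smult_l_distr smult_l_minus[unfolded a_inv_def] a_inv_def[symmetric] smult_l_minus intro!: exI[of _ \<zero>]\<close>)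
      show "a \<otimes> b \<in> I" if "b \<in> I" "a \<in> carrier R" for a b
        using that g(4) tc by (auto simp: I_def smult_assoc1)
      show "b \<otimes> a \<in> I" if "b \<in> I" "a \<in> carrier R" for a b
        using that g(4) tc by (subst R.m_comm) (auto simp: I_def smult_assoc1)
    qed
    moreover have "Y \<subseteq> I"
      using Y(2) t gen_incl[of "T (Suc j)"] by (auto simp: I_def TSuc)
    ultimately have "\<mm> \<subseteq> I" unfolding Y(3)[symmetric] by (rule R.genideal_minimal)
    then show ?thesis using r by (auto simp: I_def)
  qed
  have sub: "gen_submodule R M (T (Suc j)) \<subseteq> gen_submodule R M (T j)" for j
  proof (rule gen_minimal[OF _ G])
    show "T (Suc j) \<subseteq> gen_submodule R M (T j)"
    proof
      fix t assume "t \<in> T (Suc j)"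
      then obtain y s where "y \<in> Y" "s \<in> T j" "t = y \<odot>\<^bsub>M\<^esub> s" by (auto simp: TSuc)
      then show "t \<in> gen_submodule R M (T j)"
        using submoduleE(4)[OF G[of j], of y s] subsetD[OF gen_incl, of s "T j"] Y(2) by auto
    qed
  qed
  have "rel_length R M (gen_submodule R M (T j)) (carrier M) \<noteq> \<infinity>" for j
  proof (induction j)
    case 0
    then show ?case by (simp add: T0 S rel_length_self[OF carrier_is_submodule])
  next
    case (Suc j)
    have "gen_submodule R M (gen_submodule R M (T (Suc j)) \<union> T j) = gen_submodule R M (T j)"
    proof
      show "gen_submodule R M (gen_submodule R M (T (Suc j)) \<union> T j) \<subseteq> gen_submodule R M (T j)"
        using sub gen_incl by (intro gen_minimal[OF _ G]) auto
    qed (rule gen_mono, simp)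
    then have "rel_length R M (gen_submodule R M (T (Suc j))) (gen_submodule R M (T j)) \<le> enat (card (T j))"
      using rel_length_gen_le_card[OF fin G Tc step] by metis
    then show ?case
      using Suc.IH rel_length_add[OF G G carrier_is_submodule sub submoduleE(1)[OF G], of j]
      by (cases "rel_length R M (gen_submodule R M (T (Suc j))) (gen_submodule R M (T j))") auto
  qed
  \<comment> \<open>The case n = 1 of the reduction: the power 1 + c of \<open>\<mm>\<close> lies in
    x R.\<close>
  moreover obtain c :: nat where c: "\<And>y. y \<in> \<mm> [^]\<^bsub>ideals_set R\<^esub> (1 + c) \<Longrightarrow> \<exists>q\<in>carrier R. y = x [^] (1::nat) \<otimes> q"
    using red unfolding principal_reduction_def by meson
  have "T j \<subseteq> {r \<odot>\<^bsub>M\<^esub> s | r s. r \<in> \<mm> [^]\<^bsub>ideals_set R\<^esub> j \<and> s \<in> carrier M}" for j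
  proof (induction j)
    case 0
    have "s = \<one> \<odot>\<^bsub>M\<^esub> s" if "s \<in> S" for s using that S by auto
    then show ?case using S by (auto simp: T0 ideals_set_def)
  next
    case (Suc j)
    show ?case
    proof
      fix t assume "t \<in> T (Suc j)"
      then obtain y s where ys: "y \<in> Y" "s \<in> T j" "t = y \<odot>\<^bsub>M\<^esub> s" by (auto simp: TSuc)
      then obtain r u where ru: "r \<in> \<mm> [^]\<^bsub>ideals_set R\<^esub> j" "u \<in> carrier M" "s = r \<odot>\<^bsub>M\<^esub> u" using Suc.IH by blast
      have r: "r \<in> carrier R" and y: "y \<in> \<mm>" using ru(1) m_pow_carrier ys Y by auto
      have "t = (r \<otimes> y) \<odot>\<^bsub>M\<^esub> u" using ys ru r y by (metis R.m_comm m_carrier smult_assoc1)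
      moreover have "r \<otimes> y \<in> \<mm> [^]\<^bsub>ideals_set R\<^esub> Suc j"
        unfolding m_pow_Suc by (rule ideal_prod.prod[OF ru(1) y])
      ultimately show "t \<in> {r \<odot>\<^bsub>M\<^esub> s | r s. r \<in> \<mm> [^]\<^bsub>ideals_set R\<^esub> Suc j \<and> s \<in> carrier M}"
        using ru(2) by blast
    qed
  qed
  from this[of "1 + c"] have "T (1 + c) \<subseteq> (\<odot>\<^bsub>M\<^esub>) x ` carrier M"
  proof (rule subset_trans, safe)
    fix r s assume r: "r \<in> \<mm> [^]\<^bsub>ideals_set R\<^esub> (1 + c)" and s: "s \<in> carrier M"
    obtain q where q: "q \<in> carrier R" "r = x [^] (1::nat) \<otimes> q" using c[OF r] by blast
    have x: "x \<in> carrier R" using red unfolding principal_reduction_def by auto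
    have "r \<odot>\<^bsub>M\<^esub> s = x \<odot>\<^bsub>M\<^esub> (q \<odot>\<^bsub>M\<^esub> s)" using q s x by (simp add: smult_assoc1)
    then show "r \<odot>\<^bsub>M\<^esub> s \<in> (\<odot>\<^bsub>M\<^esub>) x ` carrier M" using q s by blast
  qed
  moreover have xM: "submodule ((\<odot>\<^bsub>M\<^esub>) x ` carrier M) R M"
    using red unfolding principal_reduction_def by (intro submodule_image_smult carrier_is_submodule) auto
  ultimately show ?thesis
    using rel_length_mono(1)[OF G xM carrier_is_submodule gen_minimal[OF _ xM] submoduleE(1)[OF xM], of "1 + c"]
    by (metis enat_ord_simps(5))
qed

text \<open>With J the product of the n-th power of \<open>\<mm>\<close> with M, x^n M \<subseteq> J
  \<subseteq> x^(n - c) M. For n < c the truncated exponent is 0 and the second inclusion only says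
  J \<subseteq> M.\<close>

lemma rel_length_m_pow_bounds:
  assumes tf: torsion_free and x: "x \<in> \<mm>" "x \<noteq> \<zero>"
    and c: "\<And>n y. y \<in> \<mm> [^]\<^bsub>ideals_set R\<^esub> (n + c) \<Longrightarrow> \<exists>q\<in>carrier R. y = x [^] (n::nat) \<otimes> q"
    and l: "rel_length R M ((\<odot>\<^bsub>M\<^esub>) x ` carrier M) (carrier M) = enat l"
  shows "\<exists>a. rel_length R M (ideal_mult R (\<mm> [^]\<^bsub>ideals_set R\<^esub> (n::nat)) M) (carrier M) = enat a \<and>
    (n - c) * l \<le> a \<and> a \<le> n * l"
proof -
  have xc: "x \<in> carrier R" using x by auto
  define J where "J = ideal_mult R (\<mm> [^]\<^bsub>ideals_set R\<^esub> n) M"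
  have J: "submodule J R M" unfolding J_def by (rule submodule_ideal_mult[OF m_pow_carrier])
  have X: "submodule ((\<odot>\<^bsub>M\<^esub>) (x [^] k) ` carrier M) R M" for k :: nat
    using xc by (intro submodule_image_smult carrier_is_submodule) auto
  note len = rel_length_pow[OF tf xc x(2) l]
  have "(\<odot>\<^bsub>M\<^esub>) (x [^] n) ` carrier M \<subseteq> J"
    unfolding J_def using pow_in_m_pow[OF x(1)] by (auto intro: smult_in_ideal_mult)
  then have up: "rel_length R M J (carrier M) \<le> enat (n * l)"
    using rel_length_mono(1)[OF X J carrier_is_submodule _ submoduleE(1)[OF J]] len by metis
  have "J \<subseteq> (\<odot>\<^bsub>M\<^esub>) (x [^] (n - c)) ` carrier M"
    unfolding J_def
  proof (rule ideal_mult_minimal[OF X])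
    fix r m assume r: "r \<in> \<mm> [^]\<^bsub>ideals_set R\<^esub> n" and m: "m \<in> carrier M"
    have "\<exists>q\<in>carrier R. r = x [^] (n - c) \<otimes> q"
    proof (cases "c \<le> n")
      case True
      then show ?thesis using c[of r "n - c"] r by simp
    next
      case False
      then show ?thesis using r m_pow_carrier[of n] by auto
    qed
    then obtain q where q: "q \<in> carrier R" "r = x [^] (n - c) \<otimes> q" by blast
    then have "r \<odot>\<^bsub>M\<^esub> m = x [^] (n - c) \<odot>\<^bsub>M\<^esub> (q \<odot>\<^bsub>M\<^esub> m)" using xc m by (simp add: smult_assoc1)
    then show "r \<odot>\<^bsub>M\<^esub> m \<in> (\<odot>\<^bsub>M\<^esub>) (x [^] (n - c)) ` carrier M" using q m by blast
  qed
  then have low: "enat ((n - c) * l) \<le> rel_length R M J (carrier M)"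
    using rel_length_mono(1)[OF J X carrier_is_submodule _ submoduleE(1)[OF X]] len by metis
  obtain a where a: "rel_length R M J (carrier M) = enat a" using up by (metis enat_ile)
  then show ?thesis using up low unfolding J_def by auto
qed

lemma multiplicity_eq_length:
  assumes tf: torsion_free and red: "principal_reduction x"
    and l: "rel_length R M ((\<odot>\<^bsub>M\<^esub>) x ` carrier M) (carrier M) = enat l"
  shows "multiplicity_mod R \<mm> M = real l"
proof -
  obtain c where x: "x \<in> \<mm>" "x \<noteq> \<zero>"
    and c: "\<And>n y. y \<in> \<mm> [^]\<^bsub>ideals_set R\<^esub> (n + c) \<Longrightarrow> \<exists>q\<in>carrier R. y = x [^] (n::nat) \<otimes> q"
    using red unfolding principal_reduction_def by blast
  define a where "a n = the_enat (rel_length R M (ideal_mult R (\<mm> [^]\<^bsub>ideals_set R\<^esub> n) M) (carrier M))" for n :: nat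
  have "(n - c) * l \<le> a n \<and> a n \<le> n * l" for n
  proof -
    obtain b where "rel_length R M (ideal_mult R (\<mm> [^]\<^bsub>ideals_set R\<^esub> n) M) (carrier M) = enat b"
        "(n - c) * l \<le> b" "b \<le> n * l"
      using rel_length_m_pow_bounds[OF tf x _ l, of c n] c by blast
    then show ?thesis by (simp add: a_def)
  qed
  then have bounds: "(n - c) * l \<le> a n" "a n \<le> n * l" for n by blast+
  have "(\<lambda>n. real (a n) / real n) \<longlonglongrightarrow> real l"
  proof (rule tendsto_sandwich)
    \<comment> \<open>For n < c the left side is at most 0, so passing from truncated to real
      subtraction keeps the bound valid for every n. At n = 0 both quotients are 0 by the convention
      on division.\<close>
    have "(real n - real c) * real l / real n \<le> real (a n) / real n" for n
    proof -
      have "(real n - real c) * real l \<le> real (n - c) * real l" by (intro mult_right_mono) auto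
      also have "\<dots> \<le> real (a n)" using bounds(1)[of n] by (metis of_nat_le_iff of_nat_mult)
      finally show ?thesis by (intro divide_right_mono) auto
    qed
    then show "\<forall>\<^sub>F n in sequentially. (real n - real c) * real l / real n \<le> real (a n) / real n" by simp
    have "real (a n) / real n \<le> real l" for n
    proof (cases "n = 0")
      case False
      have "real (a n) \<le> real n * real l" using bounds(2)[of n] by (metis of_nat_le_iff of_nat_mult)
      then show ?thesis using False by (simp add: field_simps)
    qed simp
    then show "\<forall>\<^sub>F n in sequentially. real (a n) / real n \<le> real l" by simp
    have "(\<lambda>n. real l - real c * real l / real n) \<longlonglongrightarrow> real l - 0"
      by (intro tendsto_intros tendsto_divide_0[OF tendsto_const] filterlim_at_top_imp_at_infinity filterlim_real_sequentially)
    moreover have "\<forall>\<^sub>F n in sequentially. real l - real c * real l / real n = (real n - real c) * real l / real n"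
      using eventually_gt_at_top[of 0] by eventually_elim (simp add: field_simps)
    ultimately show "(\<lambda>n. (real n - real c) * real l / real n) \<longlonglongrightarrow> real l"
      by (simp add: filterlim_cong)
  qed simp
  \<comment> \<open>In dimension one the normalising factor d! / n^d is 1 / n.\<close>
  moreover have "multiplicity_mod R \<mm> M = lim (\<lambda>n. real (a n) / real n)"
    unfolding multiplicity_mod_def krull_dim_eq_1 a_def
    by (simp add: module_length_quotient submodule_ideal_mult m_pow_carrier one_enat_def)
  ultimately show ?thesis by (simp add: limI)
qed

lemma smult_image_subset_mM:
  "x \<in> \<mm> \<Longrightarrow> (\<odot>\<^bsub>M\<^esub>) x ` carrier M \<subseteq> ideal_mult R \<mm> M"
  by (auto intro: smult_in_ideal_mult)

text \<open>The inclusion x M \<subseteq> \<open>\<mm>\<close> M always holds. The colengths of the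
  two submodules are the multiplicity and the number of generators; both are finite, so equality of
  numbers forces equality of submodules.\<close>

lemma ulrich_iff:
  assumes fg: "fg_module R M" and red: "principal_reduction x"
  shows "ulrich R \<mm> M \<longleftrightarrow> carrier M \<noteq> {\<zero>\<^bsub>M\<^esub>} \<and> torsion_free \<and>
    ideal_mult R \<mm> M \<subseteq> (\<odot>\<^bsub>M\<^esub>) x ` carrier M"
proof (cases "carrier M \<noteq> {\<zero>\<^bsub>M\<^esub>} \<and> torsion_free")
  case True
  have x: "x \<in> \<mm>" using red unfolding principal_reduction_def by blast
  have xM: "submodule ((\<odot>\<^bsub>M\<^esub>) x ` carrier M) R M"
    using x by (intro submodule_image_smult carrier_is_submodule) auto
  obtain l where l: "rel_length R M ((\<odot>\<^bsub>M\<^esub>) x ` carrier M) (carrier M) = enat l"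
    using principal_reduction_finite_length[OF fg red] by auto
  have e: "multiplicity_mod R \<mm> M = real l" using multiplicity_eq_length red l True by blast
  have "ulrich R \<mm> M \<longleftrightarrow> enat (min_num_generators R M) = enat l"
    unfolding ulrich_def maximal_cohen_macaulay_iff[OF fg] e using True by simp
  also have "\<dots> \<longleftrightarrow> rel_length R M ((\<odot>\<^bsub>M\<^esub>) x ` carrier M) (carrier M) = rel_length R M (ideal_mult R \<mm> M) (carrier M)"
    unfolding min_num_generators_eq_rel_length[OF fg] l by auto
  also have "\<dots> \<longleftrightarrow> (\<odot>\<^bsub>M\<^esub>) x ` carrier M = ideal_mult R \<mm> M"
    using rel_length_eq_imp_eq[OF xM submodule_mM carrier_is_submodule smult_image_subset_mM[OF x]
        submoduleE(1)[OF submodule_mM]] l by (metis enat.distinct(1))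
  finally show ?thesis using True smult_image_subset_mM[OF x] by auto
next
  case False
  then show ?thesis unfolding ulrich_def maximal_cohen_macaulay_iff[OF fg] by auto
qed

end

section \<open>Ideals as modules\<close>

lemma carrier_ideal_module: "carrier (ideal_module R I) = I"
  by (simp add: ideal_module_def)

lemma (in cring) submodule_ideal_module_iff:
  assumes "ideal I R"
  shows "submodule H R (ideal_module R I) \<longleftrightarrow> ideal H R \<and> H \<subseteq> I"
proof -
  interpret I: ideal I R by fact
  interpret M: module R "ideal_module R I" by (rule module_ideal_module[OF cring_axioms assms])
  have sel: "carrier (ideal_module R I) = I" "\<And>a b. a \<oplus>\<^bsub>ideal_module R I\<^esub> b = a \<oplus> b"
    "\<And>a b. a \<odot>\<^bsub>ideal_module R I\<^esub> b = a \<otimes> b" "\<zero>\<^bsub>ideal_module R I\<^esub> = \<zero>"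
    by (simp_all add: ideal_module_def)
  have inv: "\<ominus>\<^bsub>ideal_module R I\<^esub> a = \<ominus> a" if "a \<in> I" for a
    using that by (intro M.M.minus_equality) (auto simp: sel l_neg)
  show ?thesis
  proof
    assume H: "submodule H R (ideal_module R I)"
    note h = M.submoduleE[OF H, unfolded sel]
    have "\<ominus> a \<in> H" if "a \<in> H" for a using h(3)[OF that] inv[of a] that h(1) by auto
    then have "subgroup H (add_monoid R)"
      using h(1,2,5) I.a_subset by (intro add.subgroupI) (auto simp: a_inv_def[symmetric])
    then have "ideal H R"
    proof (rule idealI[OF ring_axioms])
      fix a x assume "a \<in> H" "x \<in> carrier R"
      then show "x \<otimes> a \<in> H" "a \<otimes> x \<in> H" using h(4) h(1) m_comm[of a x] by (auto simp: subset_iff)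
    qed
    then show "ideal H R \<and> H \<subseteq> I" using h(1) by blast
  next
    assume H: "ideal H R \<and> H \<subseteq> I"
    interpret H: ideal H R using H by blast
    show "submodule H R (ideal_module R I)"
      by (rule M.submoduleI) (use H H.I_l_closed in \<open>auto simp: sel inv subset_iff\<close>)
  qed
qed

text \<open>This allows the length of \<open>\<mm>\<close> / x \<open>\<mm>\<close>, which computes
  the multiplicity of \<open>\<mm>\<close>, to be measured inside R and compared there with that of
  R / x R.\<close>

lemma (in cring) rel_length_ideal_module:
  assumes "ideal I R" "ideal J R" "K \<subseteq> I" "K \<subseteq> J"
  shows "rel_length R (ideal_module R I) H K = rel_length R (ideal_module R J) H K"
  unfolding rel_length_def
  by (rule arg_cong[of _ _ sup_chain_length]) (use assms in \<open>auto simp: submodule_ideal_module_iff fun_eq_iff\<close>)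

lemma (in cring) gen_submodule_ideal_module:
  assumes "ideal I R" "S \<subseteq> I"
  shows "gen_submodule R (ideal_module R I) S = genideal R S"
proof -
  have "gen_submodule R (ideal_module R I) S = \<Inter>{H. (ideal H R \<and> H \<subseteq> I) \<and> S \<subseteq> H}"
    unfolding gen_submodule_def hull_def by (simp add: submodule_ideal_module_iff[OF assms(1)])
  also have "\<dots> = genideal R S"
    unfolding genideal_def
  proof
    show "\<Inter>{I. ideal I R \<and> S \<subseteq> I} \<subseteq> \<Inter>{H. (ideal H R \<and> H \<subseteq> I) \<and> S \<subseteq> H}" by auto
    show "\<Inter>{H. (ideal H R \<and> H \<subseteq> I) \<and> S \<subseteq> H} \<subseteq> \<Inter>{I. ideal I R \<and> S \<subseteq> I}"
    proof
      fix a assume a: "a \<in> \<Inter>{H. (ideal H R \<and> H \<subseteq> I) \<and> S \<subseteq> H}"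
      \<comment> \<open>An arbitrary ideal J containing S is cut down to
        \<open>J \<inter> I\<close>, which is a submodule of I.\<close>
      have "a \<in> J" if "ideal J R" "S \<subseteq> J" for J
        using a i_intersect[OF that(1) assms(1)] that assms(2) by auto
      then show "a \<in> \<Inter>{I. ideal I R \<and> S \<subseteq> I}" by blast
    qed
  qed
  finally show ?thesis .
qed

context curve_ring
begin

lemma curve_module_ideal_module: "ideal I R \<Longrightarrow> curve_module R (ideal_module R I) \<mm>"
  using curve_ring_axioms module_ideal_module[OF cring_axioms] by (simp add: curve_module_def)

lemma torsion_free_ideal_module:
  assumes "ideal I R"
  shows "module.torsion_free R (ideal_module R I)"
proof -
  interpret M: module R "ideal_module R I" by (rule module_ideal_module[OF cring_axioms assms])
  show ?thesis
    unfolding M.torsion_free_def using ideal.Icarr[OF assms] integral by (auto simp: ideal_module_def)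
qed

lemma fg_module_m: "fg_module R (ideal_module R \<mm>)"
proof -
  obtain Y where Y: "finite Y" "Y \<subseteq> \<mm>" "genideal R Y = \<mm>" using finite_generators_m by blast
  then show ?thesis
    unfolding fg_module_def
    using module_ideal_module[OF cring_axioms m_ideal] gen_submodule_ideal_module[OF m_ideal Y(2)]
    by (auto simp: carrier_ideal_module)
qed

lemma fg_module_regular: "fg_module R (regular_module R)"
  unfolding fg_module_def
  using module_ideal_module[OF cring_axioms oneideal] gen_submodule_ideal_module[OF oneideal, of "{\<one>}"]
  by (auto simp: carrier_ideal_module genideal_one intro!: exI[of _ "{\<one>}"])

text \<open>Multiplication by \<open>x\<close> identifies \<open>R / \<mm>\<close> with \<open>x R / x \<mm>\<close>, so the two ways around
  \<open>x \<mm> \<subseteq> x R, \<mm> \<subseteq> R\<close> show that \<open>R / x R\<close> and \<open>\<mm> / x \<mm>\<close> have the same length.\<close>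

lemma multiplicity_m_eq:
  assumes red: "principal_reduction x"
  shows "multiplicity_mod R \<mm> (ideal_module R \<mm>) = multiplicity_mod R \<mm> (regular_module R)"
proof -
  have x: "x \<in> \<mm>" "x \<noteq> \<zero>" using red unfolding principal_reduction_def by auto
  interpret S: curve_module R "regular_module R" \<mm> by (rule curve_module_ideal_module[OF oneideal])
  interpret T: curve_module R "ideal_module R \<mm>" \<mm> by (rule curve_module_ideal_module[OF m_ideal])
  have sel: "carrier (ideal_module R I) = I" "(\<odot>\<^bsub>ideal_module R I\<^esub>) = (\<otimes>)" "\<zero>\<^bsub>ideal_module R I\<^esub> = \<zero>" for I
    by (simp_all add: ideal_module_def fun_eq_iff)
  let ?len = "rel_length R (regular_module R)"
  let ?xR = "(\<otimes>) x ` carrier R" and ?xm = "(\<otimes>) x ` \<mm>"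
  have sub: "submodule \<mm> R (regular_module R)" "submodule ?xR R (regular_module R)"
      "submodule ?xm R (regular_module R)" "submodule (carrier R) R (regular_module R)"
    using S.submodule_image_smult[of \<mm> x] S.submodule_image_smult[of "carrier R" x] x
      S.carrier_is_submodule m_ideal
    by (simp_all add: sel submodule_ideal_module_iff[OF oneideal] additive_subgroup.a_subset ideal.axioms(1))
  have inc: "?xm \<subseteq> ?xR" "?xR \<subseteq> \<mm>" "\<mm> \<subseteq> carrier R" "?xm \<subseteq> \<mm>" "?xR \<subseteq> carrier R"
    using x(1) ideal.I_r_closed[OF m_ideal x(1)] by auto
  obtain l where l: "?len ?xR (carrier R) = enat l"
    using S.principal_reduction_finite_length[OF fg_module_regular red] by (auto simp: sel)
  obtain k where k: "rel_length R (ideal_module R \<mm>) ?xm \<mm> = enat k"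
    using T.principal_reduction_finite_length[OF fg_module_m red] by (auto simp: sel)
  have k': "?len ?xm \<mm> = enat k"
    using k rel_length_ideal_module[OF m_ideal oneideal, of \<mm> ?xm] inc(3) by simp
  have "?len ?xm ?xR = ?len \<mm> (carrier R)"
    using S.rel_length_image_smult[OF sub(1,4) inc(3), of x] x integral[of x]
    by (auto simp: sel)
  moreover have "?len ?xm (carrier R) = ?len ?xm \<mm> + ?len \<mm> (carrier R)"
    using S.rel_length_add[OF sub(3,1,4) inc(4,3)] .
  moreover have "?len ?xm (carrier R) = ?len ?xm ?xR + ?len ?xR (carrier R)"
    using S.rel_length_add[OF sub(3,2,4) inc(1,5)] .
  \<comment> \<open>R / \<open>\<mm>\<close> has finite length, so it may be cancelled from the two
    decompositions.\<close>
  moreover have "?len \<mm> (carrier R) \<le> enat l"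
    using S.rel_length_mono(1)[OF sub(2,1,4) inc(2,3)] l by simp
  ultimately have "k = l" using l k' by (cases "?len \<mm> (carrier R)") auto
  then show ?thesis
    using S.multiplicity_eq_length[OF torsion_free_ideal_module[OF oneideal] red, of l] l
      T.multiplicity_eq_length[OF torsion_free_ideal_module[OF m_ideal] red, of k] k
    by (simp add: sel)
qed

text \<open>In dimension one the correction - dim R + 1 vanishes, so the hypothesis equates e(R)
  with the number of generators of \<open>\<mm>\<close>, and e(R) is also
  e(\<open>\<mm>\<close>).\<close>

lemma minimal_multiplicity_imp_ulrich_m:
  assumes red: "principal_reduction x" and "minimal_multiplicity R \<mm>"
  shows "ulrich R \<mm> (ideal_module R \<mm>)"
proof -
  interpret T: curve_module R "ideal_module R \<mm>" \<mm> by (rule curve_module_ideal_module[OF m_ideal])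
  have "maximal_cohen_macaulay R \<mm> (ideal_module R \<mm>)"
    using T.maximal_cohen_macaulay_iff[OF fg_module_m] m_nonzero torsion_free_ideal_module[OF m_ideal]
    by (simp add: ideal_module_def)
  then show ?thesis
    using assms(2) unfolding ulrich_def minimal_multiplicity_def multiplicity_m_eq[OF red]
    by (simp add: krull_dim_eq_1 one_enat_def)
qed

end

section \<open>Numerical semigroups and their rings\<close>

text \<open>The least positive difference \<open>d\<close> of two elements of \<open>H\<close> divides every element of \<open>H\<close>, so \<open>d = 1\<close>.\<close>

lemma additive_nat_set_cofinite:
  fixes H :: "nat set"
  assumes zero: "0 \<in> H" and add: "\<And>a b. a \<in> H \<Longrightarrow> b \<in> H \<Longrightarrow> a + b \<in> H"
    and Gcd: "\<And>d. (\<And>h. h \<in> H \<Longrightarrow> d dvd h) \<Longrightarrow> d = 1"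
  shows "\<exists>c. \<forall>n\<ge>c. n \<in> H"
proof -
  have mul: "q * b \<in> H" if "b \<in> H" for q b
    by (induction q) (use that zero add in auto)
  define D where "D d \<longleftrightarrow> 0 < d \<and> (\<exists>b\<in>H. b + d \<in> H)" for d
  have "\<exists>d. D d"
  proof (rule ccontr)
    assume "\<nexists>d. D d"
    then have "h = 0" if "h \<in> H" for h using that zero unfolding D_def by (metis add_0 gr0I)
    then have "(2::nat) = 1" by (intro Gcd) auto
    then show False by simp
  qed
  define d where "d = (LEAST d. D d)"
  have d: "D d" unfolding d_def using \<open>\<exists>d. D d\<close> by (rule LeastI_ex)
  then obtain b where b: "b \<in> H" "b + d \<in> H" "0 < d" unfolding D_def by auto
  have "d dvd h" if h: "h \<in> H" for h
  proof (rule ccontr)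
    assume "\<not> d dvd h"
    then have pos: "0 < h mod d" by (simp add: dvd_eq_mod_eq_0)
    have "h = (h div d) * d + h mod d" by simp
    \<comment> \<open>This exhibits h mod d as a difference of two elements of H; if it were
      positive, it would be smaller than the least such difference.\<close>
    then have "(h div d) * (b + d) + h mod d = h + (h div d) * b"
      by (simp only: distrib_left)
    moreover have "h + (h div d) * b \<in> H" "(h div d) * (b + d) \<in> H" using h b mul add by auto
    ultimately have "D (h mod d)" unfolding D_def using pos by metis
    then have "d \<le> h mod d" unfolding d_def by (rule Least_le)
    then show False using mod_less_divisor[OF b(3), of h] by linarith
  qed
  then have "d = 1" by (rule Gcd)
  then have b1: "b + 1 \<in> H" using b by simp
  \<comment> \<open>With b and b + 1 in H, write n = q b + r = (q - r) b + r (b + 1), where q and r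
    are quotient and remainder modulo b. This needs r \<le> q, which n \<ge> b * b guarantees. For b
    = 0 the element b + 1 = 1 already generates everything.\<close>
  have "n \<in> H" if n: "(b + 1) * (b + 1) \<le> n" for n
  proof (cases "b = 0")
    case True
    then show ?thesis using mul[OF b1, of n] by simp
  next
    case False
    have "n mod b \<le> n div b"
    proof -
      have "b * b \<le> n" using n by (simp add: algebra_simps)
      then have "b \<le> n div b" using False by (simp add: less_eq_div_iff_mult_less_eq)
      moreover have "n mod b < b" using False by simp
      ultimately show ?thesis by linarith
    qed
    then obtain k where k: "n div b = k + n mod b" by (metis le_add_diff_inverse2)
    have "n = (n div b) * b + n mod b" by simp
    then have "n = k * b + (n mod b) * (b + 1)" unfolding k by (simp only: distrib_left distrib_right)
    then show ?thesis using add[OF mul[OF b(1), of k] mul[OF b1, of "n mod b"]] by simp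
  qed
  then show ?thesis by blast
qed

section \<open>Power series supported on a numerical semigroup\<close>

lemma fps_X_dvd_iff: "fps_X dvd f \<longleftrightarrow> fps_nth f 0 = 0" for f :: "'k::field fps"
proof
  assume "fps_nth f 0 = 0"
  then show "fps_X dvd f"
    by (cases "f = 0") (auto simp: fps_dvd_iff subdegree_eq_0_iff Suc_le_eq intro!: Nat.gr0I)
qed auto

text \<open>\<open>c\<close> is any bound beyond which H has no gaps, not necessarily the least. It
  gives t^c k[[t]] \<subseteq> R, through which divisibility in k[[t]] is carried back to R.\<close>

locale semigroup_ring =
  fixes H :: "nat set" and R :: "'k::field fps ring" and c :: nat
  assumes zero_in: "0 \<in> H" and add_in: "\<lbrakk>a \<in> H; b \<in> H\<rbrakk> \<Longrightarrow> a + b \<in> H"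
    and conductor: "c \<le> n \<Longrightarrow> n \<in> H"
    and carrier_eq: "carrier R = {f. \<forall>m. fps_nth f m \<noteq> 0 \<longrightarrow> m \<in> H}"
    and ops [simp]: "monoid.mult R = (*)" "\<one>\<^bsub>R\<^esub> = 1" "\<zero>\<^bsub>R\<^esub> = 0" "ring.add R = (+)"
    and is_domain: "domain R"
begin

sublocale domain R by (rule is_domain)

lemma inR_iff: "f \<in> carrier R \<longleftrightarrow> (\<forall>m. fps_nth f m \<noteq> 0 \<longrightarrow> m \<in> H)"
  by (simp add: carrier_eq)

lemma pow_eq [simp]: "f [^]\<^bsub>R\<^esub> (n::nat) = f ^ n"
  by (induction n) (simp_all add: mult.commute)

lemma minus_eq': "f \<in> carrier R \<Longrightarrow> \<ominus>\<^bsub>R\<^esub> f = - f"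
  using minus_equality[of "- f" f] by (simp add: inR_iff)

lemma X_pow_in: "h \<in> H \<Longrightarrow> fps_X ^ h \<in> carrier R"
  by (simp add: inR_iff fps_X_power_iff)

text \<open>Comparing coefficients in f g = 1 writes the n-th coefficient of g through products of
  coefficients of f and g with indices i and n - i. If it is nonzero, some such product is nonzero,
  and n is a sum of two elements of H. This is what makes R local.\<close>

lemma inverse_in:
  assumes f: "f \<in> carrier R" and "fps_nth f 0 \<noteq> 0"
  shows "inverse f \<in> carrier R"
proof -
  define g where "g = inverse f"
  have fg: "f * g = 1" using assms(2) by (simp add: g_def inverse_mult_eq_1')
  have "fps_nth g n \<noteq> 0 \<longrightarrow> n \<in> H" for n
  proof (induction n rule: less_induct)
    case (less n)
    show ?case
    proof (intro impI, cases "n = 0")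
      case False
      assume nz: "fps_nth g n \<noteq> 0"
      have "(\<Sum>i=0..n. fps_nth f i * fps_nth g (n - i)) = 0"
        using arg_cong[OF fg, of "\<lambda>h. fps_nth h n"] False by (simp add: fps_mult_nth)
      also have "(\<Sum>i=0..n. fps_nth f i * fps_nth g (n - i)) =
          fps_nth f 0 * fps_nth g n + (\<Sum>i=1..n. fps_nth f i * fps_nth g (n - i))"
        by (simp add: sum.atLeast_Suc_atMost)
      finally have "(\<Sum>i=1..n. fps_nth f i * fps_nth g (n - i)) \<noteq> 0"
        using nz assms(2) by (metis add.right_neutral mult_eq_0_iff)
      then obtain i where "i \<in> {1..n}" "fps_nth f i * fps_nth g (n - i) \<noteq> 0"
        by (meson sum.neutral)
      then have "i \<in> H" "n - i \<in> H" "i \<le> n" using f less[of "n - i"] by (auto simp: inR_iff)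
      then show "n \<in> H" using add_in[of i "n - i"] by simp
    qed (use zero_in in simp)
  qed
  then show ?thesis by (simp add: inR_iff g_def)
qed

lemma Units_I:
  assumes "f \<in> carrier R" "fps_nth f 0 \<noteq> 0"
  shows "f \<in> Units R"
  using inverse_in[OF assms] assms inverse_mult_eq_1[OF assms(2)] inverse_mult_eq_1'[OF assms(2)]
  by (auto simp: Units_def)

text \<open>The order of z allows division by y in k[[t]] with a factor t^c to spare, and that
  factor puts the quotient into R.\<close>

lemma dvd_in_R:
  assumes y: "y \<in> carrier R" "y \<noteq> 0" and z: "fps_X ^ (subdegree y + c) dvd z"
  shows "\<exists>q\<in>carrier R. z = y * q"
proof -
  obtain g where g: "z = fps_X ^ (subdegree y + c) * g" using z by blast
  have "y dvd fps_X ^ subdegree y" using y(2) by (simp add: fps_dvd_iff)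
  then obtain k where k: "fps_X ^ subdegree y = y * k" by blast
  have "z = y * (fps_X ^ c * (k * g))" by (simp add: g k power_add mult_ac)
  moreover have "fps_X ^ c * (k * g) \<in> carrier R"
    by (auto simp: inR_iff fps_X_power_mult_nth intro: conductor)
  ultimately show ?thesis by blast
qed

context
  fixes \<mm> assumes max: "maximalideal \<mm> R"
begin

lemma m_eq: "\<mm> = {f \<in> carrier R. fps_nth f 0 = 0}"
proof -
  interpret m: maximalideal \<mm> R by (rule max)
  define I where "I = {f \<in> carrier R. fps_nth f 0 = 0}"
  have "ideal I R"
  proof (rule idealI[OF ring_axioms])
    have "0 \<in> I" using zero_closed by (simp add: I_def)
    moreover have "\<ominus>\<^bsub>R\<^esub> f \<in> I" if "f \<in> I" for f
      using that minus_eq'[of f] a_inv_closed[of f] by (simp add: I_def)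
    moreover have "f + g \<in> I" if "f \<in> I" "g \<in> I" for f g
      using that a_closed[of f g] by (simp add: I_def)
    ultimately show "subgroup I (add_monoid R)"
      by (intro add.subgroupI) (auto simp: a_inv_def[symmetric], simp add: I_def)
    show "x \<otimes>\<^bsub>R\<^esub> a \<in> I" "a \<otimes>\<^bsub>R\<^esub> x \<in> I" if "a \<in> I" "x \<in> carrier R" for a x
      using that m_closed[of x a] m_closed[of a x] by (auto simp: I_def)
  qed
  moreover have "\<mm> \<subseteq> I"
  proof
    fix f assume f: "f \<in> \<mm>"
    then have fR: "f \<in> carrier R" by (rule m.Icarr)
    have "fps_nth f 0 = 0"
    proof (rule ccontr)
      assume nz: "fps_nth f 0 \<noteq> 0"
      have "f \<otimes>\<^bsub>R\<^esub> inverse f \<in> \<mm>" by (rule m.I_r_closed[OF f inverse_in[OF fR nz]])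
      then have "\<one>\<^bsub>R\<^esub> \<in> \<mm>" using nz by (simp add: inverse_mult_eq_1')
      then show False using m.one_imp_carrier m.I_notcarr by blast
    qed
    then show "f \<in> I" using fR by (simp add: I_def)
  qed
  moreover have "1 \<notin> I" "1 \<in> carrier R" using one_closed by (simp_all add: I_def)
  then have "I \<noteq> carrier R" by blast
  moreover have "I \<subseteq> carrier R" by (auto simp: I_def)
  ultimately have "I = \<mm>" using m.I_maximal[of I] by blast
  then show ?thesis by (simp add: I_def)
qed

lemma X_dvd_m: "f \<in> \<mm> \<Longrightarrow> fps_X dvd f"
  unfolding m_eq by (simp add: fps_X_dvd_iff) 

text \<open>Leading terms are subtracted until the order reaches 2 c + 1 = (c + 1) + c. From there
  \<open>dvd_in_R\<close> makes the rest a multiple of t^(c+1), itself one of the listed powers.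
  This is where the size of the bound comes from.\<close>

lemma genideal_X_pows: "genideal R {fps_X ^ h | h. h \<in> H \<and> 0 < h \<and> h \<le> c + c + 2} = \<mm>"
proof -
  define Y where "Y = {(fps_X ^ h :: 'k fps) | h. h \<in> H \<and> 0 < h \<and> h \<le> c + c + 2}"
  have Ym: "Y \<subseteq> \<mm>" by (auto simp: Y_def m_eq X_pow_in)
  then have YR: "Y \<subseteq> carrier R" by (auto simp: m_eq)
  interpret J: ideal "genideal R Y" R by (rule genideal_ideal[OF YR])
  have YJ: "Y \<subseteq> genideal R Y" by (rule genideal_self[OF YR])
  have "f \<in> genideal R Y" if "f \<in> carrier R" "fps_X ^ n dvd f" "0 < n" "n \<le> c + c + 1" for n f
    using that(4,1-3)
  proof (induction n arbitrary: f rule: inc_induct)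
    case base
    have "c + 1 \<in> H" by (rule conductor) simp
    then have X: "fps_X ^ (c + 1) \<in> Y"
      unfolding Y_def by (intro CollectI exI[of _ "c + 1"]) simp
    then have "\<exists>q\<in>carrier R. f = fps_X ^ (c + 1) * q"
      using base YR by (intro dvd_in_R) (auto simp: add.commute add.left_commute)
    then show ?case using J.I_r_closed[of "fps_X ^ (c + 1)"] X YJ by auto
  next
    case (step n)
    define a where "a = fps_nth f n"
    define t where "t = fps_const a * fps_X ^ n"
    have t: "t \<in> genideal R Y \<and> t \<in> carrier R"
    proof (cases "a = 0")
      case True
      then show ?thesis using J.zero_closed zero_closed by (simp add: t_def)
    next
      case False
      \<comment> \<open>A nonzero coefficient at n puts n into the support of f, so t^n is one of
        the generators.\<close>
      then have "n \<in> H" using step.prems by (auto simp: a_def inR_iff)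
      then have "fps_X ^ n \<in> genideal R Y" using step YJ by (auto simp: Y_def)
      moreover have "fps_const a \<in> carrier R" using zero_in by (simp add: inR_iff)
      ultimately show ?thesis using J.I_l_closed[of "fps_X ^ n" "fps_const a"] J.Icarr
        by (auto simp: t_def)
    qed
    have "f - t \<in> carrier R"
      using minus_closed[OF step.prems(1), of t] minus_eq'[of t] t by (simp add: a_minus_def)
    moreover have "fps_X ^ Suc n dvd f - t"
    proof -
      obtain g where g: "f = fps_X ^ n * g" using step.prems by blast
      then have "a = fps_nth g 0" by (simp add: a_def fps_X_power_mult_nth)
      then have "f - t = fps_X ^ n * (g - fps_const (fps_nth g 0))"
        by (simp add: g t_def algebra_simps)
      moreover have "fps_X dvd g - fps_const (fps_nth g 0)" by (simp add: fps_X_dvd_iff)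
      ultimately show ?thesis by (metis mult.commute mult_dvd_mono dvd_refl power_Suc)
    qed
    ultimately have "f - t \<in> genideal R Y" using step.IH by blast
    then have "(f - t) \<oplus>\<^bsub>R\<^esub> t \<in> genideal R Y" using t J.a_closed by blast
    then show ?case by simp
  qed
  from this[of _ 1] have "\<mm> \<subseteq> genideal R Y" using X_dvd_m by (auto simp: m_eq)
  moreover have "genideal R Y \<subseteq> \<mm>" by (rule genideal_minimal[OF maximalideal.axioms(1)[OF max] Ym])
  ultimately show ?thesis unfolding Y_def by blast
qed

lemma curve_ring: "curve_ring R \<mm>"
proof (rule curve_ring.intro[OF is_domain])
  show "local_cring R \<mm>"
  proof (rule local_cring.intro[OF is_cring local_cring_axioms.intro[OF max]])
    show "r \<in> Units R" if "r \<in> carrier R" "r \<notin> \<mm>" for r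
      using that Units_I unfolding m_eq by blast
  qed
  show "curve_ring_axioms R \<mm>"
  proof
    have "finite {fps_X ^ h :: 'k fps | h. h \<in> H \<and> 0 < h \<and> h \<le> c + c + 2}"
      by (rule finite_subset[of _ "(\<lambda>h. fps_X ^ h) ` {..c + c + 2}"]) auto
    moreover have "{fps_X ^ h | h. h \<in> H \<and> 0 < h \<and> h \<le> c + c + 2} \<subseteq> \<mm>"
      by (auto simp: m_eq X_pow_in)
    ultimately show "\<exists>Y. finite Y \<and> Y \<subseteq> \<mm> \<and> genideal R Y = \<mm>" using genideal_X_pows by blast
    have "fps_X ^ Suc c \<in> \<mm>" by (simp only: m_eq mem_Collect_eq) (simp add: X_pow_in conductor del: power_Suc)
    moreover have "fps_X ^ Suc c \<noteq> (0 :: 'k fps)" by (simp del: power_Suc)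
    ultimately show "\<mm> \<noteq> {\<zero>\<^bsub>R\<^esub>}" by auto
  next
    fix y z assume y: "y \<in> carrier R" "y \<noteq> \<zero>\<^bsub>R\<^esub>" and z: "z \<in> \<mm>"
    \<comment> \<open>Elements of \<open>\<mm>\<close> have order at least 1, so this exponent is
      large enough for \<open>dvd_in_R\<close>.\<close>
    have "fps_X ^ (subdegree y + c) dvd z ^ (subdegree y + c)"
      using X_dvd_m[OF z] by (rule dvd_power_same)
    then have "\<exists>q\<in>carrier R. z ^ (subdegree y + c) = y * q"
      using dvd_in_R[OF y(1)] y(2) by simp
    then show "\<exists>(n::nat). \<exists>q\<in>carrier R. z [^]\<^bsub>R\<^esub> n = y \<otimes>\<^bsub>R\<^esub> q" by auto
  qed
qed

interpretation curve_ring R \<mm> by (rule curve_ring)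

lemma m_iff: "f \<in> \<mm> \<longleftrightarrow> f \<in> carrier R \<and> fps_nth f 0 = 0"
  using m_eq by blast

text \<open>With e the order of w, the power n + c of \<open>\<mm>\<close> consists of series of
  order at least (n + c) e \<ge> n e + c, because e \<ge> 1. As w^n has order n e,
  \<open>dvd_in_R\<close> divides them by w^n within R; the shift is the gap bound
  \<open>c\<close>.\<close>

lemma principal_reductionI:
  assumes w: "w \<in> \<mm>" "w \<noteq> 0" and min: "\<And>f. f \<in> \<mm> \<Longrightarrow> f \<noteq> 0 \<Longrightarrow> subdegree w \<le> subdegree f"
  shows "principal_reduction w"
proof -
  define e where "e = subdegree w"
  have e: "0 < e" using w unfolding e_def by (metis m_iff gr0I subdegree_eq_0_iff)
  have em: "fps_X ^ e dvd f" if "f \<in> \<mm>" for f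
    using min[OF that] by (cases "f = 0") (auto simp: fps_dvd_iff e_def)
  have pow: "fps_X ^ (n * e) dvd f" if "f \<in> \<mm> [^]\<^bsub>ideals_set R\<^esub> (n::nat)" for n f
    using that
  proof (induction n arbitrary: f)
    case (Suc n)
    from Suc.prems show ?case unfolding m_pow_Suc
    proof (induction f rule: ideal_prod.induct)
      case (prod i j)
      have "fps_X ^ (n * e) * fps_X ^ e dvd i * j" by (rule mult_dvd_mono[OF Suc.IH[OF prod(1)] em[OF prod(2)]])
      then show ?case by (simp add: power_add[symmetric] add.commute)
    qed simp
  qed simp
  have "\<exists>q\<in>carrier R. y = w [^]\<^bsub>R\<^esub> n \<otimes>\<^bsub>R\<^esub> q" if y: "y \<in> \<mm> [^]\<^bsub>ideals_set R\<^esub> (n + c)" for n y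
  proof -
    have "c \<le> c * e" using e by simp
    then have "subdegree (w ^ n) + c \<le> (n + c) * e" by (simp add: e_def[symmetric] algebra_simps)
    then have "fps_X ^ (subdegree (w ^ n) + c) dvd y"
      by (rule dvd_trans[OF le_imp_power_dvd pow[OF y]])
    moreover have "w ^ n \<in> carrier R" using m_carrier[OF w(1)] nat_pow_closed[of w n] by simp
    ultimately show ?thesis using dvd_in_R[of "w ^ n" y] w(2) by simp
  qed
  then show ?thesis unfolding principal_reduction_def using w by (simp only: ops) blast
qed

text \<open>If w has order e and generates \<open>\<mm>\<close>, then t^h = w r shows that each
  positive h in H leaves h - e in H. So e divides every element of H, in particular the neighbours c
  and c + 1, whence e = 1 and H contains all naturals.\<close>

lemma m_eq_principal_imp_UNIV:
  assumes w: "w \<in> \<mm>" and "\<And>y. y \<in> \<mm> \<Longrightarrow> \<exists>r\<in>carrier R. y = w * r"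
  shows "carrier R = UNIV"
proof -
  have Xh: "fps_X ^ h \<in> \<mm>" if "h \<in> H" "0 < h" for h unfolding m_iff using that X_pow_in by simp
  have "fps_X ^ Suc c \<in> \<mm>" by (rule Xh[OF conductor]) simp_all
  then have w0: "w \<noteq> 0" using assms(2) by (metis mult_zero_left fps_X_neq_zero power_not_zero)
  define e where "e = subdegree w"
  have e: "0 < e" using w w0 unfolding e_def by (metis m_iff gr0I subdegree_eq_0_iff)
  have eH: "e \<in> H" using w w0 inR_iff[of w] m_carrier[OF w] by (simp add: e_def)
  have step: "e \<le> h \<and> h - e \<in> H" if h: "h \<in> H" "0 < h" for h
  proof -
    obtain r where r: "r \<in> carrier R" "fps_X ^ h = w * r" using assms(2) Xh[OF h] by blast
    have r0: "r \<noteq> 0" using r(2) by (metis mult_zero_right fps_X_neq_zero power_not_zero)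
    have "h = e + subdegree r" using arg_cong[OF r(2), of subdegree] w0 r0 by (simp add: e_def)
    moreover have "subdegree r \<in> H" using r r0 by (auto simp: inR_iff)
    ultimately show ?thesis by simp
  qed
  have "e dvd h" if "h \<in> H" for h
    using that
  proof (induction h rule: less_induct)
    case (less h)
    show ?case
    proof (cases "h = 0")
      case False
      then have "e dvd h - e" "e \<le> h" using step[of h] less e by auto
      then show ?thesis by (simp add: dvd_minus_self)
    qed simp
  qed
  then have "e dvd c" "e dvd c + 1" using conductor by auto
  then have "e = 1" by (metis dvd_add_right_iff nat_dvd_1_iff_1)
  have "n \<in> H" for n by (induction n) (use zero_in eH \<open>e = 1\<close> add_in in \<open>auto dest: add_in[OF _ eH]\<close>)
  then show ?thesis by (auto simp: carrier_eq)
qed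

end

end

section \<open>Splitting off the maximal ideal\<close>

lemma mod_hom_zero:
  assumes "module R M" "module R N" "f \<in> mod_hom R M N"
  shows "f \<zero>\<^bsub>M\<^esub> = \<zero>\<^bsub>N\<^esub>"
proof -
  interpret M: module R M by fact
  interpret N: module R N by fact
  have "f (\<zero>\<^bsub>R\<^esub> \<odot>\<^bsub>M\<^esub> \<zero>\<^bsub>M\<^esub>) = \<zero>\<^bsub>R\<^esub> \<odot>\<^bsub>N\<^esub> f \<zero>\<^bsub>M\<^esub>" "f \<zero>\<^bsub>M\<^esub> \<in> carrier N"
    using assms(3) M.M.zero_closed M.R.zero_closed unfolding mod_hom_def by blast+
  then show ?thesis by simp
qed

text \<open>The complement of \<open>\<mm>\<close> in M is the image of a projection; it inherits
  finite generation this way, without a Noetherian argument.\<close>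

lemma fg_module_surj_image:
  assumes fg: "fg_module R M" and N: "module R N" and p: "p \<in> mod_hom R M N" and surj: "p ` carrier M = carrier N"
  shows "fg_module R N"
proof -
  interpret M: module R M using fg by (simp add: fg_module_def)
  interpret N: module R N by (rule N)
  obtain T where T: "finite T" "T \<subseteq> carrier M" "gen_submodule R M T = carrier M"
    using fg unfolding fg_module_def by blast
  have pT: "p ` T \<subseteq> carrier N" using T(2) surj by auto
  note G = N.submodule_gen[OF pT]
  note g = N.submoduleE[OF G]
  have hom: "p (x \<oplus>\<^bsub>M\<^esub> y) = p x \<oplus>\<^bsub>N\<^esub> p y" "p (r \<odot>\<^bsub>M\<^esub> x) = r \<odot>\<^bsub>N\<^esub> p x"
    if "x \<in> carrier M" "y \<in> carrier M" "r \<in> carrier R" for x y r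
    using p that unfolding mod_hom_def by auto
  define K where "K = {m \<in> carrier M. p m \<in> gen_submodule R N (p ` T)}"
  have "submodule K R M"
  proof (rule M.submoduleI)
    show "\<zero>\<^bsub>M\<^esub> \<in> K"
      using mod_hom_zero[OF M.module_axioms N p] N.submodule_zero_closed[OF G] by (simp add: K_def)
  next
    fix a assume a: "a \<in> K"
    have "\<ominus>\<^bsub>M\<^esub> a = (\<ominus>\<^bsub>R\<^esub> \<one>\<^bsub>R\<^esub>) \<odot>\<^bsub>M\<^esub> a" using a by (simp add: K_def M.smult_l_minus)
    then show "\<ominus>\<^bsub>M\<^esub> a \<in> K" using a g(4) hom(2) by (auto simp: K_def)
    fix b assume "b \<in> K"
    then show "a \<oplus>\<^bsub>M\<^esub> b \<in> K"
      using a g(5)[of "p a" "p b"] hom(1)[of a b "\<zero>\<^bsub>R\<^esub>"] by (auto simp: K_def)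
  next
    fix r a assume "r \<in> carrier R" "a \<in> K"
    then show "r \<odot>\<^bsub>M\<^esub> a \<in> K" using g(4) hom(2) by (auto simp: K_def)
  qed (auto simp: K_def)
  moreover have "T \<subseteq> K" using T(2) N.gen_incl[of "p ` T"] by (auto simp: K_def)
  ultimately have "carrier M \<subseteq> K" using M.gen_minimal T(3) by metis
  then have "p ` carrier M \<subseteq> gen_submodule R N (p ` T)" by (auto simp: K_def)
  then have "carrier N \<subseteq> gen_submodule R N (p ` T)" by (simp add: surj)
  then have "gen_submodule R N (p ` T) = carrier N" using N.gen_in_carrier[OF pT] by blast
  then show ?thesis unfolding fg_module_def using N T(1) pT by blast
qed

context curve_module
begin

text \<open>Division by w of single products is what builds the section below, and it passes easily
  to kernels, direct sums and isomorphic modules.\<close>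

lemma ulrich_iff_elementwise:
  assumes fg: "fg_module R M" and red: "principal_reduction w"
  shows "ulrich R \<mm> M \<longleftrightarrow> carrier M \<noteq> {\<zero>\<^bsub>M\<^esub>} \<and> torsion_free \<and>
    (\<forall>y\<in>\<mm>. \<forall>m\<in>carrier M. \<exists>m'\<in>carrier M. y \<odot>\<^bsub>M\<^esub> m = w \<odot>\<^bsub>M\<^esub> m')"
proof -
  have "submodule ((\<odot>\<^bsub>M\<^esub>) w ` carrier M) R M"
    using red unfolding principal_reduction_def by (intro submodule_image_smult carrier_is_submodule) auto
  then have "ideal_mult R \<mm> M \<subseteq> (\<odot>\<^bsub>M\<^esub>) w ` carrier M \<longleftrightarrow>
      (\<forall>y\<in>\<mm>. \<forall>m\<in>carrier M. y \<odot>\<^bsub>M\<^esub> m \<in> (\<odot>\<^bsub>M\<^esub>) w ` carrier M)"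
    using ideal_mult_minimal smult_in_ideal_mult by (meson subset_iff)
  then show ?thesis unfolding ulrich_iff[OF assms] by (auto simp: image_iff)
qed

text \<open>If \<open>f m\<^sub>0 = w\<close>, then sending \<open>a \<in> \<mm>\<close> to the unique \<open>m'\<close> with \<open>w m' = a m\<^sub>0\<close>
  is a section of \<open>f : M \<rightarrow> \<mm>\<close>.\<close>

lemma ulrich_splits_off_m:
  assumes fg: "fg_module R M" and ulrich: "ulrich R \<mm> M"
    and f: "f \<in> mod_hom R M (regular_module R)" and fm: "f ` carrier M \<subseteq> \<mm>"
    and m0: "m0 \<in> carrier M" and red: "principal_reduction (f m0)"
  defines "N \<equiv> M\<lparr>carrier := {m \<in> carrier M. f m = \<zero>}\<rparr>"
  shows "fg_module R N" and "carrier N = {\<zero>\<^bsub>N\<^esub>} \<or> ulrich R \<mm> N"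
    and "mod_isomorphic R M (direct_sum (ideal_module R \<mm>) N)"
proof -
  define w where "w = f m0"
  have w: "w \<in> \<mm>" "w \<noteq> \<zero>" and redw: "principal_reduction w"
    using red unfolding principal_reduction_def w_def by auto
  have wc: "w \<in> carrier R" using w by simp
  have tf: torsion_free and ex: "\<And>y m. y \<in> \<mm> \<Longrightarrow> m \<in> carrier M \<Longrightarrow> \<exists>m'\<in>carrier M. y \<odot>\<^bsub>M\<^esub> m = w \<odot>\<^bsub>M\<^esub> m'"
    using ulrich unfolding ulrich_iff_elementwise[OF fg redw] by blast+
  have fadd: "f (a \<oplus>\<^bsub>M\<^esub> b) = f a \<oplus> f b" if "a \<in> carrier M" "b \<in> carrier M" for a b
    using f that by (auto simp: mod_hom_def ideal_module_def)
  have fsmult: "f (r \<odot>\<^bsub>M\<^esub> a) = r \<otimes> f a" if "a \<in> carrier M" "r \<in> carrier R" for a r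
    using f that by (auto simp: mod_hom_def ideal_module_def)
  have fin: "f a \<in> \<mm>" if "a \<in> carrier M" for a using fm that by auto
  have fc: "f a \<in> carrier R" if "a \<in> carrier M" for a using fin[OF that] by simp
  have f0: "f \<zero>\<^bsub>M\<^esub> = \<zero>" using fsmult[of "\<zero>\<^bsub>M\<^esub>" \<zero>] fc[of "\<zero>\<^bsub>M\<^esub>"] by simp
  have fminus: "f (\<ominus>\<^bsub>M\<^esub> a) = \<ominus> f a" if "a \<in> carrier M" for a
    using fsmult[of a "\<ominus> \<one>"] that fc[OF that] by (simp add: smult_l_minus R.l_minus)
  \<comment> \<open>Quotients by w are unique, which will make the pointwise chosen map s
    linear.\<close>
  have winj: "a = b" if "a \<in> carrier M" "b \<in> carrier M" "w \<odot>\<^bsub>M\<^esub> a = w \<odot>\<^bsub>M\<^esub> b" for a b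
  proof -
    have "w \<odot>\<^bsub>M\<^esub> (a \<ominus>\<^bsub>M\<^esub> b) = \<zero>\<^bsub>M\<^esub>"
      using that wc by (simp add: a_minus_def smult_r_distr smult_r_minus M.r_neg)
    then have "a \<ominus>\<^bsub>M\<^esub> b = \<zero>\<^bsub>M\<^esub>" using torsion_freeD[OF tf wc _ _ w(2)] that by simp
    then show ?thesis using minus_eq_zero_imp_eq that by blast
  qed
  have "\<exists>s. \<forall>a\<in>\<mm>. s a \<in> carrier M \<and> a \<odot>\<^bsub>M\<^esub> m0 = w \<odot>\<^bsub>M\<^esub> s a" using ex[OF _ m0] by metis
  then obtain s where sc: "\<And>a. a \<in> \<mm> \<Longrightarrow> s a \<in> carrier M"
    and s: "\<And>a. a \<in> \<mm> \<Longrightarrow> a \<odot>\<^bsub>M\<^esub> m0 = w \<odot>\<^bsub>M\<^esub> s a" by blast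
  \<comment> \<open>Apply f to w s(a) = a m_0, use f(m_0) = w, and cancel w in the domain R.\<close>
  have fs: "f (s a) = a" if a: "a \<in> \<mm>" for a
  proof -
    have "w \<otimes> f (s a) = f (a \<odot>\<^bsub>M\<^esub> m0)" using s[OF a] fsmult[OF sc[OF a] wc] by simp
    also have "\<dots> = w \<otimes> a" using fsmult[OF m0] a by (simp add: w_def[symmetric] R.m_comm wc)
    finally show ?thesis using w(2) wc fc[OF sc[OF a]] a by (simp add: m_lcancel)
  qed
  have sadd: "s (a \<oplus> b) = s a \<oplus>\<^bsub>M\<^esub> s b" if a: "a \<in> \<mm>" and b: "b \<in> \<mm>" for a b
  proof (rule winj)
    have ab: "a \<oplus> b \<in> \<mm>" using additive_subgroup.a_closed[OF ideal.axioms(1)[OF m_ideal]] a b by blast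
    show "s (a \<oplus> b) \<in> carrier M" "s a \<oplus>\<^bsub>M\<^esub> s b \<in> carrier M" using sc ab a b by auto
    show "w \<odot>\<^bsub>M\<^esub> s (a \<oplus> b) = w \<odot>\<^bsub>M\<^esub> (s a \<oplus>\<^bsub>M\<^esub> s b)"
      using s[OF ab] s[OF a] s[OF b] a b m0 sc wc by (simp add: smult_l_distr smult_r_distr)
  qed
  have ssmult: "s (r \<otimes> a) = r \<odot>\<^bsub>M\<^esub> s a" if a: "a \<in> \<mm>" and r: "r \<in> carrier R" for a r
  proof (rule winj)
    have ra: "r \<otimes> a \<in> \<mm>" using ideal.I_l_closed[OF m_ideal a r] .
    show "s (r \<otimes> a) \<in> carrier M" "r \<odot>\<^bsub>M\<^esub> s a \<in> carrier M" using sc ra a r by auto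
    have "w \<odot>\<^bsub>M\<^esub> s (r \<otimes> a) = r \<odot>\<^bsub>M\<^esub> (w \<odot>\<^bsub>M\<^esub> s a)"
      using s[OF ra] s[OF a] a r m0 by (simp add: smult_assoc1)
    then show "w \<odot>\<^bsub>M\<^esub> s (r \<otimes> a) = w \<odot>\<^bsub>M\<^esub> (r \<odot>\<^bsub>M\<^esub> s a)"
      using sc[OF a] r wc by (metis R.m_comm smult_assoc1)
  qed
  define K where "K = {m \<in> carrier M. f m = \<zero>}"
  have Nsel: "carrier N = K" "(\<oplus>\<^bsub>N\<^esub>) = (\<oplus>\<^bsub>M\<^esub>)" "(\<odot>\<^bsub>N\<^esub>) = (\<odot>\<^bsub>M\<^esub>)" "\<zero>\<^bsub>N\<^esub> = \<zero>\<^bsub>M\<^esub>"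
    by (simp_all add: N_def K_def)
  have K: "submodule K R M"
    by (rule submoduleI) (auto simp: K_def f0 fadd fsmult fminus)
  have Nmod: "module R N"
    using submodule.submodule_is_module[OF K module_axioms] by (simp add: N_def K_def)
  interpret N: curve_module R N \<mm>
    using Nmod curve_ring_axioms by (simp add: curve_module_def)
  \<comment> \<open>\<open>p\<close> is the projection of M onto the kernel K of f along the image
    of s.\<close>
  define p where "p m = m \<ominus>\<^bsub>M\<^esub> s (f m)" for m
  have pK: "p m \<in> K" if "m \<in> carrier M" for m
    using that sc[OF fin[OF that]] fin[OF that] fc[OF that]
    by (simp add: p_def K_def a_minus_def fadd fminus fs R.r_neg)
  have p_id: "p m = m" if "m \<in> K" for m
  proof -
    have m: "m \<in> carrier M" "f m = \<zero>" using that by (auto simp: K_def)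
    have "\<zero> \<in> \<mm>" using fin[OF m(1)] m(2) by simp
    then have "s \<zero> = \<zero>\<^bsub>M\<^esub>" using ssmult[of \<zero> \<zero>] sc by simp
    then show ?thesis using m M.minus_equality[of "\<zero>\<^bsub>M\<^esub>" "\<zero>\<^bsub>M\<^esub>"] by (simp add: p_def a_minus_def)
  qed
  have padd: "p (a \<oplus>\<^bsub>M\<^esub> b) = p a \<oplus>\<^bsub>M\<^esub> p b" if "a \<in> carrier M" "b \<in> carrier M" for a b
    using that sc[OF fin[OF that(1)]] sc[OF fin[OF that(2)]] fin[OF that(1)] fin[OF that(2)]
    by (simp add: p_def fadd sadd a_minus_def M.minus_add M.a_ac)
  have psmult: "p (r \<odot>\<^bsub>M\<^esub> a) = r \<odot>\<^bsub>M\<^esub> p a" if "a \<in> carrier M" "r \<in> carrier R" for a r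
    using that sc[OF fin[OF that(1)]] fin[OF that(1)]
    by (simp add: p_def fsmult ssmult a_minus_def smult_r_distr smult_r_minus)
  have "p \<in> mod_hom R M N" using pK padd psmult by (auto simp: mod_hom_def Nsel)
  moreover have "p ` carrier M = carrier N"
    unfolding Nsel
  proof
    show "K \<subseteq> p ` carrier M"
    proof
      fix m assume "m \<in> K"
      then show "m \<in> p ` carrier M" using p_id[of m] by (intro image_eqI[of _ _ m]) (auto simp: K_def)
    qed
  qed (use pK in auto)
  ultimately show fgN: "fg_module R N" by (rule fg_module_surj_image[OF fg Nmod])
  show "carrier N = {\<zero>\<^bsub>N\<^esub>} \<or> ulrich R \<mm> N"
  proof (cases "carrier N = {\<zero>\<^bsub>N\<^esub>}")
    case False
    have "N.torsion_free" using tf unfolding N.torsion_free_def torsion_free_def by (auto simp: Nsel K_def)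
    moreover have "\<exists>m'\<in>carrier N. y \<odot>\<^bsub>N\<^esub> m = w \<odot>\<^bsub>N\<^esub> m'" if y: "y \<in> \<mm>" and m: "m \<in> carrier N" for y m
    proof -
      have mc: "m \<in> carrier M" "f m = \<zero>" using m by (auto simp: Nsel K_def)
      obtain m' where m': "m' \<in> carrier M" "y \<odot>\<^bsub>M\<^esub> m = w \<odot>\<^bsub>M\<^esub> m'" using ex[OF y mc(1)] by blast
      \<comment> \<open>Dividing an element of the kernel by w stays in the kernel, since R has no
        zero divisors; so N inherits the Ulrich condition.\<close>
      have "w \<otimes> f m' = \<zero>" using arg_cong[OF m'(2), of f] fsmult[OF mc(1), of y] fsmult[OF m'(1) wc] y mc(2) by simp
      then have "f m' = \<zero>" using integral[OF _ wc fc[OF m'(1)]] w(2) by blast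
      then show ?thesis using m' by (auto simp: Nsel K_def)
    qed
    ultimately show ?thesis using N.ulrich_iff_elementwise[OF fgN redw] False by blast
  qed simp
  define D where "D = direct_sum (ideal_module R \<mm>) N"
  have Dsel: "carrier D = \<mm> \<times> K" "(a, b) \<oplus>\<^bsub>D\<^esub> (a', b') = (a \<oplus> a', b \<oplus>\<^bsub>M\<^esub> b')"
      "r \<odot>\<^bsub>D\<^esub> (a, b) = (r \<otimes> a, r \<odot>\<^bsub>M\<^esub> b)" for a a' b b' r
    by (simp_all add: D_def direct_sum_def Nsel ideal_module_def)
  \<comment> \<open>The inverse sends (a, n) to s(a) + n.\<close>
  define g where "g m = (f m, p m)" for m
  have "g \<in> mod_hom R M D"
    using fin pK padd psmult fadd fsmult by (auto simp: mod_hom_def g_def Dsel)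
  moreover have "bij_betw g (carrier M) (carrier D)"
    unfolding bij_betw_def
  proof
    have rec: "m = p m \<oplus>\<^bsub>M\<^esub> s (f m)" if "m \<in> carrier M" for m
      using that sc[OF fin[OF that]] by (simp add: p_def a_minus_def M.a_assoc M.l_neg)
    show "inj_on g (carrier M)"
    proof (rule inj_onI)
      fix m m' assume m: "m \<in> carrier M" "m' \<in> carrier M" "g m = g m'"
      then have "f m = f m'" "p m = p m'" by (simp_all add: g_def)
      then show "m = m'" using rec[OF m(1)] rec[OF m(2)] by simp
    qed
    show "g ` carrier M = carrier D"
    proof
      show "carrier D \<subseteq> g ` carrier M"
      proof
        fix z assume "z \<in> carrier D"
        then obtain a n where an: "z = (a, n)" "a \<in> \<mm>" "n \<in> K" by (auto simp: Dsel)
        have n: "n \<in> carrier M" "f n = \<zero>" using an by (auto simp: K_def)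
        have fa: "f (s a \<oplus>\<^bsub>M\<^esub> n) = a" using n an(2) sc[OF an(2)] by (simp add: fadd fs)
        have "p (s a \<oplus>\<^bsub>M\<^esub> n) = n" using n sc[OF an(2)] by (simp add: p_def fa add_minus_cancel)
        then have "z = g (s a \<oplus>\<^bsub>M\<^esub> n)" using fa an(1) by (simp add: g_def)
        then show "z \<in> g ` carrier M" using n sc[OF an(2)] by blast
      qed
    qed (use fin pK in \<open>auto simp: g_def Dsel\<close>)
  qed
  ultimately show "mod_isomorphic R M (direct_sum (ideal_module R \<mm>) N)"
    unfolding mod_isomorphic_def D_def by blast
qed

text \<open>Both the Ulrich condition and the bound on the trace rest on division by w, which is
  transported from the two summands to M. The hypothesis \<open>not_principal\<close> excludes
  homomorphisms that take a unit as value.\<close>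

lemma full_trace_ulrich_of_direct_sum:
  assumes fg: "fg_module R M" and red: "principal_reduction w" and um: "ulrich R \<mm> (ideal_module R \<mm>)"
    and fgN: "fg_module R N" and N: "carrier N = {\<zero>\<^bsub>N\<^esub>} \<or> ulrich R \<mm> N"
    and iso: "mod_isomorphic R M (direct_sum (ideal_module R \<mm>) N)"
    and not_principal: "\<not> (\<forall>y\<in>\<mm>. \<exists>r\<in>carrier R. y = w \<otimes> r)"
  shows "full_trace_ulrich R \<mm> M"
proof -
  interpret T: curve_module R "ideal_module R \<mm>" \<mm> by (rule curve_module_ideal_module[OF m_ideal])
  interpret N: curve_module R N \<mm>
    using fgN curve_ring_axioms by (simp add: curve_module_def fg_module_def)
  define D where "D = direct_sum (ideal_module R \<mm>) N"
  have Dsel: "carrier D = \<mm> \<times> carrier N" "(a, b) \<oplus>\<^bsub>D\<^esub> (a', b') = (a \<oplus> a', b \<oplus>\<^bsub>N\<^esub> b')"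
      "r \<odot>\<^bsub>D\<^esub> (a, b) = (r \<otimes> a, r \<odot>\<^bsub>N\<^esub> b)" "\<zero>\<^bsub>D\<^esub> = (\<zero>, \<zero>\<^bsub>N\<^esub>)" for a a' b b' r
    by (simp_all add: D_def direct_sum_def ideal_module_def)
  have Dmod: "module R D"
    unfolding D_def by (rule module_direct_sum[OF T.module_axioms N.module_axioms])
  obtain g where g: "g \<in> mod_hom R M D" and bij: "bij_betw g (carrier M) (carrier D)"
    using iso unfolding mod_isomorphic_def D_def by blast
  have gsmult: "g (r \<odot>\<^bsub>M\<^esub> m) = r \<odot>\<^bsub>D\<^esub> g m" if "r \<in> carrier R" "m \<in> carrier M" for r m
    using g that by (simp add: mod_hom_def)
  have g0: "g \<zero>\<^bsub>M\<^esub> = \<zero>\<^bsub>D\<^esub>" by (rule mod_hom_zero[OF module_axioms Dmod g])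
  have ginj: "a = b" if "a \<in> carrier M" "b \<in> carrier M" "g a = g b" for a b
    using bij that by (auto simp: bij_betw_def dest: inj_onD)
  have gc: "g m \<in> \<mm> \<times> carrier N" if "m \<in> carrier M" for m using g that Dsel(1) by (auto simp: mod_hom_def)
  have gsurj: "\<exists>m\<in>carrier M. g m = z" if "z \<in> \<mm> \<times> carrier N" for z
    using bij that Dsel(1) unfolding bij_betw_def by (metis imageE)
  have w: "w \<in> \<mm>" "w \<in> carrier R" using red unfolding principal_reduction_def by auto
  \<comment> \<open>For N = 0 both properties hold trivially, so the two cases for N need not be
    kept apart any further.\<close>
  have tfN: "N.torsion_free" and exN: "\<And>y n. y \<in> \<mm> \<Longrightarrow> n \<in> carrier N \<Longrightarrow> \<exists>n'\<in>carrier N. y \<odot>\<^bsub>N\<^esub> n = w \<odot>\<^bsub>N\<^esub> n'"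
    using N N.ulrich_iff_elementwise[OF fgN red] w(2) by (auto simp: N.torsion_free_def)
  have exm: "\<exists>a'\<in>\<mm>. y \<otimes> a = w \<otimes> a'" if "y \<in> \<mm>" "a \<in> \<mm>" for y a
    using um that unfolding T.ulrich_iff_elementwise[OF fg_module_m red] by (simp add: ideal_module_def)
  have nonzero: "carrier M \<noteq> {\<zero>\<^bsub>M\<^esub>}"
  proof
    assume eq: "carrier M = {\<zero>\<^bsub>M\<^esub>}"
    have "a = \<zero>" if "a \<in> \<mm>" for a
      using gsurj[of "(a, \<zero>\<^bsub>N\<^esub>)"] that eq g0 Dsel(4) by auto
    then show False using m_nonzero w(1) by blast
  qed
  have tf: torsion_free
    unfolding torsion_free_def
  proof (intro ballI impI)
    fix r m assume r: "r \<in> carrier R" and m: "m \<in> carrier M" and rm: "r \<odot>\<^bsub>M\<^esub> m = \<zero>\<^bsub>M\<^esub>"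
    obtain a n where an: "g m = (a, n)" "a \<in> \<mm>" "n \<in> carrier N" using gc[OF m] by auto
    have "r \<otimes> a = \<zero>" "r \<odot>\<^bsub>N\<^esub> n = \<zero>\<^bsub>N\<^esub>" using gsmult[OF r m] rm g0 an Dsel by auto
    then have "r = \<zero> \<or> g m = g \<zero>\<^bsub>M\<^esub>"
      using integral[of r a] N.torsion_freeD[OF tfN r an(3)] an r g0 Dsel(4) by auto
    then show "r = \<zero> \<or> m = \<zero>\<^bsub>M\<^esub>" using ginj[OF m M.zero_closed] by blast
  qed
  have ex: "\<exists>m'\<in>carrier M. y \<odot>\<^bsub>M\<^esub> m = w \<odot>\<^bsub>M\<^esub> m'" if y: "y \<in> \<mm>" and m: "m \<in> carrier M" for y m
  proof -
    obtain a n where an: "g m = (a, n)" "a \<in> \<mm>" "n \<in> carrier N" using gc[OF m] by auto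
    obtain a' n' where a'n': "a' \<in> \<mm>" "y \<otimes> a = w \<otimes> a'" "n' \<in> carrier N" "y \<odot>\<^bsub>N\<^esub> n = w \<odot>\<^bsub>N\<^esub> n'"
      using exm[OF y an(2)] exN[OF y an(3)] by blast
    obtain m' where m': "m' \<in> carrier M" "g m' = (a', n')" using gsurj[of "(a', n')"] a'n' by auto
    have "g (y \<odot>\<^bsub>M\<^esub> m) = g (w \<odot>\<^bsub>M\<^esub> m')"
      using gsmult m m' y w a'n' an by (simp add: Dsel)
    then show ?thesis using ginj[of "y \<odot>\<^bsub>M\<^esub> m" "w \<odot>\<^bsub>M\<^esub> m'"] m m' y w by auto
  qed
  have ulrich: "ulrich R \<mm> M" using ulrich_iff_elementwise[OF fg red] nonzero tf ex by blast
  define F where "F = (\<Union>f \<in> mod_hom R M (regular_module R). f ` carrier M)"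
  have Fm: "F \<subseteq> \<mm>"
  proof
    fix u assume "u \<in> F"
    then obtain f m where f: "f \<in> mod_hom R M (regular_module R)" and m: "m \<in> carrier M" "u = f m"
      by (auto simp: F_def)
    have fc: "f a \<in> carrier R" if "a \<in> carrier M" for a
      using f that by (auto simp: mod_hom_def ideal_module_def)
    have fsmult: "f (r \<odot>\<^bsub>M\<^esub> a) = r \<otimes> f a" if "a \<in> carrier M" "r \<in> carrier R" for a r
      using f that by (auto simp: mod_hom_def ideal_module_def)
    show "u \<in> \<mm>"
    proof (rule ccontr)
      assume "u \<notin> \<mm>"
      then have u: "u \<in> Units R" using unitI fc m by simp
      \<comment> \<open>If f(m) = u is a unit, then y m = w m' gives y u = w f(m'), so w would
        divide every element of \<open>\<mm>\<close>.\<close>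
      have "\<exists>r\<in>carrier R. y = w \<otimes> r" if y: "y \<in> \<mm>" for y
      proof -
        obtain m' where m': "m' \<in> carrier M" "y \<odot>\<^bsub>M\<^esub> m = w \<odot>\<^bsub>M\<^esub> m'" using ex[OF y m(1)] by blast
        have "y \<otimes> u = w \<otimes> f m'" using arg_cong[OF m'(2), of f] fsmult[OF m(1), of y] fsmult[OF m'(1) w(2)] m(2) y by simp
        then have "(y \<otimes> u) \<otimes> inv u = w \<otimes> (f m' \<otimes> inv u)"
          using fc[OF m'(1)] u w by (simp add: R.m_assoc)
        then have "y = w \<otimes> (f m' \<otimes> inv u)" using u y by (simp add: R.m_assoc R.Units_closed)
        then show ?thesis using fc[OF m'(1)] u by blast
      qed
      then show False using not_principal by blast
    qed
  qed
  have "fst \<circ> g \<in> mod_hom R M (regular_module R)"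
  proof -
    have "g (a \<oplus>\<^bsub>M\<^esub> b) = g a \<oplus>\<^bsub>D\<^esub> g b" if "a \<in> carrier M" "b \<in> carrier M" for a b
      using g that by (simp add: mod_hom_def)
    moreover have "fst (u \<oplus>\<^bsub>D\<^esub> v) = fst u \<oplus> fst v" "fst (r \<odot>\<^bsub>D\<^esub> u) = r \<otimes> fst u" for u v r
      using Dsel(2,3) by (cases u; cases v; simp)+
    moreover have "fst (g m) \<in> carrier R" if "m \<in> carrier M" for m using gc[OF that] by auto
    ultimately show ?thesis by (auto simp: mod_hom_def ideal_module_def gsmult)
  qed
  \<comment> \<open>The projection to the first summand, followed by the inclusion of
    \<open>\<mm>\<close> into R, is one homomorphism with all of \<open>\<mm>\<close> as its
    image.\<close>
  moreover have "\<mm> \<subseteq> (fst \<circ> g) ` carrier M"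
  proof
    fix a assume "a \<in> \<mm>"
    then obtain m where "m \<in> carrier M" "g m = (a, \<zero>\<^bsub>N\<^esub>)" using gsurj[of "(a, \<zero>\<^bsub>N\<^esub>)"] by auto
    then show "a \<in> (fst \<circ> g) ` carrier M" by force
  qed
  ultimately have "\<mm> \<subseteq> F" unfolding F_def by blast
  then have "mod_trace R M = \<mm>"
    using Fm genideal_m unfolding mod_trace_def F_def[symmetric] by simp
  then show ?thesis using ulrich unfolding full_trace_ulrich_def by blast
qed

end

text \<open>The reduction is found inside a given generating set: if every element of F had order
  above the least order e, then F would generate an ideal without t^e. Applied to the set of all
  values of homomorphisms, it yields a reduction that is the value of one homomorphism.\<close>

lemma (in semigroup_ring) ex_principal_reduction:
  assumes max: "maximalideal \<mm> R" and F: "F \<subseteq> \<mm>" "genideal R F = \<mm>"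
  shows "\<exists>w\<in>F. curve_ring.principal_reduction R \<mm> w"
proof -
  define e where "e = (LEAST h. h \<in> H \<and> 0 < h)"
  have "Suc c \<in> H \<and> 0 < Suc c" using conductor by simp
  then have e: "e \<in> H \<and> 0 < e" unfolding e_def by (rule LeastI)
  have min: "e \<le> h" if "h \<in> H" "0 < h" for h unfolding e_def using that by (intro Least_le) simp
  have sub: "e \<le> subdegree f" if "f \<in> \<mm>" "f \<noteq> 0" for f
    using that min[of "subdegree f"] m_iff[OF max, of f] inR_iff[of f]
    by (metis gr0I nth_subdegree_nonzero)
  have "\<exists>w\<in>F. w \<noteq> 0 \<and> subdegree w = e"
  proof (rule ccontr)
    assume none: "\<not> (\<exists>w\<in>F. w \<noteq> 0 \<and> subdegree w = e)"
    define I where "I = {f \<in> carrier R. fps_X ^ Suc e dvd f}"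
    have "ideal I R"
    proof (rule idealI[OF ring_axioms])
      have "0 \<in> I" using zero_closed by (simp add: I_def)
      moreover have "\<ominus>\<^bsub>R\<^esub> f \<in> I" if "f \<in> I" for f
        using that minus_eq'[of f] a_inv_closed[of f] by (simp add: I_def)
      moreover have "f + g \<in> I" if "f \<in> I" "g \<in> I" for f g
        using that a_closed[of f g] by (simp add: I_def dvd_add del: power_Suc)
      ultimately show "subgroup I (add_monoid R)"
        by (intro add.subgroupI) (auto simp: a_inv_def[symmetric], simp add: I_def)
      show "x \<otimes>\<^bsub>R\<^esub> a \<in> I" "a \<otimes>\<^bsub>R\<^esub> x \<in> I" if "a \<in> I" "x \<in> carrier R" for a x
        using that m_closed[of x a] m_closed[of a x] by (auto simp: I_def simp del: power_Suc)
    qed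
    moreover have "F \<subseteq> I"
    proof
      fix f assume f: "f \<in> F"
      then have "Suc e \<le> subdegree f" if "f \<noteq> 0" using sub[of f] none F(1) that by fastforce
      then show "f \<in> I"
        using f F(1) m_iff[OF max, of f] by (cases "f = 0") (auto simp: I_def fps_dvd_iff simp del: power_Suc)
    qed
    ultimately have "\<mm> \<subseteq> I" unfolding F(2)[symmetric] by (rule genideal_minimal)
    moreover have "fps_X ^ e \<in> \<mm>" using e X_pow_in m_iff[OF max] by simp
    ultimately have "fps_X ^ Suc e dvd (fps_X ^ e :: 'k fps)" by (auto simp: I_def)
    then show False by (simp add: fps_dvd_iff del: power_Suc)
  qed
  then obtain w where "w \<in> F" "w \<noteq> 0" "subdegree w = e" by blast
  then show ?thesis using principal_reductionI[OF max, of w] sub F(1) by blast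
qed

lemma semigroup_ring_numerical_semigroup_ring:
  assumes "finite A" "0 \<notin> A" "Gcd A = 1"
  shows "\<exists>H c. semigroup_ring H (numerical_semigroup_ring A :: 'k::field fps ring) c"
proof -
  define H where "H = {m. \<exists>\<nu> :: nat \<Rightarrow> nat. (\<Sum>a\<in>A. \<nu> a * a) = m}"
  have zero: "0 \<in> H" by (auto simp: H_def intro!: exI[of _ "\<lambda>_. 0"])
  have add: "m + n \<in> H" if mn: "m \<in> H" "n \<in> H" for m n
  proof -
    obtain \<mu> \<nu> :: "nat \<Rightarrow> nat" where "(\<Sum>a\<in>A. \<mu> a * a) = m" "(\<Sum>a\<in>A. \<nu> a * a) = n"
      using mn by (auto simp: H_def)
    then have "(\<Sum>a\<in>A. (\<mu> a + \<nu> a) * a) = m + n"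
      by (simp add: sum.distrib algebra_simps)
    then show ?thesis unfolding H_def by (intro CollectI exI[of _ "\<lambda>a. \<mu> a + \<nu> a"])
  qed
  have "a \<in> H" if a: "a \<in> A" for a
  proof -
    have "(\<Sum>b\<in>A. (if b = a then 1 else 0) * b) = (\<Sum>b\<in>A. if b = a then b else 0)"
      by (rule sum.cong) auto
    also have "\<dots> = a" using assms(1) a by simp
    finally show ?thesis unfolding H_def by (intro CollectI exI)
  qed
  then have "d = 1" if "\<And>h. h \<in> H \<Longrightarrow> d dvd h" for d
    using that assms(3) Gcd_greatest[of A d] by auto
  then obtain c where c: "\<forall>n\<ge>c. n \<in> H" using additive_nat_set_cofinite[OF zero add] by blast
  have "semigroup_ring H (numerical_semigroup_ring A :: 'k fps ring) c"
    by (rule semigroup_ring.intro)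
       (use zero add c domain_numerical_semigroup_ring[OF assms(1,2)] in
        \<open>auto simp: numerical_semigroup_ring_def ring_of_type_algebra_def H_def
          semigroup_series_eq_support[OF assms(1,2)]\<close>)
  then show ?thesis by blast
qed

theorem proposition1p4:
  fixes A :: "nat set"
    and R :: "'k::field fps ring"
    and \<mm> :: "'k fps set"
    and M :: "('k fps, 'b) module"
  assumes "finite A" and "0 \<notin> A" and "Gcd A = 1"
    and "R = numerical_semigroup_ring A"
    and "carrier R \<noteq> UNIV"
    and "maximalideal \<mm> R"
    and "minimal_multiplicity R \<mm>"
    and "fg_module R M"
  shows "full_trace_ulrich R \<mm> M \<longleftrightarrow>
    (\<exists>N :: ('k fps, 'b) module.
       fg_module R N \<and> (carrier N = {\<zero>\<^bsub>N\<^esub>} \<or> ulrich R \<mm> N) \<and>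
       mod_isomorphic R M (direct_sum (ideal_module R \<mm>) N))"
proof -
  obtain H c where "semigroup_ring H R c"
    using semigroup_ring_numerical_semigroup_ring[OF assms(1-3)] assms(4) by blast
  then interpret S: semigroup_ring H R c .
  interpret C: curve_ring R \<mm> by (rule S.curve_ring[OF assms(6)])
  interpret M: curve_module R M \<mm>
    using assms(8) C.curve_ring_axioms by (simp add: curve_module_def fg_module_def)
  show ?thesis
  proof
    assume "full_trace_ulrich R \<mm> M"
    then have u: "ulrich R \<mm> M" and tr: "mod_trace R M = \<mm>" by (simp_all add: full_trace_ulrich_def)
    define F where "F = (\<Union>f \<in> mod_hom R M (regular_module R). f ` carrier M)"
    have Fc: "F \<subseteq> carrier R" by (auto simp: F_def mod_hom_def ideal_module_def)
    have FI: "genideal R F = \<mm>" using tr by (simp add: mod_trace_def F_def)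
    then have Fm: "F \<subseteq> \<mm>" using S.genideal_self[OF Fc] by simp
    obtain w where w: "w \<in> F" "C.principal_reduction w"
      using S.ex_principal_reduction[OF assms(6) Fm FI] by blast
    then obtain f m0 where f: "f \<in> mod_hom R M (regular_module R)" "m0 \<in> carrier M" "w = f m0"
      by (auto simp: F_def)
    then have "f ` carrier M \<subseteq> \<mm>" using Fm by (auto simp: F_def)
    \<comment> \<open>The witness N is the kernel of f. Its elements are elements of M, so it lives
      in the same type as M.\<close>
    from M.ulrich_splits_off_m[OF assms(8) u f(1) this f(2) w(2)[unfolded f(3)]]
    show "\<exists>N :: ('k fps, 'b) module.
       fg_module R N \<and> (carrier N = {\<zero>\<^bsub>N\<^esub>} \<or> ulrich R \<mm> N) \<and>
       mod_isomorphic R M (direct_sum (ideal_module R \<mm>) N)" by blast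
  next
    assume "\<exists>N :: ('k fps, 'b) module.
       fg_module R N \<and> (carrier N = {\<zero>\<^bsub>N\<^esub>} \<or> ulrich R \<mm> N) \<and>
       mod_isomorphic R M (direct_sum (ideal_module R \<mm>) N)"
    then obtain N :: "('k fps, 'b) module" where N: "fg_module R N" "carrier N = {\<zero>\<^bsub>N\<^esub>} \<or> ulrich R \<mm> N"
      "mod_isomorphic R M (direct_sum (ideal_module R \<mm>) N)" by blast
    obtain w where w: "w \<in> \<mm>" "C.principal_reduction w"
      using S.ex_principal_reduction[OF assms(6) subset_refl C.genideal_m] by blast
    \<comment> \<open>Here R \<noteq> k[[t]] enters: a principal maximal ideal would make R the full
      power series ring.\<close>
    have "\<not> (\<forall>y\<in>\<mm>. \<exists>r\<in>carrier R. y = w \<otimes>\<^bsub>R\<^esub> r)"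
      using S.m_eq_principal_imp_UNIV[OF assms(6) w(1)] assms(5) by auto
    then show "full_trace_ulrich R \<mm> M"
      using M.full_trace_ulrich_of_direct_sum[OF assms(8) w(2)
          C.minimal_multiplicity_imp_ulrich_m[OF w(2) assms(7)] N] by blast
  qed
qed

end
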